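(* If the EDSM problem can be solved in $\mathcal{O}(nm^{1.5-\epsilon}+N)$ time, for some $\epsilon>0$, by a combinatorial algorithm, then there exists a truly subcubic combinatorial algorithm for the Triangle Detection problem.
   Context: Strings are over a finite ordered alphabet $\Sigma$; $T[i..j]$ denotes the substring of $T$ from position $i$ to $j$ (positions start at 1). An elastic-degenerate (ED) string $\tilde T=\tilde T[1]\cdots\tilde T[n]$ is a sequence of $n$ finite non-empty sets of strings over $\Sigma$ (a set may contain the empty string $\varepsilon$); $n$ is its length and its size $N$ is the total length of all strings in all sets. A string $P$ matches an ED string $\tilde X$ of length $k$ if either $k=1$ and $P$ is a substring of some string in $\tilde X[1]$, or $k>1$ and $P=P_1\cdots P_k$ where $P_1$ is a suffix of some string in $\tilde X[1]$, $P_k$ is a prefix of some string in $\tilde X[k]$, and $P_i\in\tilde X[i]$ for $1<i<k$. An occurrence of $P$ ends at position $j$ of $\tilde T$ if $P$ matches $\tilde T[i]\cdots\tilde T[j]$ for some $i\le j$. The EDSM problem: given a string $P$ of length $m$ and an ED string $\tilde T$ of length $n$ and size $N\ge m$, report all positions of $\tilde T$ where at least one occurrence of $P$ ends. Triangle Detection (TD): given three $\mathcal{N}\times\mathcal{N}$ Boolean matrices $A,B,C$, decide whether there exist $i,j,k$ with $A[i,j]=B[j,k]=C[k,i]=1$. An algorithm for TD is truly subcubic if it runs in $\mathcal{O}(\mathcal{N}^{3-\delta})$ time for some $\delta>0$. *)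

theory Defs
  imports
    Complex_Main
    "HOL-Library.Sublist"
    "HOL-Library.More_List"
    "Jordan_Normal_Form.Matrix"
begin

section \<open>Elastic-degenerate strings\<close>

type_synonym 'a ed_string = "'a list set list"

definition ed_string :: "'a set \<Rightarrow> 'a ed_string \<Rightarrow> bool" where
  "ed_string \<Sigma> T \<longleftrightarrow> (\<forall>X \<in> set T. finite X \<and> X \<noteq> {} \<and> X \<subseteq> lists \<Sigma>)"

definition ed_size :: "'a ed_string \<Rightarrow> nat" where
  "ed_size T = (\<Sum>X\<leftarrow>T. \<Sum>w\<in>X. length w)"

definition matches :: "'a list \<Rightarrow> 'a ed_string \<Rightarrow> bool" where
  "matches P X \<longleftrightarrow>
     (length X = 1 \<and> (\<exists>w \<in> X ! 0. sublist P w)) \<or>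
     (length X > 1 \<and>
       (\<exists>Ps. length Ps = length X \<and> P = concat Ps \<and>
          (\<exists>w \<in> X ! 0. suffix (Ps ! 0) w) \<and>
          (\<exists>w \<in> X ! (length X - 1). prefix (Ps ! (length X - 1)) w) \<and>
          (\<forall>i. 0 < i \<and> i < length X - 1 \<longrightarrow> Ps ! i \<in> X ! i)))"

text \<open>Positions of an ED string are counted from 1; the list inside is the segment from
  position \<open>i\<close> to position \<open>j\<close>, both included.\<close>

definition occurrence_ends :: "'a list \<Rightarrow> 'a ed_string \<Rightarrow> nat set" where
  "occurrence_ends P T =
     {j. \<exists>i. 1 \<le> i \<and> i \<le> j \<and> j \<le> length T \<and> matches P (drop (i - 1) (take j T))}"


section \<open>Triangles\<close>

definition has_triangle :: "nat \<Rightarrow> bool mat \<Rightarrow> bool mat \<Rightarrow> bool mat \<Rightarrow> bool" where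
  "has_triangle N A B C \<longleftrightarrow>
     (\<exists>i<N. \<exists>j<N. \<exists>k<N. A $$ (i, j) \<and> B $$ (j, k) \<and> C $$ (k, i))"


section \<open>A word RAM\<close>

text \<open>
  The memory consists of registers and of arrays; a program mentions only finitely many of either
  by name. Every instruction and every test costs one time unit. A run is relative to a bound
  \<open>W\<close> on the values that fit into a word: an instruction whose result is not below \<open>W\<close> has no
  transition, so a terminating run never overflows.
\<close>

datatype loc = Reg nat | Cell nat nat

type_synonym store = "loc \<Rightarrow> nat"

datatype binop = Add | Sub | Mul | Div | Mod | And | Or | Xor | Less | Equal

fun binop_val :: "binop \<Rightarrow> nat \<Rightarrow> nat \<Rightarrow> nat" where
  "binop_val Add a b = a + b"
| "binop_val Sub a b = a - b"
| "binop_val Mul a b = a * b"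
| "binop_val Div a b = a div b"
| "binop_val Mod a b = a mod b"
| "binop_val And a b = and a b"
| "binop_val Or a b = or a b"
| "binop_val Xor a b = xor a b"
| "binop_val Less a b = of_bool (a < b)"
| "binop_val Equal a b = of_bool (a = b)"

text \<open>\<open>Load x a y\<close> reads into register \<open>x\<close> the cell of array \<open>a\<close> whose index is in register \<open>y\<close>;
  \<open>Store a x y\<close> writes register \<open>y\<close> into the cell of array \<open>a\<close> whose index is in register \<open>x\<close>.\<close>

datatype com =
    Skip
  | Const nat nat
  | Op binop nat nat nat
  | Load nat nat nat
  | Store nat nat nat
  | Seq com com
  | If nat com com
  | While nat com

inductive exec :: "nat \<Rightarrow> com \<Rightarrow> store \<Rightarrow> nat \<Rightarrow> store \<Rightarrow> bool" for W :: nat where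
  Skip: "exec W Skip s 1 s"
| Const: "v < W \<Longrightarrow> exec W (Const x v) s 1 (s(Reg x := v))"
| Op: "v = binop_val f (s (Reg y)) (s (Reg z)) \<Longrightarrow> v < W \<Longrightarrow>
    exec W (Op f x y z) s 1 (s(Reg x := v))"
| Load: "v = s (Cell a (s (Reg y))) \<Longrightarrow> v < W \<Longrightarrow> exec W (Load x a y) s 1 (s(Reg x := v))"
| Store: "v = s (Reg y) \<Longrightarrow> v < W \<Longrightarrow> exec W (Store a x y) s 1 (s(Cell a (s (Reg x)) := v))"
| Seq: "exec W c s t s' \<Longrightarrow> exec W d s' t' s'' \<Longrightarrow> exec W (Seq c d) s (t + t') s''"
| If_true: "s (Reg x) \<noteq> 0 \<Longrightarrow> exec W c s t s' \<Longrightarrow> exec W (If x c d) s (Suc t) s'"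
| If_false: "s (Reg x) = 0 \<Longrightarrow> exec W d s t s' \<Longrightarrow> exec W (If x c d) s (Suc t) s'"
| While_true: "s (Reg x) \<noteq> 0 \<Longrightarrow> exec W c s t s' \<Longrightarrow> exec W (While x c) s' t' s'' \<Longrightarrow>
    exec W (While x c) s (Suc (t + t')) s''"
| While_false: "s (Reg x) = 0 \<Longrightarrow> exec W (While x c) s 1 s"

text \<open>Words of \<open>\<Theta>(log S)\<close> bits for inputs of size \<open>S\<close>; the constant \<open>k\<close> depends on the program
  only.\<close>

definition word_bound :: "nat \<Rightarrow> nat \<Rightarrow> nat" where
  "word_bound k S = (S + 2) ^ k"

definition input_store :: "nat list \<Rightarrow> nat list list \<Rightarrow> store" where
  "input_store rs as =
     (\<lambda>l. case l of Reg x \<Rightarrow> nth_default 0 rs x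
                   | Cell a i \<Rightarrow> nth_default 0 (nth_default [] as a) i)"


section \<open>Solving the two problems on the RAM\<close>

text \<open>An ED string is presented by listing each of its sets in some order, without repetition.\<close>

definition enumerates :: "'a list list list \<Rightarrow> 'a ed_string \<Rightarrow> bool" where
  "enumerates E T \<longleftrightarrow> list_all2 (\<lambda>ws X. distinct ws \<and> set ws = X) E T"

text \<open>The arrays hold the pattern, the cardinalities of the sets, the lengths of all strings, and
  the letters of all strings.\<close>

definition edsm_input :: "nat list \<Rightarrow> nat list list list \<Rightarrow> store" where
  "edsm_input P E =
     input_store [length P, length E, length (concat E), length (concat (concat E))]
       [P, map length E, map length (concat E), concat (concat E)]"

text \<open>Register 0 holds the number of reported entries, array 0 the entries, in any order.\<close>

definition reported :: "store \<Rightarrow> nat set" where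
  "reported s = {s (Cell 0 i) | i. i < s (Reg 0)}"

text \<open>The alphabet consists of the letters \<open>0, \<dots>, \<sigma> - 1\<close>. The time bound \<open>f\<close> has the arguments
  \<open>m\<close>, \<open>n\<close>, \<open>N\<close>: length of the pattern, length and size of the ED string. The term \<open>length T\<close> in
  the word bound is there because the size does not count empty strings.\<close>

definition solves_EDSM :: "nat \<Rightarrow> (nat \<Rightarrow> nat \<Rightarrow> nat \<Rightarrow> real) \<Rightarrow> com \<Rightarrow> bool" where
  "solves_EDSM \<sigma> f p \<longleftrightarrow>
     (\<exists>(c::real) k. \<forall>P T E.
        P \<in> lists {..<\<sigma>} \<and> P \<noteq> [] \<and> ed_string {..<\<sigma>} T \<and> length P \<le> ed_size T \<and> enumerates E T \<longrightarrow>
        (\<exists>t s. exec (word_bound k (length T + ed_size T)) p (edsm_input P E) t s \<and>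
           real t \<le> c * f (length P) (length T) (ed_size T) \<and>
           reported s = occurrence_ends P T))"

definition td_input :: "nat \<Rightarrow> bool mat \<Rightarrow> bool mat \<Rightarrow> bool mat \<Rightarrow> store" where
  "td_input N A B C =
     input_store [N] (map (\<lambda>M. map of_bool (concat (mat_to_list M))) [A, B, C])"

definition solves_TD :: "(nat \<Rightarrow> real) \<Rightarrow> com \<Rightarrow> bool" where
  "solves_TD f p \<longleftrightarrow>
     (\<exists>(c::real) k. \<forall>N\<ge>1. \<forall>A B C.
        A \<in> carrier_mat N N \<and> B \<in> carrier_mat N N \<and> C \<in> carrier_mat N N \<longrightarrow>
        (\<exists>t s. exec (word_bound k (N * N)) p (td_input N A B C) t s \<and>
           real t \<le> c * f N \<and>
           s (Reg 0) = of_bool (has_triangle N A B C)))"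

definition truly_subcubic_TD :: "com \<Rightarrow> bool" where
  "truly_subcubic_TD p \<longleftrightarrow> (\<exists>\<delta>>0. solves_TD (\<lambda>N. real N powr (3 - \<delta>)) p)"


section \<open>Combinatorial algorithms\<close>

text \<open>
  ``Combinatorial'' has no agreed formal definition, so it is treated as an unspecified class of
  programs. The class cannot be closed under arbitrary program constructs: it would then contain
  every program, Strassen's algorithm included. What is required is that a program in the class may
  be used as a subroutine of a program that otherwise merely moves data around.

  Moving data around is captured by projections, in the sense of projection reductions: given the
  initial contents of the registers, every register and every array cell of the final store is
  a function of a single array cell of the initial store, and this cell is determined by the
  registers alone. Hence a projection never combines two array entries.
\<close>

definition projection :: "com \<Rightarrow> bool" where
  "projection c \<longleftrightarrow>
     (\<forall>\<rho> l. \<exists>a i. \<forall>W s t s' r u r'.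
        (\<forall>x. s (Reg x) = \<rho> x) \<and> (\<forall>x. r (Reg x) = \<rho> x) \<and> s (Cell a i) = r (Cell a i) \<and>
        exec W c s t s' \<and> exec W c r u r' \<longrightarrow> s' l = r' l)"

text \<open>Renaming, to run a subroutine on registers and arrays of its own.\<close>

primrec shift :: "nat \<Rightarrow> com \<Rightarrow> com" where
  "shift k Skip = Skip"
| "shift k (Const x v) = Const (x + k) v"
| "shift k (Op f x y z) = Op f (x + k) (y + k) (z + k)"
| "shift k (Load x a y) = Load (x + k) (a + k) (y + k)"
| "shift k (Store a x y) = Store (a + k) (x + k) (y + k)"
| "shift k (Seq c d) = Seq (shift k c) (shift k d)"
| "shift k (If x c d) = If (x + k) (shift k c) (shift k d)"
| "shift k (While x c) = While (x + k) (shift k c)"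

definition projection_closed :: "(com \<Rightarrow> bool) \<Rightarrow> bool" where
  "projection_closed \<C> \<longleftrightarrow>
     (\<forall>p pre post k. \<C> p \<and> projection pre \<and> projection post \<longrightarrow>
        \<C> (Seq pre (Seq (shift k p) post)))"

text \<open>In particular, the class of all programs is closed; for it the notion is no restriction.\<close>

lemma projection_closed_all: "projection_closed (\<lambda>_. True)"
  by (simp add: projection_closed_def)

end

theory Submission
  imports Defs
begin

text \<open>
  Let \<open>i, j, k\<close> be the vertices of a possible triangle. Cut the ranges of
  \<open>j\<close> and \<open>k\<close> into \<open>g\<close> intervals of length \<open>b\<close>.
  The pattern is a sequence of blocks, one for every \<open>i\<close>, interval \<open>x\<close> of
  \<open>j\<close> and interval \<open>y\<close> of \<open>k\<close>; the block is \<open>[i x] 1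
  a^b [x y] 1 a^b [i y] 1\<close>, where brackets are codes of fixed length. The middle of the text
  consists of three sets with one word per matrix entry: \<open>[i x] A a^j\<close>, \<open>a^(b-j)
  [x y] B a^(b-k)\<close> and \<open>a^k [i y] C\<close>, with \<open>j\<close> and \<open>k\<close>
  taken relative to their intervals and the entries themselves as letters. Their concatenation is a
  block if and only if the three entries are 1 and belong to the same triple \<open>i, j, k\<close>.
  On both sides there is padding, for every \<open>h\<close> a set with the empty word and all
  aligned runs of \<open>2^h\<close> blocks, which can be used to spell any prefix and any suffix of
  the sequence of blocks. So there are only logarithmically many sets, the pattern has length about
  \<open>N\<^sup>2 g\<close> and the text has size about \<open>N\<^sup>3 / g\<close>; for
  \<open>g\<close> a small power of \<open>N\<close> the assumed EDSM algorithm is truly subcubic on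
  this instance. As a zero entry only changes a letter, the instance is a projection of the
  matrices.\<close>


section \<open>Executions\<close>

text \<open>The choice of \<open>g\<close> is a trade-off: the entry words alone have total length
  about \<open>N * N * b\<close> and ask for a large \<open>g\<close>, pattern and padding ask for a
  small one. With \<open>g\<close> about N^(1/q) the EDSM bound becomes N to the power (2 + 1/q)(1.5
  - 1/q) = 3 - 1/(2q) - 1/q^2, up to the number of sets; half of the gain 1/(2q) absorbs that
  logarithmic factor. The low digits of \<open>j\<close> and \<open>k\<close> are compared by
  counting: fillers of neighbouring words merge, and a^j followed by a^(b-j') has length
  \<open>b\<close> only if j = j'. This makes every block about as long as \<open>b\<close>, and
  codes must not exceed that order; hence a vertex below \<open>b * b\<close> is written with two
  one-hot digits of length \<open>b\<close>. The end markers 3 and 4 occur once each in the text, so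
  an occurrence has to use all sets and whole words, although a match may in general begin and end
  inside a word. On the machine side, a class closed only under surrounding projections rules out
  any test on a matrix entry: lengths, cardinalities and control flow must depend on
  \<open>N\<close> alone, and the programs are therefore verified through symbolic output.\<close>

lemmas exec_intros = exec.intros exec.intros[unfolded One_nat_def]

lemma exec_mono: "exec W c s t s' \<Longrightarrow> W \<le> W' \<Longrightarrow> exec W' c s t s'"
proof (induction rule: exec.induct)
  case (While_true s x c t s' t' s'')
  then show ?case using exec.While_true by blast
qed (auto intro: exec_intros)

text \<open>The bound \<open>W\<close> decides whether a transition exists, never its result, so
  executions under different bounds still agree. A store computed for one bound thus describes every
  terminating run, as \<open>projection\<close> asks.\<close>

lemma exec_deterministic:
  "exec W c s t s' \<Longrightarrow> exec W' c s u s'' \<Longrightarrow> t = u \<and> s' = s''"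
proof (induction arbitrary: u s'' rule: exec.induct)
  case (Seq c s t s' d t' s'')
  from Seq.prems show ?case by (cases rule: exec.cases) (use Seq.IH in blast)+
next
  case (If_true s x c t s' d)
  from If_true.prems show ?case by (cases rule: exec.cases) (use If_true in auto)
next
  case (If_false s x d t s' c)
  from If_false.prems show ?case by (cases rule: exec.cases) (use If_false in auto)
next
  case (While_true s x c t s1 t' s2)
  from While_true.prems show ?case
    by (cases rule: exec.cases) (use While_true.IH While_true.hyps in \<open>blast | simp\<close>)+
next
  case (While_false s x c)
  from While_false.prems show ?case by (cases rule: exec.cases) (use While_false.hyps in auto)
qed (erule exec.cases; simp)+

text \<open>Hides the word bound: programs are verified as if words were unbounded, and
  \<open>exec_incremental\<close> later derives a sufficient bound from the running time.\<close>

definition runs :: "com \<Rightarrow> store \<Rightarrow> nat \<Rightarrow> store \<Rightarrow> bool" where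
  "runs c s t s' \<longleftrightarrow> (\<exists>W. exec W c s t s')"

lemma runs_Skip: "runs Skip s 1 s"
  unfolding runs_def by (blast intro: exec.intros)

lemma runs_Const: "runs (Const x v) s 1 (s(Reg x := v))"
  unfolding runs_def by (blast intro: exec.intros lessI)

lemma runs_Op: "runs (Op f x y z) s 1 (s(Reg x := binop_val f (s (Reg y)) (s (Reg z))))"
  unfolding runs_def by (blast intro: exec.intros lessI)

lemma runs_Load: "runs (Load x a y) s 1 (s(Reg x := s (Cell a (s (Reg y)))))"
  unfolding runs_def by (blast intro: exec.intros lessI)

lemma runs_Store: "runs (Store a x y) s 1 (s(Cell a (s (Reg x)) := s (Reg y)))"
  unfolding runs_def by (blast intro: exec.intros lessI)

lemma runs_Seq:
  assumes "runs c s t s'" "runs d s' t' s''"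
  shows "runs (Seq c d) s (t + t') s''"
proof -
  obtain W W' where "exec W c s t s'" "exec W' d s' t' s''" using assms unfolding runs_def by blast
  then have "exec (max W W') c s t s'" "exec (max W W') d s' t' s''"
    by (auto elim: exec_mono)
  then show ?thesis unfolding runs_def by (blast intro: exec.Seq)
qed

lemma runs_While_true:
  assumes "s (Reg x) \<noteq> 0" "runs c s t s'" "runs (While x c) s' t' s''"
  shows "runs (While x c) s (Suc (t + t')) s''"
proof -
  obtain W W' where "exec W c s t s'" "exec W' (While x c) s' t' s''"
    using assms unfolding runs_def by blast
  then have "exec (max W W') c s t s'" "exec (max W W') (While x c) s' t' s''"
    by (auto elim: exec_mono)
  then show ?thesis unfolding runs_def using assms(1) by (blast intro: exec.While_true)
qed

lemma runs_While_false: "s (Reg x) = 0 \<Longrightarrow> runs (While x c) s 1 s"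
  unfolding runs_def by (blast intro: exec.intros)

section \<open>Renaming of registers and arrays\<close>

definition shifted :: "nat \<Rightarrow> store \<Rightarrow> store \<Rightarrow> bool" where
  "shifted k s r \<longleftrightarrow> (\<forall>x. r (Reg (x + k)) = s (Reg x)) \<and> (\<forall>a i. r (Cell (a + k) i) = s (Cell a i))"

text \<open>The renamed program touches only registers and arrays from \<open>k\<close> on, so
  \<open>shifted\<close> is a simulation relation; the store \<open>r\<close> may hold anything
  below \<open>k\<close>.\<close>

lemma exec_shift:
  "exec W p s t s' \<Longrightarrow> shifted k s r \<Longrightarrow> \<exists>r'. exec W (shift k p) r t r' \<and> shifted k s' r'"
proof (induction arbitrary: r rule: exec.induct)
  case (Skip s)
  then show ?case by (auto intro: exec_intros)
next
  case (Const v x s)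
  then have "exec W (shift k (Const x v)) r 1 (r(Reg (x + k) := v))"
    unfolding shift.simps by (intro exec.Const)
  moreover have "shifted k (s(Reg x := v)) (r(Reg (x + k) := v))"
    using Const by (auto simp: shifted_def)
  ultimately show ?case by blast
next
  case (Op v f s y z x)
  then have "exec W (shift k (Op f x y z)) r 1 (r(Reg (x + k) := v))"
    unfolding shift.simps by (intro exec.Op) (auto simp: shifted_def)
  moreover have "shifted k (s(Reg x := v)) (r(Reg (x + k) := v))"
    using Op by (auto simp: shifted_def)
  ultimately show ?case by blast
next
  case (Load v s a y x)
  then have "exec W (shift k (Load x a y)) r 1 (r(Reg (x + k) := v))"
    unfolding shift.simps by (intro exec.Load) (auto simp: shifted_def)
  moreover have "shifted k (s(Reg x := v)) (r(Reg (x + k) := v))"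
    using Load by (auto simp: shifted_def)
  ultimately show ?case by blast
next
  case (Store v s y a x)
  have "exec W (Store (a + k) (x + k) (y + k)) r 1 (r(Cell (a + k) (r (Reg (x + k))) := v))"
    using Store by (intro exec.Store) (auto simp: shifted_def)
  moreover have "shifted k (s(Cell a (s (Reg x)) := v)) (r(Cell (a + k) (r (Reg (x + k))) := v))"
    using Store by (auto simp: shifted_def)
  ultimately show ?case unfolding shift.simps by blast
next
  case (Seq c s t s' d t' s'')
  then show ?case by (metis exec.Seq shift.simps(6))
next
  case (If_true s x c t s' d)
  then show ?case by (metis exec.If_true shift.simps(7) shifted_def)
next
  case (If_false s x d t s' c)
  then show ?case by (metis exec.If_false shift.simps(7) shifted_def)
next
  case (While_true s x c t s' t' s'')
  then show ?case by (metis exec.While_true shift.simps(8) shifted_def)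
next
  case (While_false s x c)
  then show ?case by (metis exec.While_false shift.simps(8) shifted_def)
qed

text \<open>If addition is used for increments only, with register 40 as the constant 1, then no value
  grows by more than 1 per step. This turns a time bound into a word bound.\<close>

primrec incremental :: "nat \<Rightarrow> com \<Rightarrow> bool" where
  "incremental D Skip = True"
| "incremental D (Const x v) = (v \<le> D \<and> (x = 40 \<longrightarrow> v \<le> 1))"
| "incremental D (Op f x y z) = (x \<noteq> 40 \<and> (f \<in> {Sub, Div, Mod, Less, Equal} \<or> f = Add \<and> z = 40))"
| "incremental D (Load x a y) = (x \<noteq> 40)"
| "incremental D (Store a x y) = True"
| "incremental D (Seq c d) = (incremental D c \<and> incremental D d)"
| "incremental D (If x c d) = (incremental D c \<and> incremental D d)"
| "incremental D (While x c) = incremental D c"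

text \<open>\<open>W\<close> and \<open>W'\<close> are unrelated: the given execution only shows
  that the program ends after \<open>t\<close> steps. With \<open>D\<close> bounding the constants,
  each step raises the maximal value by at most 1, so all values stay at most \<open>V + t\<close>
  and any \<open>W'\<close> above that suffices. The invariant on register 40 is what makes
  \<open>Add\<close> an increment.\<close>

lemma exec_incremental:
  "exec W c s t s' \<Longrightarrow> incremental D c \<Longrightarrow> s (Reg 40) \<le> 1 \<Longrightarrow> \<forall>l. s l \<le> V \<Longrightarrow> D \<le> V \<Longrightarrow> 1 \<le> V \<Longrightarrow>
    V + t < W' \<Longrightarrow> exec W' c s t s' \<and> (\<forall>l. s' l \<le> V + t) \<and> s' (Reg 40) \<le> 1"
proof (induction arbitrary: V rule: exec.induct)
  case (Skip s)
  then show ?case by (auto intro: exec_intros le_SucI)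
next
  case (Const v x s)
  then have "exec W' (Const x v) s 1 (s(Reg x := v))" by (intro exec.Const) auto
  moreover have "\<forall>l. (s(Reg x := v)) l \<le> V + 1" "(s(Reg x := v)) (Reg 40) \<le> 1"
    using Const by (auto intro: le_SucI)
  ultimately show ?case by blast
next
  case (Op v f s y z x)
  have "v \<le> V + 1"
  proof (cases "f = Add \<and> z = 40")
    case True
    then have "v = s (Reg y) + s (Reg 40)" using Op.hyps by simp
    then show ?thesis using Op.prems(2,3) by (metis add_mono)
  next
    case False
    \<comment> \<open>\<open>Sub\<close>, \<open>Div\<close> and \<open>Mod\<close> never exceed
      their left operand, also for divisor 0, and comparisons return at most 1.\<close>
    have "v \<le> max (s (Reg y)) 1"
      using False Op.hyps(1) Op.prems(1) by (auto simp: le_max_iff_disj div_le_dividend mod_less_eq_dividend)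
    then show ?thesis using Op.prems(3,5) by (metis le_add1 max.bounded_iff order_trans max_def)
  qed
  moreover have "exec W' (Op f x y z) s 1 (s(Reg x := v))"
    using Op.hyps(1) Op.prems(6) \<open>v \<le> V + 1\<close> by (intro exec.Op) auto
  moreover have "\<forall>l. (s(Reg x := v)) l \<le> V + 1" "(s(Reg x := v)) (Reg 40) \<le> 1"
    using Op.prems \<open>v \<le> V + 1\<close> by (auto intro: le_SucI)
  ultimately show ?case by blast
next
  case (Load v s a y x)
  have "v \<le> V" using Load by auto
  moreover have "exec W' (Load x a y) s 1 (s(Reg x := v))"
    using Load.hyps(1) Load.prems(6) \<open>v \<le> V\<close> by (intro exec.Load) auto
  moreover have "\<forall>l. (s(Reg x := v)) l \<le> V + 1" "(s(Reg x := v)) (Reg 40) \<le> 1"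
    using Load.prems \<open>v \<le> V\<close> by (auto intro: le_SucI)
  ultimately show ?case by blast
next
  case (Store v s y a x)
  have "v \<le> V" using Store by auto
  moreover have "exec W' (Store a x y) s 1 (s(Cell a (s (Reg x)) := v))"
    using Store.hyps(1) Store.prems(6) \<open>v \<le> V\<close> by (intro exec.Store) auto
  moreover have "\<forall>l. (s(Cell a (s (Reg x)) := v)) l \<le> V + 1"
    "(s(Cell a (s (Reg x)) := v)) (Reg 40) \<le> 1"
    using Store.prems \<open>v \<le> V\<close> by (auto intro: le_SucI)
  ultimately show ?case by blast
next
  case (Seq c s t s' d t' s'')
  from Seq.IH(1)[of V] Seq.prems
  have 1: "exec W' c s t s'" "\<forall>l. s' l \<le> V + t" "s' (Reg 40) \<le> 1" by auto
  from Seq.IH(2)[of "V + t"] Seq.prems 1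
  have 2: "exec W' d s' t' s''" "\<forall>l. s'' l \<le> V + t + t'" "s'' (Reg 40) \<le> 1" by auto
  show ?case using exec.Seq[OF 1(1) 2(1)] 2(2,3) by (simp add: add.assoc)
next
  case (If_true s x c t s' d)
  then have "exec W' c s t s' \<and> (\<forall>l. s' l \<le> V + t) \<and> s' (Reg 40) \<le> 1" by auto
  then show ?case using If_true.hyps by (auto intro: exec.If_true le_SucI)
next
  case (If_false s x d t s' c)
  then have "exec W' d s t s' \<and> (\<forall>l. s' l \<le> V + t) \<and> s' (Reg 40) \<le> 1" by auto
  then show ?case using If_false.hyps by (auto intro: exec.If_false le_SucI)
next
  case (While_true s x c t s' t' s'')
  from While_true.IH(1)[of V] While_true.prems
  have 1: "exec W' c s t s'" "\<forall>l. s' l \<le> V + t" "s' (Reg 40) \<le> 1" by auto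
  from While_true.IH(2)[of "V + t"] While_true.prems 1
  have 2: "exec W' (While x c) s' t' s''" "\<forall>l. s'' l \<le> V + t + t'" "s'' (Reg 40) \<le> 1" by auto
  show ?case using exec.While_true[OF While_true.hyps(1) 1(1) 2(1)] 2(2,3)
    by (auto simp: add.assoc intro: le_SucI)
next
  case (While_false s x c)
  then show ?case by (auto intro: exec_intros le_SucI)
qed


section \<open>Programs that write streams\<close>

text \<open>A program computes with the registers below 40 and appends to four output streams. Stream
  \<open>a\<close> is kept in array \<open>43 + a\<close>, its length in register \<open>43 + a\<close>; after renaming by 43 these are
  exactly the arrays and registers of an EDSM input. A symbol is a constant or a
  reference to an entry of the initial memory, which is only ever copied. Registers 40, 41, 42 hold
  the constant for increments, loop conditions and entries in transit.\<close>

datatype symbol = Lit nat | Entry nat nat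

primrec symbol_val :: "store \<Rightarrow> symbol \<Rightarrow> nat" where
  "symbol_val s (Lit v) = v"
| "symbol_val s (Entry a i) = s (Cell a i)"

type_synonym streams = "nat \<Rightarrow> symbol list"

text \<open>\<open>R\<close> describes the scratch registers, \<open>F\<close> the streams
  symbolically, and \<open>s0\<close> is the store in which entries are looked up. Arrays outside
  the streams still agree with \<open>s0\<close>, so a copy from an array below 43 reads initial
  memory.\<close>

definition represents :: "store \<Rightarrow> (nat \<Rightarrow> nat) \<Rightarrow> streams \<Rightarrow> store \<Rightarrow> bool" where
  "represents s0 R F s \<longleftrightarrow>
     (\<forall>x<40. s (Reg x) = R x) \<and> (\<forall>a<4. s (Reg (43 + a)) = length (F a)) \<and>
     (\<forall>x\<ge>47. s (Reg x) = s0 (Reg x)) \<and>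
     (\<forall>a<4. \<forall>i. s (Cell (43 + a) i) =
       (if i < length (F a) then symbol_val s0 (F a ! i) else s0 (Cell (43 + a) i))) \<and>
     (\<forall>a i. a < 43 \<or> 47 \<le> a \<longrightarrow> s (Cell a i) = s0 (Cell a i))"

definition join :: "streams \<Rightarrow> streams \<Rightarrow> streams" where
  "join F G = (\<lambda>a. F a @ G a)"

definition only :: "nat \<Rightarrow> symbol list \<Rightarrow> streams" where
  "only a w = (\<lambda>b. if b = a then w else [])"

lemma join_assoc: "join (join F G) H = join F (join G H)"
  by (simp add: join_def)

lemma join_empty [simp]: "join F (\<lambda>_. []) = F" "join (\<lambda>_. []) F = F"
  by (simp_all add: join_def)

lemma join_only: "join (only a u) (only a v) = only a (u @ v)"
  by (auto simp: join_def only_def)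

text \<open>\<open>G\<close> is fixed before \<open>s0\<close> and \<open>F\<close> are quantified:
  the output is a function of the scratch registers alone and is appended to whatever was written
  before. The first property later yields the projection, the second is the frame rule.\<close>

definition triple ::
  "(nat \<Rightarrow> nat) \<Rightarrow> com \<Rightarrow> streams \<Rightarrow> nat \<Rightarrow> ((nat \<Rightarrow> nat) \<Rightarrow> bool) \<Rightarrow> bool" where
  "triple R c G T Q \<longleftrightarrow>
     (\<forall>s0 F s. represents s0 R F s \<longrightarrow>
        (\<exists>t s' R'. runs c s t s' \<and> t \<le> T \<and> represents s0 R' (join F G) s' \<and> Q R'))"

definition agree :: "nat set \<Rightarrow> (nat \<Rightarrow> nat) \<Rightarrow> (nat \<Rightarrow> nat) \<Rightarrow> bool" where
  "agree V R R' \<longleftrightarrow> (\<forall>x. x \<notin> V \<longrightarrow> R' x = R x)"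

lemma agree_refl [simp]: "agree V R R"
  by (simp add: agree_def)

lemma agreeD: "agree V R R' \<Longrightarrow> x \<notin> V \<Longrightarrow> R' x = R x"
  by (simp add: agree_def)

lemma triple_weaken:
  assumes "triple R c G T Q" "T \<le> T'" "\<And>R'. Q R' \<Longrightarrow> Q' R'"
  shows "triple R c G T' Q'"
  using assms unfolding triple_def by (meson order_trans)

lemma triple_Seq:
  assumes "triple R c G T Q" "\<And>R'. Q R' \<Longrightarrow> triple R' d H U Q'"
  shows "triple R (Seq c d) (join G H) (T + U) Q'"
  unfolding triple_def
proof (intro allI impI)
  fix s0 F s assume "represents s0 R F s"
  then obtain t s' R' where 1: "runs c s t s'" "t \<le> T" "represents s0 R' (join F G) s'" "Q R'"
    using assms(1) unfolding triple_def by blast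
  then obtain u s'' R'' where 2: "runs d s' u s''" "u \<le> U"
    "represents s0 R'' (join (join F G) H) s''" "Q' R''"
    using assms(2) unfolding triple_def by blast
  show "\<exists>t s' R'. runs (Seq c d) s t s' \<and> t \<le> T + U \<and>
      represents s0 R' (join F (join G H)) s' \<and> Q' R'"
    using runs_Seq[OF 1(1) 2(1)] 1(2) 2(2-4) by (auto simp: join_assoc intro: add_mono)
qed

abbreviation seq (infixr ";;" 60) where "c ;; d \<equiv> Seq c d"

definition Inc :: "nat \<Rightarrow> com" where
  "Inc x = Const 40 1 ;; Op Add x x 40"

definition Push :: "nat \<Rightarrow> nat \<Rightarrow> com" where
  "Push a x = Store (43 + a) (43 + a) x ;; Inc (43 + a)"

definition Copy :: "nat \<Rightarrow> nat \<Rightarrow> nat \<Rightarrow> com" where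
  "Copy a b x = Load 42 b x ;; Push a 42"

text \<open>No instruction moves a register, so subtracting 0 serves as a copy; register 40 may be
  that 0 because \<open>incremental\<close> lets it be 0 or 1.\<close>

definition Len :: "nat \<Rightarrow> nat \<Rightarrow> com" where
  "Len x a = Const 40 0 ;; Op Sub x (43 + a) 40"

definition For :: "nat \<Rightarrow> nat \<Rightarrow> com \<Rightarrow> com" where
  "For x y c = Const x 0 ;; Op Less 41 x y ;; While 41 (c ;; Inc x ;; Op Less 41 x y)"

lemma triple_Const: "x < 40 \<Longrightarrow> triple R (Const x v) (\<lambda>_. []) 1 (\<lambda>R'. R' = R(x := v))"
  unfolding triple_def
  by (intro allI impI exI conjI, rule runs_Const, simp, simp_all) (auto simp: represents_def)

lemma triple_Op:
  assumes "x < 40" "y < 40" "z < 40"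
  shows "triple R (Op f x y z) (\<lambda>_. []) 1 (\<lambda>R'. R' = R(x := binop_val f (R y) (R z)))"
  unfolding triple_def
  by (intro allI impI exI conjI, rule runs_Op, simp, simp_all)
    (use assms in \<open>auto simp: represents_def\<close>)

lemma runs_Inc: "x \<noteq> 40 \<Longrightarrow> runs (Inc x) s 2 (s(Reg 40 := 1, Reg x := Suc (s (Reg x))))"
  unfolding Inc_def using runs_Seq[OF runs_Const runs_Op, of 40 1 Add x x 40 s] by (simp add: numeral_2_eq_2)

lemma triple_Inc: "x < 40 \<Longrightarrow> triple R (Inc x) (\<lambda>_. []) 2 (\<lambda>R'. R' = R(x := Suc (R x)))"
  unfolding triple_def
  by (intro allI impI exI conjI, rule runs_Inc, simp, simp, simp_all) (auto simp: represents_def)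

lemma runs_Push:
  assumes "a < 4" "represents s0 R F s" "v = symbol_val s0 w" "s (Reg x) = v"
  shows "\<exists>s'. runs (Push a x) s 3 s' \<and> represents s0 R (join F (only a [w])) s'"
proof -
  have *: "s (Reg (43 + a)) = length (F a)" using assms by (auto simp: represents_def)
  let ?s1 = "s(Cell (43 + a) (length (F a)) := v)"
  let ?s2 = "?s1(Reg 40 := 1, Reg (43 + a) := Suc (length (F a)))"
  have "runs (Push a x) s (1 + 2) ?s2"
    unfolding Push_def
    using runs_Seq[OF runs_Store runs_Inc, of "43 + a" "43 + a" "43 + a" x s] assms(4) * by simp
  moreover have "represents s0 R (join F (only a [w])) ?s2"
    using assms unfolding represents_def join_def only_def
    by (auto simp: nth_append less_Suc_eq)
  ultimately show ?thesis by (auto simp: numeral_eq_Suc)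
qed

lemma triple_Push:
  assumes "a < 4" "x < 40"
  shows "triple R (Push a x) (only a [Lit (R x)]) 3 (\<lambda>R'. R' = R)"
  unfolding triple_def
proof (intro allI impI)
  fix s0 F s assume *: "represents s0 R F s"
  then have "s (Reg x) = R x" using assms by (auto simp: represents_def)
  from runs_Push[OF assms(1) * _ this, of "Lit (R x)"]
  show "\<exists>t s' R'. runs (Push a x) s t s' \<and> t \<le> 3 \<and>
      represents s0 R' (join F (only a [Lit (R x)])) s' \<and> R' = R" by auto
qed

lemma triple_Copy:
  assumes "a < 4" "b < 43" "x < 40"
  shows "triple R (Copy a b x) (only a [Entry b (R x)]) 4 (\<lambda>R'. R' = R)"
  unfolding triple_def
proof (intro allI impI)
  fix s0 F s assume *: "represents s0 R F s"
  let ?s = "s(Reg 42 := s (Cell b (s (Reg x))))"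
  have "represents s0 R F ?s" using * by (auto simp: represents_def)
  moreover have "s (Cell b (s (Reg x))) = symbol_val s0 (Entry b (R x))"
    using * assms by (auto simp: represents_def)
  ultimately obtain s' where "runs (Push a 42) ?s 3 s'"
    "represents s0 R (join F (only a [Entry b (R x)])) s'"
    using runs_Push[OF assms(1), of s0 R F ?s _ "Entry b (R x)" 42] by auto
  then show "\<exists>t s' R'. runs (Copy a b x) s t s' \<and> t \<le> 4 \<and>
      represents s0 R' (join F (only a [Entry b (R x)])) s' \<and> R' = R"
    unfolding Copy_def using runs_Seq[OF runs_Load] by fastforce
qed

lemma runs_Len:
  assumes "represents s0 R F s" "a < 4" "x < 40"
  shows "\<exists>s'. runs (Len x a) s 2 s' \<and> represents s0 (R(x := length (F a))) F s'"
proof -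
  have *: "s (Reg (43 + a)) = length (F a)" using assms by (auto simp: represents_def)
  have "runs (Len x a) s (1 + 1) (s(Reg 40 := 0, Reg x := length (F a)))"
    unfolding Len_def using runs_Seq[OF runs_Const runs_Op, of 40 0 Sub x "43 + a" 40 s] * by simp
  moreover have "represents s0 (R(x := length (F a))) F (s(Reg 40 := 0, Reg x := length (F a)))"
    using assms by (auto simp: represents_def)
  ultimately show ?thesis by (auto simp: numeral_2_eq_2)
qed

text \<open>\<open>k\<close> counts the remaining rounds. The overhead of 4 per round is the
  increment (2), the comparison (1) and the loop test (1). The invariant is stated with the counter
  already advanced, since the body has to end with counter and bound as it found them.\<close>

lemma runs_For_loop:
  assumes xy: "x \<noteq> y" "x < 40" "y < 40"
    and body: "\<And>i R'. i < n \<Longrightarrow> I i R' \<Longrightarrow> R' x = i \<Longrightarrow> R' y = n \<Longrightarrow>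
      triple R' c (G i) T (\<lambda>R''. R'' x = i \<and> R'' y = n \<and> I (Suc i) (R''(x := Suc i)))"
    and "i + k = n" "represents s0 R F s" "I i R" "R x = i" "R y = n" "s (Reg 41) = of_bool (i < n)"
  shows "\<exists>t s' R'. runs (While 41 (c ;; Inc x ;; Op Less 41 x y)) s t s' \<and> t \<le> k * (T + 4) + 1 \<and>
    represents s0 R' (join F (\<lambda>a. concat (map (\<lambda>i. G i a) [i..<n]))) s' \<and> I n R'"
  using assms(5-)
proof (induction k arbitrary: i R F s)
  case 0
  then have "s (Reg 41) = 0" "i = n" by auto
  then show ?case using runs_While_false[of s 41] 0 by fastforce
next
  case (Suc k)
  then have "i < n" by simp
  from body[OF this Suc.prems(3,4,5)] Suc.prems(2)
  obtain t1 s1 R1 where 1: "runs c s t1 s1" "t1 \<le> T" "represents s0 R1 (join F (G i)) s1"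
    "R1 x = i" "R1 y = n" "I (Suc i) (R1(x := Suc i))" unfolding triple_def by blast
  have "s1 (Reg x) = i" "s1 (Reg y) = n" using 1 xy by (auto simp: represents_def)
  define s2 where "s2 = s1(Reg 40 := 1, Reg x := Suc i)"
  define s3 where "s3 = s2(Reg 41 := of_bool (Suc i < n))"
  have 2: "runs (Inc x) s1 2 s2"
    using runs_Inc[of x s1] xy \<open>s1 (Reg x) = i\<close> by (simp add: s2_def)
  have 3: "runs (Op Less 41 x y) s2 1 s3"
    using runs_Op[of Less 41 x y s2] xy \<open>s1 (Reg y) = n\<close> by (simp add: s2_def s3_def)
  have 4: "represents s0 (R1(x := Suc i)) (join F (G i)) s3"
    using 1(3) xy by (auto simp: represents_def s2_def s3_def)
  have "Suc i + k = n" "(R1(x := Suc i)) x = Suc i" "(R1(x := Suc i)) y = n"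
    "s3 (Reg 41) = of_bool (Suc i < n)"
    using Suc.prems 1 xy by (auto simp: s3_def)
  from Suc.IH[OF this(1) 4 1(6) this(2-4)]
  obtain t s' R' where 5: "runs (While 41 (c ;; Inc x ;; Op Less 41 x y)) s3 t s'" "t \<le> k * (T + 4) + 1"
    "represents s0 R' (join (join F (G i)) (\<lambda>a. concat (map (\<lambda>i. G i a) [Suc i..<n]))) s'" "I n R'"
    by blast
  have "s (Reg 41) \<noteq> 0" using Suc.prems(6) \<open>i < n\<close> by simp
  from runs_While_true[OF this runs_Seq[OF 1(1) runs_Seq[OF 2 3]] 5(1)]
  have "runs (While 41 (c ;; Inc x ;; Op Less 41 x y)) s (Suc (t1 + (2 + 1) + t)) s'" .
  moreover have "Suc (t1 + (2 + 1) + t) \<le> Suc k * (T + 4) + 1" using 1(2) 5(2) by simp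
  moreover have "join (join F (G i)) (\<lambda>a. concat (map (\<lambda>i. G i a) [Suc i..<n])) =
      join F (\<lambda>a. concat (map (\<lambda>i. G i a) [i..<n]))"
    using \<open>i < n\<close> by (simp add: join_def upt_conv_Cons)
  ultimately show ?case using 5(3,4) by metis
qed

lemma triple_For:
  assumes "x \<noteq> y" "x < 40" "y < 40" "R y = n" "I 0 (R(x := 0))"
    and "\<And>i R'. i < n \<Longrightarrow> I i R' \<Longrightarrow> R' x = i \<Longrightarrow> R' y = n \<Longrightarrow>
      triple R' c (G i) T (\<lambda>R''. R'' x = i \<and> R'' y = n \<and> I (Suc i) (R''(x := Suc i)))"
  shows "triple R (For x y c) (\<lambda>a. concat (map (\<lambda>i. G i a) [0..<n])) (n * (T + 4) + 3) (I n)"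
  unfolding triple_def
proof (intro allI impI)
  fix s0 F s assume *: "represents s0 R F s"
  have y: "s (Reg y) = n" using * assms by (auto simp: represents_def)
  define s1 where "s1 = s(Reg x := 0)"
  define s2 where "s2 = s1(Reg 41 := of_bool (0 < n))"
  have 1: "runs (Const x 0) s 1 s1" unfolding s1_def by (rule runs_Const)
  have 2: "runs (Op Less 41 x y) s1 1 s2"
    using runs_Op[of Less 41 x y s1] assms y by (simp add: s2_def s1_def)
  have "represents s0 (R(x := 0)) F s2" "s2 (Reg 41) = of_bool (0 < n)"
    "(R(x := 0)) x = 0" "(R(x := 0)) y = n"
    using * assms by (auto simp: represents_def s2_def s1_def)
  note * = this(1) assms(5) this(3,4,2)
  have "\<exists>t s' R'. runs (While 41 (c ;; Inc x ;; Op Less 41 x y)) s2 t s' \<and> t \<le> n * (T + 4) + 1 \<and>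
    represents s0 R' (join F (\<lambda>a. concat (map (\<lambda>i. G i a) [0..<n]))) s' \<and> I n R'"
  proof (rule runs_For_loop[where x = x and y = y and n = n and I = I and c = c and G = G and T = T
        and i = 0 and k = n and ?s0.0 = s0 and R = "R(x := 0)" and F = F and s = s2])
    show "triple R' c (G i) T (\<lambda>R''. R'' x = i \<and> R'' y = n \<and> I (Suc i) (R''(x := Suc i)))"
      if "i < n" "I i R'" "R' x = i" "R' y = n" for i R'
      using that by (rule assms(6))
  qed (use assms(1-3) * in auto)
  then obtain t s' R' where 3: "runs (While 41 (c ;; Inc x ;; Op Less 41 x y)) s2 t s'"
    "t \<le> n * (T + 4) + 1" "represents s0 R' (join F (\<lambda>a. concat (map (\<lambda>i. G i a) [0..<n]))) s'" "I n R'"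
    by auto
  show "\<exists>t s' R'. runs (For x y c) s t s' \<and> t \<le> n * (T + 4) + 3 \<and>
      represents s0 R' (join F (\<lambda>a. concat (map (\<lambda>i. G i a) [0..<n]))) s' \<and> I n R'"
    unfolding For_def
    by (intro exI conjI, rule runs_Seq[OF 1 runs_Seq[OF 2 3(1)]]) (use 3(2-4) in auto)
qed

lemma triple_For_agree:
  assumes "x \<noteq> y" "x < 40" "y < 40" "x \<in> V" "y \<notin> V" "V' \<subseteq> V" "x \<notin> V'"
    and "\<And>i R'. i < R y \<Longrightarrow> agree V R R' \<Longrightarrow> R' x = i \<Longrightarrow> triple R' c (G i) T (agree V' R')"
  shows "triple R (For x y c) (\<lambda>a. concat (map (\<lambda>i. G i a) [0..<R y])) (R y * (T + 4) + 3) (agree V R)"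
proof (rule triple_For[where I = "\<lambda>_. agree V R"])
  show "agree V R (R(x := 0))" using assms by (simp add: agree_def)
next
  fix i R' assume *: "i < R y" "agree V R R'" "R' x = i" "R' y = R y"
  show "triple R' c (G i) T (\<lambda>R''. R'' x = i \<and> R'' y = R y \<and> agree V R (R''(x := Suc i)))"
    by (rule triple_weaken[OF assms(8)[OF *(1-3)]]) (use * assms in \<open>auto simp: agree_def\<close>)
qed (use assms in auto)

lemma triple_step:
  assumes "triple R c (\<lambda>_. []) T (\<lambda>R'. R' = R1)" "triple R1 d G U Q"
  shows "triple R (Seq c d) G (T + U) Q"
  using triple_Seq[OF assms(1), of d G U Q] assms(2) by simp

section \<open>The reduction\<close>

text \<open>Letters 0 and 1 carry codes and matrix entries, 2 is a filler, 3 and 4 mark the two ends. All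
  words are built through a map \<open>f\<close> on letters and a table \<open>M\<close> of matrix entries, so that they can
  consist of symbols (when the program runs) or of letters (when it is judged).\<close>

definition one_hot :: "(nat \<Rightarrow> 'v) \<Rightarrow> nat \<Rightarrow> nat \<Rightarrow> 'v list" where
  "one_hot f b d = map (\<lambda>t. f (of_bool (t = d))) [0..<b]"

text \<open>Two digits in base \<open>b\<close> name a vertex and the third an interval, or two
  digits name intervals and the third is the dummy 0. All cores thus have the same length, which
  allows them to be cut off by position. The letter \<open>c\<close> is the matrix entry,
  respectively the 1 that a block demands.\<close>

definition core :: "(nat \<Rightarrow> 'v) \<Rightarrow> nat \<Rightarrow> nat \<Rightarrow> nat \<Rightarrow> nat \<Rightarrow> 'v \<Rightarrow> 'v list" where
  "core f b d1 d2 d3 c = one_hot f b d1 @ one_hot f b d2 @ one_hot f b d3 @ [c]"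

definition segment :: "(nat \<Rightarrow> 'v) \<Rightarrow> nat \<Rightarrow> nat \<Rightarrow> nat \<Rightarrow> nat \<Rightarrow> nat \<Rightarrow> 'v \<Rightarrow> nat \<Rightarrow> 'v list" where
  "segment f b u d1 d2 d3 c w = replicate u (f 2) @ core f b d1 d2 d3 c @ replicate w (f 2)"

text \<open>Block \<open>\<phi> = (i g + x) g + y\<close> asks for a triangle \<open>i, j, k\<close> with \<open>j div b = x\<close> and
  \<open>k div b = y\<close>.\<close>

definition block :: "(nat \<Rightarrow> 'v) \<Rightarrow> nat \<Rightarrow> nat \<Rightarrow> nat \<Rightarrow> 'v list" where
  "block f b g \<phi> =
     (let i = \<phi> div g div g; x = \<phi> div g mod g; y = \<phi> mod g in
      segment f b 0 (i div b) (i mod b) x (f 1) b @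
      segment f b 0 x y 0 (f 1) b @
      segment f b 0 (i div b) (i mod b) y (f 1) 0)"

definition blocks :: "(nat \<Rightarrow> 'v) \<Rightarrow> nat \<Rightarrow> nat \<Rightarrow> nat \<Rightarrow> nat \<Rightarrow> 'v list" where
  "blocks f b g m n = concat (map (block f b g) [m..<n])"

definition pattern :: "(nat \<Rightarrow> 'v) \<Rightarrow> nat \<Rightarrow> nat \<Rightarrow> nat \<Rightarrow> 'v list" where
  "pattern f b g n = f 3 # blocks f b g 0 n @ [f 4]"

definition padding :: "(nat \<Rightarrow> 'v) \<Rightarrow> nat \<Rightarrow> nat \<Rightarrow> nat \<Rightarrow> nat \<Rightarrow> 'v list list" where
  "padding f b g H h = [] # map (\<lambda>a. blocks f b g (a * 2 ^ h) (Suc a * 2 ^ h)) [0..<2 ^ (H - h)]"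

definition entry1 :: "(nat \<Rightarrow> 'v) \<Rightarrow> (nat \<Rightarrow> nat \<Rightarrow> 'v) \<Rightarrow> nat \<Rightarrow> nat \<Rightarrow> nat \<Rightarrow> 'v list" where
  "entry1 f M b N e =
     segment f b 0 (e div N div b) (e div N mod b) (e mod N div b) (M 0 e) (e mod N mod b)"

definition entry2 :: "(nat \<Rightarrow> 'v) \<Rightarrow> (nat \<Rightarrow> nat \<Rightarrow> 'v) \<Rightarrow> nat \<Rightarrow> nat \<Rightarrow> nat \<Rightarrow> 'v list" where
  "entry2 f M b N e =
     segment f b (b - e div N mod b) (e div N div b) (e mod N div b) 0 (M 1 e) (b - e mod N mod b)"

definition entry3 :: "(nat \<Rightarrow> 'v) \<Rightarrow> (nat \<Rightarrow> nat \<Rightarrow> 'v) \<Rightarrow> nat \<Rightarrow> nat \<Rightarrow> nat \<Rightarrow> 'v list" where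
  "entry3 f M b N e =
     segment f b (e div N mod b) (e mod N div b) (e mod N mod b) (e div N div b) (M 2 e) 0"

text \<open>Levels descend before the middle and ascend after it: a prefix of the blocks is spelled
  by aligned runs from long to short, a suffix by runs from short to long.\<close>

definition ed_text ::
  "(nat \<Rightarrow> 'v) \<Rightarrow> (nat \<Rightarrow> nat \<Rightarrow> 'v) \<Rightarrow> nat \<Rightarrow> nat \<Rightarrow> nat \<Rightarrow> nat \<Rightarrow> 'v list list list" where
  "ed_text f M b g H N =
     [[f 3]] # map (\<lambda>h. padding f b g H (H - h)) [0..<Suc H] @
     [map (entry1 f M b N) [0..<N * N], map (entry2 f M b N) [0..<N * N],
      map (entry3 f M b N) [0..<N * N]] @
     map (padding f b g H) [0..<Suc H] @ [[[f 4]]]"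

text \<open>Renaming letters commutes with the whole construction. Applied with
  \<open>symbol_val\<close>, this identifies what the program writes symbolically with the numeric
  instance that is judged.\<close>

lemma map_segment: "map k (segment f b u d1 d2 d3 c w) = segment (k \<circ> f) b u d1 d2 d3 (k c) w"
  by (simp add: segment_def core_def one_hot_def)

lemma map_block: "map k (block f b g \<phi>) = block (k \<circ> f) b g \<phi>"
  by (simp add: block_def map_segment Let_def)

lemma map_blocks: "map k (blocks f b g m n) = blocks (k \<circ> f) b g m n"
  by (simp add: blocks_def map_concat map_block comp_def)

lemma map_pattern: "map k (pattern f b g n) = pattern (k \<circ> f) b g n"
  by (simp add: pattern_def map_blocks)

lemma map_padding: "map (map k) (padding f b g H h) = padding (k \<circ> f) b g H h"
  by (simp add: padding_def map_blocks)

lemma map_ed_text: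
  "map (map (map k)) (ed_text f M b g H N) = ed_text (k \<circ> f) (\<lambda>a e. k (M a e)) b g H N"
  by (simp add: ed_text_def map_padding entry1_def entry2_def entry3_def map_segment comp_def)

lemma length_core: "length (core f b d1 d2 d3 c) = 3 * b + 1"
  by (simp add: core_def one_hot_def)

lemma length_segment: "length (segment f b u d1 d2 d3 c w) = u + (3 * b + 1) + w"
  by (simp add: segment_def length_core)

text \<open>Three cores of length \<open>3 * b + 1\<close> and two fillers of length
  \<open>b\<close>.\<close>

lemma length_block: "length (block f b g \<phi>) = 11 * b + 3"
  by (simp add: block_def length_segment Let_def)

lemma length_blocks: "length (blocks f b g m n) = (n - m) * (11 * b + 3)"
  by (simp add: blocks_def length_concat comp_def length_block sum_list_triv)

lemma length_pattern: "length (pattern f b g n) = n * (11 * b + 3) + 2"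
  by (simp add: pattern_def length_blocks)

lemma blocks_append: "m \<le> n \<Longrightarrow> n \<le> p \<Longrightarrow> blocks f b g m n @ blocks f b g n p = blocks f b g m p"
  unfolding blocks_def
  by (metis concat_append le_Suc_ex map_append upt_add_eq_append)

lemma blocks_single: "blocks f b g n (Suc n) = block f b g n"
  by (simp add: blocks_def)

lemma blocks_empty: "blocks f b g n n = []"
  by (simp add: blocks_def)


section \<open>Decoding\<close>

text \<open>At position \<open>d\<close> the left code has a 1, and the right code has one there
  only if \<open>d' = d\<close>. Having one side in range is enough, which lets entry words be
  compared with a block \<open>\<phi>\<close> of which nothing is known.\<close>

lemma one_hot_eq_iff: "d < b \<Longrightarrow> one_hot (\<lambda>x. x) b d = one_hot (\<lambda>x. x) b d' \<longleftrightarrow> d = d'"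
proof
  assume "d < b" "one_hot (\<lambda>x. x) b d = one_hot (\<lambda>x. x) b d'"
  then have "one_hot (\<lambda>x. x) b d ! d = one_hot (\<lambda>x. x) b d' ! d" by simp
  with \<open>d < b\<close> show "d = d'" by (cases "d = d'") (simp_all add: one_hot_def)
qed simp

lemma core_eq_iff:
  assumes "d1 < b" "d2 < b" "d3 < b"
  shows "core (\<lambda>x. x) b d1 d2 d3 c = core (\<lambda>x. x) b d1' d2' d3' c' \<longleftrightarrow>
    d1 = d1' \<and> d2 = d2' \<and> d3 = d3' \<and> c = c'"
proof -
  have [simp]: "length (one_hot (\<lambda>x. x) b d) = b" for d :: nat by (simp add: one_hot_def)
  show ?thesis using assms by (simp add: core_def one_hot_eq_iff)
qed

lemma set_core: "set (core (\<lambda>x. x) b d1 d2 d3 c) \<subseteq> {0, 1, c}"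
  by (auto simp: core_def one_hot_def)

lemma core_Nil: "core f b d1 d2 d3 c \<noteq> []"
  by (simp add: core_def)

lemma hd_core: "c < 2 \<Longrightarrow> hd (core (\<lambda>x. x) b d1 d2 d3 c) \<noteq> 2"
  using hd_in_set[OF core_Nil, of "\<lambda>x. x" b d1 d2 d3 c] set_core[of b d1 d2 d3 c] by auto

lemma replicate_append_cancel:
  assumes "replicate u x @ v = replicate u' x @ v'" "v \<noteq> []" "v' \<noteq> []" "hd v \<noteq> x" "hd v' \<noteq> x"
  shows "u = u' \<and> v = v'"
  using assms
proof (induction u arbitrary: u')
  case 0
  then show ?case by (cases u') auto
next
  case (Suc u)
  then show ?case by (cases u') auto
qed

text \<open>One parsing step: cores have equal length and are cut off by position, a filler ends at
  the first letter other than \<open>x\<close>.\<close>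

lemma core_replicate_cancel:
  assumes "core f b d1 d2 d3 c @ replicate u x @ v = core f b d1' d2' d3' c' @ replicate u' x @ v'"
    and "v \<noteq> []" "v' \<noteq> []" "hd v \<noteq> x" "hd v' \<noteq> x"
  shows "core f b d1 d2 d3 c = core f b d1' d2' d3' c' \<and> u = u' \<and> v = v'"
proof -
  have "length (core f b d1 d2 d3 c) = length (core f b d1' d2' d3' c')"
    by (simp only: length_core)
  note * = iffD1[OF append_eq_append_conv[OF disjI1[OF this]] assms(1)]
  show ?thesis
    by (rule conjI[OF conjunct1[OF *] replicate_append_cancel[OF conjunct2[OF *] assms(2-5)]])
qed

lemma segment_eq_iff:
  assumes "c < 2" "c' < 2" "d1 < b" "d2 < b" "d3 < b"
  shows "segment (\<lambda>x. x) b u d1 d2 d3 c w = segment (\<lambda>x. x) b u' d1' d2' d3' c' w' \<longleftrightarrow>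
    u = u' \<and> d1 = d1' \<and> d2 = d2' \<and> d3 = d3' \<and> c = c' \<and> w = w'"
proof
  assume *: "segment (\<lambda>x. x) b u d1 d2 d3 c w = segment (\<lambda>x. x) b u' d1' d2' d3' c' w'"
  have "u = u' \<and> core (\<lambda>x. x) b d1 d2 d3 c @ replicate w 2 =
      core (\<lambda>x. x) b d1' d2' d3' c' @ replicate w' 2"
    using * assms unfolding segment_def
    by (intro replicate_append_cancel[where x = 2]) (simp_all add: core_Nil hd_core)
  then show "u = u' \<and> d1 = d1' \<and> d2 = d2' \<and> d3 = d3' \<and> c = c' \<and> w = w'"
    using assms by (auto simp: append_eq_append_conv length_core core_eq_iff)
qed simp

lemma block_core:
  "block f b g \<phi> =
     core f b (\<phi> div g div g div b) (\<phi> div g div g mod b) (\<phi> div g mod g) (f 1) @ replicate b (f 2) @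
     core f b (\<phi> div g mod g) (\<phi> mod g) 0 (f 1) @ replicate b (f 2) @
     core f b (\<phi> div g div g div b) (\<phi> div g div g mod b) (\<phi> mod g) (f 1)"
  by (simp add: block_def segment_def Let_def)

text \<open>The filler at the end of one word and the one at the start of the next become a single
  run, whose length is the sum. A block sees only these sums, which is how complementary lengths
  test equality.\<close>

lemma segments_core:
  "segment f b 0 d1 d2 d3 c u @ segment f b v d4 d5 d6 c' w @ segment f b x d7 d8 d9 c'' 0 =
     core f b d1 d2 d3 c @ replicate (u + v) (f 2) @
     core f b d4 d5 d6 c' @ replicate (w + x) (f 2) @ core f b d7 d8 d9 c''"
  by (simp add: segment_def replicate_add)

text \<open>Parsing both sides core by core turns the equality into equations between digits.
  \<open>\<phi>\<close> drops out because its vertex and its two interval numbers each occur in two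
  of the three cores.\<close>

lemma segments_eq_block:
  assumes "segment (\<lambda>x. x) b 0 d1 d2 d3 c u @ segment (\<lambda>x. x) b v d4 d5 d6 c' w @
      segment (\<lambda>x. x) b x d7 d8 d9 c'' 0 = block (\<lambda>x. x) b g \<phi>"
    and "c < 2" "c' < 2" "c'' < 2"
    and "d1 < b" "d2 < b" "d3 < b" "d4 < b" "d5 < b" "d6 < b" "d7 < b" "d8 < b" "d9 < b"
  shows "c = 1 \<and> c' = 1 \<and> c'' = 1 \<and> d1 = d7 \<and> d2 = d8 \<and> d3 = d4 \<and> d5 = d9 \<and> u + v = b \<and> w + x = b"
proof -
  note eq = assms(1)[unfolded segments_core block_core]
  have 2: "core (\<lambda>x. x) b d1 d2 d3 c =
      core (\<lambda>x. x) b (\<phi> div g div g div b) (\<phi> div g div g mod b) (\<phi> div g mod g) 1 \<and>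
    u + v = b \<and>
    core (\<lambda>x. x) b d4 d5 d6 c' @ replicate (w + x) 2 @ core (\<lambda>x. x) b d7 d8 d9 c'' =
     core (\<lambda>x. x) b (\<phi> div g mod g) (\<phi> mod g) 0 1 @ replicate b 2 @
     core (\<lambda>x. x) b (\<phi> div g div g div b) (\<phi> div g div g mod b) (\<phi> mod g) 1"
    by (rule core_replicate_cancel[OF eq]) (use assms(2-4) in \<open>simp_all add: core_Nil hd_core\<close>)
  have 4: "core (\<lambda>x. x) b d4 d5 d6 c' = core (\<lambda>x. x) b (\<phi> div g mod g) (\<phi> mod g) 0 1 \<and>
    w + x = b \<and> core (\<lambda>x. x) b d7 d8 d9 c'' =
     core (\<lambda>x. x) b (\<phi> div g div g div b) (\<phi> div g div g mod b) (\<phi> mod g) 1"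
    by (rule core_replicate_cancel[OF 2[THEN conjunct2, THEN conjunct2]])
      (use assms(2-4) in \<open>simp_all add: core_Nil hd_core\<close>)
  have "d1 = \<phi> div g div g div b \<and> d2 = \<phi> div g div g mod b \<and> d3 = \<phi> div g mod g \<and> c = 1"
    using 2 core_eq_iff[OF assms(5-7)] by blast
  moreover have "d4 = \<phi> div g mod g \<and> d5 = \<phi> mod g \<and> d6 = 0 \<and> c' = 1"
    using 4 core_eq_iff[OF assms(8-10)] by blast
  moreover have "d7 = \<phi> div g div g div b \<and> d8 = \<phi> div g div g mod b \<and> d9 = \<phi> mod g \<and> c'' = 1"
    using 4 core_eq_iff[OF assms(11-13)] by blast
  ultimately show ?thesis using 2 4 by (simp only: simp_thms)
qed

text \<open>The bound on \<open>\<phi>\<close> keeps the high digit of its vertex below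
  \<open>b\<close>, where one-hot codes are injective; \<open>\<phi>\<close> is then rebuilt from
  its digits.\<close>

lemma block_inj:
  assumes "block (\<lambda>x. x) b g \<phi> = block (\<lambda>x. x) b g \<psi>" "0 < g" "g \<le> b" "\<phi> < b * b * g * g"
  shows "\<phi> = \<psi>"
proof -
  have [simp]: "0 < b" using assms by simp
  have "\<phi> div g mod g < b" "\<phi> mod g < b"
    using assms by (meson less_le_trans mod_less_divisor)+
  moreover have "\<phi> div g div g div b < b"
    using assms by (simp add: div_mult2_eq[symmetric] less_mult_imp_div_less mult_ac)
  ultimately have *: "\<phi> div g div g div b = \<psi> div g div g div b" "\<phi> div g div g mod b = \<psi> div g div g mod b"
    "\<phi> div g mod g = \<psi> div g mod g" "\<phi> mod g = \<psi> mod g"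
    using assms(1) unfolding block_def Let_def
    by (auto simp: append_eq_append_conv length_segment segment_eq_iff)
  then have "\<phi> div g div g = \<psi> div g div g" by (metis div_mult_mod_eq)
  then have "\<phi> div g = \<psi> div g" using * by (metis div_mult_mod_eq)
  then show ?thesis using * by (metis div_mult_mod_eq)
qed

text \<open>Runs of one level start at different multiples of \<open>2 ^ h\<close>, so their first
  blocks already differ by \<open>block_inj\<close>. Distinctness matters because
  \<open>enumerates\<close> presents each set without repetition.\<close>

lemma distinct_padding:
  assumes "0 < g" "g \<le> b" "2 ^ H \<le> b * b * g * g" "h \<le> H"
  shows "distinct (padding (\<lambda>x. x) b g H h)"
proof -
  have less: "a * 2 ^ h < Suc a * 2 ^ h" for a by simp
  have first: "\<exists>v. blocks (\<lambda>x. x) b g (a * 2 ^ h) (Suc a * 2 ^ h) = block (\<lambda>x. x) b g (a * 2 ^ h) @ v" for a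
    unfolding blocks_def upt_conv_Cons[OF less] by simp
  have "inj_on (\<lambda>a. blocks (\<lambda>x. x) b g (a * 2 ^ h) (Suc a * 2 ^ h)) {..<2 ^ (H - h)}"
  proof (rule inj_onI)
    fix a a' assume a: "a \<in> {..<2 ^ (H - h)}"
      and eq: "blocks (\<lambda>x. x) b g (a * 2 ^ h) (Suc a * 2 ^ h) = blocks (\<lambda>x. x) b g (a' * 2 ^ h) (Suc a' * 2 ^ h)"
    have "block (\<lambda>x. x) b g (a * 2 ^ h) = block (\<lambda>x. x) b g (a' * 2 ^ h)"
      using eq first[of a] first[of a'] by (auto simp: append_eq_append_conv length_block)
    moreover have "a * 2 ^ h < 2 ^ H"
      using a assms(4) by (metis lessThan_iff less_2_cases_iff le_add_diff_inverse2 mult_less_cancel2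
          power_add zero_less_numeral zero_less_power)
    ultimately have "a * 2 ^ h = a' * 2 ^ h" using assms by (intro block_inj) auto
    then show "a = a'" by simp
  qed
  moreover have "blocks (\<lambda>x. x) b g (a * 2 ^ h) (Suc a * 2 ^ h) \<noteq> []" for a
    using first[of a] length_block[of "\<lambda>x. x" b g "a * 2 ^ h"] by auto
  ultimately show ?thesis
    unfolding padding_def by (auto simp: distinct_map atLeast0LessThan) (metis)
qed

lemma entry_digits:
  fixes e N b :: nat
  assumes "e < N * N" "N \<le> b * b"
  shows "e div N div b < b" "e div N mod b < b" "e mod N div b < b" "e mod N mod b < b" "e div N < N" "e mod N < N"
proof -
  have N: "0 < N" "0 < b" using assms by (auto intro!: Nat.gr0I)
  show *: "e div N < N" "e mod N < N" using assms N by (simp_all add: less_mult_imp_div_less)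
  have "v div b < b" if "v < N" for v
    using that assms by (meson less_le_trans less_mult_imp_div_less)
  then show "e div N div b < b" "e mod N div b < b" using * by auto
  show "e div N mod b < b" "e mod N mod b < b" using N by auto
qed

lemma index_eqI:
  fixes b :: nat
  shows "e div N div b = e' div N div b \<Longrightarrow> e div N mod b = e' div N mod b \<Longrightarrow>
    e mod N div b = e' mod N div b \<Longrightarrow> e mod N mod b = e' mod N mod b \<Longrightarrow> e = e'"
  by (metis div_mult_mod_eq)

text \<open>Row and column of \<open>e\<close> can be recovered from code digits and filler lengths,
  so the words differ whatever the matrix entries are. The subtractions in \<open>entry2\<close>
  lose nothing, as remainders are below \<open>b\<close>.\<close>

lemma distinct_entries:
  assumes "N \<le> b * b" "\<And>a e. M a e < 2"
  shows "distinct (map (entry1 (\<lambda>x. x) M b N) [0..<N * N])"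
    "distinct (map (entry2 (\<lambda>x. x) M b N) [0..<N * N])"
    "distinct (map (entry3 (\<lambda>x. x) M b N) [0..<N * N])"
proof -
  note d = entry_digits[OF _ assms(1)]
  show "distinct (map (entry1 (\<lambda>x. x) M b N) [0..<N * N])"
    unfolding distinct_map
    by (auto intro!: inj_onI simp: entry1_def segment_eq_iff assms(2) d intro: index_eqI)
  have "e = e'" if "e < N * N" "e' < N * N" "entry2 (\<lambda>x. x) M b N e = entry2 (\<lambda>x. x) M b N e'" for e e'
  proof -
    have "0 < b" using d(2)[OF that(1)] by auto
    then have *: "b - e div N mod b = b - e' div N mod b" "e div N div b = e' div N div b"
      "e mod N div b = e' mod N div b" "b - e mod N mod b = b - e' mod N mod b"
      using that by (auto simp: entry2_def segment_eq_iff assms(2) d)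
    have "e div N mod b = e' div N mod b" "e mod N mod b = e' mod N mod b"
      using *(1,4) d(2,4)[OF that(1)] d(2,4)[OF that(2)] by linarith+
    with * show ?thesis by (auto intro: index_eqI)
  qed
  then show "distinct (map (entry2 (\<lambda>x. x) M b N) [0..<N * N])"
    unfolding distinct_map by (auto intro!: inj_onI)
  show "distinct (map (entry3 (\<lambda>x. x) M b N) [0..<N * N])"
    unfolding distinct_map
    by (auto intro!: inj_onI simp: entry3_def segment_eq_iff assms(2) d intro: index_eqI)
qed


section \<open>Triangles and factorizations of the pattern\<close>

abbreviation picks :: "'a list list \<Rightarrow> 'a list list list \<Rightarrow> bool" where
  "picks \<equiv> list_all2 (\<lambda>w X. w \<in> set X)"

lemma padding_memberI: "a < 2 ^ (H - h) \<Longrightarrow> blocks f b g (a * 2 ^ h) (Suc a * 2 ^ h) \<in> set (padding f b g H h)"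
  by (auto simp: padding_def)

lemma Nil_padding: "[] \<in> set (padding f b g H h)"
  by (simp add: padding_def)

text \<open>Binary expansion of \<open>r\<close>: the run number \<open>a\<close> of level
  \<open>h + 1\<close> has the halves \<open>2 * a\<close> and \<open>2 * a + 1\<close> of level
  \<open>h\<close>. If the bit of weight \<open>2 ^ h\<close> is set, the first half is picked and
  the rest lies in the second; otherwise the empty word is picked.\<close>

lemma padding_prefix:
  "h \<le> H \<Longrightarrow> a < 2 ^ (H - h) \<Longrightarrow> r < 2 ^ h \<Longrightarrow>
   \<exists>Qs. picks Qs (map (padding f b g H) (rev [0..<h])) \<and> concat Qs = blocks f b g (a * 2 ^ h) (a * 2 ^ h + r)"
proof (induction h arbitrary: a r)
  case 0
  then show ?case by (auto simp: blocks_empty)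
next
  case (Suc h)
  have *: "2 ^ (H - h) = 2 * (2::nat) ^ (H - Suc h)"
    using Suc.prems(1) by (metis Suc_diff_Suc less_eq_Suc_le power_Suc)
  show ?case
  proof (cases "r < 2 ^ h")
    case True
    obtain Qs where "picks Qs (map (padding f b g H) (rev [0..<h]))"
      "concat Qs = blocks f b g (2 * a * 2 ^ h) (2 * a * 2 ^ h + r)"
      using Suc.IH[of "2 * a" r] Suc.prems True * by auto
    then show ?thesis
      by (intro exI[of _ "[] # Qs"]) (auto simp: Nil_padding mult_ac)
  next
    case False
    then have "r - 2 ^ h < 2 ^ h" using Suc.prems(3) by simp
    then obtain Qs where "picks Qs (map (padding f b g H) (rev [0..<h]))"
      "concat Qs = blocks f b g (Suc (2 * a) * 2 ^ h) (Suc (2 * a) * 2 ^ h + (r - 2 ^ h))"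
      using Suc.IH[of "Suc (2 * a)" "r - 2 ^ h"] Suc.prems False * by auto
    moreover have "blocks f b g (2 * a * 2 ^ h) (Suc (2 * a) * 2 ^ h) \<in> set (padding f b g H h)"
      by (rule padding_memberI) (use * Suc.prems in simp)
    moreover have "blocks f b g (2 * a * 2 ^ h) (Suc (2 * a) * 2 ^ h) @
        blocks f b g (Suc (2 * a) * 2 ^ h) (Suc (2 * a) * 2 ^ h + (r - 2 ^ h)) =
        blocks f b g (a * 2 ^ Suc h) (a * 2 ^ Suc h + r)"
      using False by (subst blocks_append) (auto simp: algebra_simps)
    ultimately show ?thesis
      by (intro exI[of _ "blocks f b g (2 * a * 2 ^ h) (Suc (2 * a) * 2 ^ h) # Qs"]) auto
  qed
qed

text \<open>Mirror image of the prefix: the second half is picked when the suffix contains it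
  entirely. The condition \<open>0 < r\<close> reflects that for \<open>h = 0\<close> there is no
  set to pick from, so only the empty suffix can be spelled.\<close>

lemma padding_suffix:
  "h \<le> H \<Longrightarrow> a < 2 ^ (H - h) \<Longrightarrow> 0 < r \<Longrightarrow> r \<le> 2 ^ h \<Longrightarrow>
   \<exists>Qs. picks Qs (map (padding f b g H) [0..<h]) \<and> concat Qs = blocks f b g (a * 2 ^ h + r) (Suc a * 2 ^ h)"
proof (induction h arbitrary: a r)
  case 0
  then have "r = 1" by simp
  then show ?case by (auto simp: blocks_empty)
next
  case (Suc h)
  have *: "2 ^ (H - h) = 2 * (2::nat) ^ (H - Suc h)"
    using Suc.prems(1) by (metis Suc_diff_Suc less_eq_Suc_le power_Suc)
  show ?case
  proof (cases "r \<le> 2 ^ h")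
    case True
    obtain Qs where "picks Qs (map (padding f b g H) [0..<h])"
      "concat Qs = blocks f b g (2 * a * 2 ^ h + r) (Suc (2 * a) * 2 ^ h)"
      using Suc.IH[of "2 * a" r] Suc.prems True * by auto
    moreover have "blocks f b g (Suc (2 * a) * 2 ^ h) (Suc (Suc (2 * a)) * 2 ^ h) \<in> set (padding f b g H h)"
      by (rule padding_memberI) (use * Suc.prems in simp)
    moreover have "blocks f b g (2 * a * 2 ^ h + r) (Suc (2 * a) * 2 ^ h) @
        blocks f b g (Suc (2 * a) * 2 ^ h) (Suc (Suc (2 * a)) * 2 ^ h) =
        blocks f b g (a * 2 ^ Suc h + r) (Suc a * 2 ^ Suc h)"
      using True by (subst blocks_append) (auto simp: algebra_simps)
    ultimately show ?thesis
      by (intro exI[of _ "Qs @ [blocks f b g (Suc (2 * a) * 2 ^ h) (Suc (Suc (2 * a)) * 2 ^ h)]"])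
        (auto simp: list_all2_appendI)
  next
    case False
    then have "r - 2 ^ h \<le> 2 ^ h" using Suc.prems(4) by simp
    then obtain Qs where "picks Qs (map (padding f b g H) [0..<h])"
      "concat Qs = blocks f b g (Suc (2 * a) * 2 ^ h + (r - 2 ^ h)) (Suc (Suc (2 * a)) * 2 ^ h)"
      using Suc.IH[of "Suc (2 * a)" "r - 2 ^ h"] Suc.prems False * by auto
    moreover have "Suc (2 * a) * 2 ^ h + (r - 2 ^ h) = a * 2 ^ Suc h + r"
      "Suc (Suc (2 * a)) * 2 ^ h = Suc a * 2 ^ Suc h"
      using False by (auto simp: algebra_simps)
    ultimately show ?thesis
      by (intro exI[of _ "Qs @ [[]]"]) (auto simp: list_all2_appendI Nil_padding mult_ac)
  qed
qed

text \<open>Soundness uses only lengths: whatever runs are chosen, consecutive or not, what they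
  leave for the middle is aligned with the blocks.\<close>

lemma picks_padding_dvd:
  "picks Qs (map (padding f b g H) hs) \<Longrightarrow> 11 * b + 3 dvd length (concat Qs)"
proof (induction hs arbitrary: Qs)
  case (Cons h hs)
  then obtain Q Qs' where "Qs = Q # Qs'" "Q \<in> set (padding f b g H h)" "picks Qs' (map (padding f b g H) hs)"
    by (auto simp: list_all2_Cons2)
  moreover from this have "11 * b + 3 dvd length Q" by (auto simp: padding_def length_blocks)
  ultimately show ?case using Cons.IH by simp
qed simp

text \<open>The words picked from the padding have lengths divisible by the block length, so what remains
  between them is aligned with the blocks.\<close>

lemma blocks_eq_append3:
  assumes "u @ v @ w = blocks f b g 0 n" "11 * b + 3 dvd length u" "11 * b + 3 dvd length w"
    and "v \<noteq> []" "length v < 2 * (11 * b + 3)"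
  shows "\<exists>\<phi>. v = block f b g \<phi>"
proof -
  define l where "l = 11 * b + 3"
  obtain k k' where k: "length u = k * l" "length w = k' * l"
    using assms(2,3) unfolding l_def by (metis dvd_def mult.commute)
  have len: "k * l + length v + k' * l = n * l"
    using arg_cong[OF assms(1), of length] k by (simp add: length_blocks l_def)
  have "l dvd length v"
    by (metis dvd_add_right_iff dvd_add_times_triv_right_iff dvd_triv_right len)
  then obtain c where c: "length v = c * l" by (metis dvd_def mult.commute)
  have "c = 1" using assms(4,5) c unfolding l_def[symmetric] by (cases c; cases "c - 1") auto
  have "(k + 1 + k') * l = n * l" using len c \<open>c = 1\<close> by (simp add: algebra_simps)
  then have n: "n = k + 1 + k'" using mult_cancel2[of "k + 1 + k'" l n] by (simp add: l_def)
  have "blocks f b g 0 k @ block f b g k @ blocks f b g (Suc k) n = blocks f b g 0 n"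
    by (subst blocks_single[symmetric]) (simp add: blocks_append n)
  with assms(1) have "u @ v @ w = blocks f b g 0 k @ block f b g k @ blocks f b g (Suc k) n" by simp
  then have "v = block f b g k"
    using k c \<open>c = 1\<close> by (simp add: append_eq_append_conv length_blocks length_block l_def)
  then show ?thesis by blast
qed

definition middle ::
  "(nat \<Rightarrow> 'v) \<Rightarrow> (nat \<Rightarrow> nat \<Rightarrow> 'v) \<Rightarrow> nat \<Rightarrow> nat \<Rightarrow> nat \<Rightarrow> nat \<Rightarrow> 'v list list list" where
  "middle f M b g H N = map (padding f b g H) (rev [0..<Suc H]) @
     [map (entry1 f M b N) [0..<N * N], map (entry2 f M b N) [0..<N * N],
      map (entry3 f M b N) [0..<N * N]] @ map (padding f b g H) [0..<Suc H]"

lemma ed_text_middle: "ed_text f M b g H N = [[f 3]] # middle f M b g H N @ [[[f 4]]]"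
proof -
  have "map (\<lambda>h. padding f b g H (H - h)) [0..<Suc H] = map (padding f b g H) (rev [0..<Suc H])"
    by (rule nth_equalityI) (auto simp: rev_nth simp del: upt_Suc)
  then show ?thesis by (simp add: ed_text_def middle_def del: upt_Suc)
qed

text \<open>The three entry words have \<open>9 * b + 3\<close> letters in cores and at most
  \<open>4 * b\<close> in fillers, less than two blocks. Being nonempty and of a length divisible by
  the block length, they form exactly one block.\<close>

lemma entry_lengths:
  "u < b \<Longrightarrow> v \<le> b \<Longrightarrow> w \<le> b \<Longrightarrow> x < b \<Longrightarrow>
    0 + (3 * b + 1) + u + (v + (3 * b + 1) + w + (x + (3 * b + 1) + 0)) < 2 * (11 * b + 3)" for b :: nat
  by simp

lemma picks_imp_triangle:
  assumes "picks Qs (middle (\<lambda>x. x) M b g H N)" "concat Qs = blocks (\<lambda>x. x) b g 0 (2 ^ H)"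
    and "N \<le> b * b" and M: "\<And>a e. M a e < 2"
  shows "\<exists>i<N. \<exists>j<N. \<exists>k<N. M 0 (i * N + j) = 1 \<and> M 1 (j * N + k) = 1 \<and> M 2 (k * N + i) = 1"
proof -
  from assms(1)[unfolded middle_def] obtain Q1 e1 e2 e3 Q2 where
    Qs: "Qs = Q1 @ [entry1 (\<lambda>x. x) M b N e1, entry2 (\<lambda>x. x) M b N e2, entry3 (\<lambda>x. x) M b N e3] @ Q2"
    and Q: "picks Q1 (map (padding (\<lambda>x. x) b g H) (rev [0..<Suc H]))"
      "picks Q2 (map (padding (\<lambda>x. x) b g H) [0..<Suc H])"
    and e: "e1 < N * N" "e2 < N * N" "e3 < N * N"
    by (auto simp: list_all2_append2 list_all2_Cons2 simp del: upt_Suc)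
  let ?v = "entry1 (\<lambda>x. x) M b N e1 @ entry2 (\<lambda>x. x) M b N e2 @ entry3 (\<lambda>x. x) M b N e3"
  note d1 = entry_digits[OF e(1) assms(3)]
  note d2 = entry_digits[OF e(2) assms(3)]
  note d3 = entry_digits[OF e(3) assms(3)]
  have eq: "concat Q1 @ ?v @ concat Q2 = blocks (\<lambda>x. x) b g 0 (2 ^ H)"
    using assms(2) Qs by simp
  have "length ?v < 2 * (11 * b + 3)"
    unfolding entry1_def entry2_def entry3_def length_append length_segment
    by (rule entry_lengths[OF d1(4) diff_le_self diff_le_self d3(2)])
  then have "\<exists>\<phi>. ?v = block (\<lambda>x. x) b g \<phi>"
    by (intro blocks_eq_append3[OF eq picks_padding_dvd[OF Q(1)] picks_padding_dvd[OF Q(2)]])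
      (auto simp: entry1_def segment_def core_Nil)
  then obtain \<phi> where "?v = block (\<lambda>x. x) b g \<phi>" by blast
  then have "M 0 e1 = 1 \<and> M 1 e2 = 1 \<and> M 2 e3 = 1 \<and> e1 div N div b = e3 mod N div b \<and>
      e1 div N mod b = e3 mod N mod b \<and> e1 mod N div b = e2 div N div b \<and>
      e2 mod N div b = e3 div N div b \<and>
      e1 mod N mod b + (b - e2 div N mod b) = b \<and> (b - e2 mod N mod b) + e3 div N mod b = b"
    unfolding entry1_def entry2_def entry3_def
    by (intro segments_eq_block[where g = g and \<phi> = \<phi> and ?d6.0 = 0]) (use d1 d2 d3 M in auto)
  \<comment> \<open>From \<open>j + (b - j') = b\<close> follows \<open>j = j'\<close>; as
    \<open>j' < b\<close>, the subtraction is not truncated.\<close>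
  moreover from this have "e1 mod N mod b = e2 div N mod b" "e2 mod N mod b = e3 div N mod b"
    using d2(2,4) by linarith+
  ultimately have *: "M 0 e1 = 1" "M 1 e2 = 1" "M 2 e3 = 1"
    "e1 div N = e3 mod N" "e1 mod N = e2 div N" "e2 mod N = e3 div N"
    by (metis div_mult_mod_eq)+
  \<comment> \<open>The three positions are now chained cyclically; the triangle is
    \<open>i = e1 div N\<close>, \<open>j = e1 mod N\<close>, \<open>k = e2 mod N\<close>.\<close>
  have "e1 = (e1 div N) * N + e1 mod N" "e2 = (e1 mod N) * N + e2 mod N" "e3 = (e2 mod N) * N + e1 div N"
    using *(4-6) by (metis div_mult_mod_eq)+
  with *(1-3) d1(5,6) d2(6) show ?thesis by metis
qed

lemma triangle_imp_picks:
  assumes "i < N" "j < N" "k < N" "M 0 (i * N + j) = f 1" "M 1 (j * N + k) = f 1" "M 2 (k * N + i) = f 1"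
    and "N \<le> g * b" "N * g * g \<le> 2 ^ H"
  shows "\<exists>Qs. picks Qs (middle f M b g H N) \<and> concat Qs = blocks f b g 0 (2 ^ H)"
proof -
  have b: "0 < b" using assms by (intro Nat.gr0I) auto
  define x y where "x = j div b" and "y = k div b"
  have xy: "x < g" "y < g"
    using assms by (auto simp: x_def y_def mult.commute intro!: less_mult_imp_div_less)
  define \<phi> where "\<phi> = (i * g + x) * g + y"
  have \<phi>: "\<phi> div g = i * g + x" "\<phi> mod g = y" "(i * g + x) div g = i" "(i * g + x) mod g = x"
    using xy by (simp_all add: \<phi>_def)
  have "i * g + x < N * g"
    by (metis assms(1) \<phi>(3) div_less_iff_less_mult gr_implies_not0 neq0_conv xy(1))
  then have "\<phi> div g < N * g" using \<phi> by simp
  then have "\<phi> < N * g * g"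
    by (metis div_less_iff_less_mult gr_implies_not0 neq0_conv xy(1))
  then have \<phi>_less: "\<phi> < 2 ^ H" using assms(8) by simp
  obtain Q1 where Q1: "picks Q1 (map (padding f b g H) (rev [0..<H]))"
    "concat Q1 = blocks f b g 0 \<phi>"
    using padding_prefix[of H H 0 \<phi> f b g] \<phi>_less by auto
  obtain Q2 where Q2: "picks Q2 (map (padding f b g H) [0..<H])"
    "concat Q2 = blocks f b g (Suc \<phi>) (2 ^ H)"
    using padding_suffix[of H H 0 "Suc \<phi>" f b g] \<phi>_less by auto
  let ?e1 = "entry1 f M b N (i * N + j)" and ?e2 = "entry2 f M b N (j * N + k)"
    and ?e3 = "entry3 f M b N (k * N + i)"
  have less: "v * N + w < N * N" if "v < N" "w < N" for v w
  proof -
    have "v * N + w < Suc v * N" using that by simp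
    also have "\<dots> \<le> N * N" using that by (intro mult_le_mono1) simp
    finally show ?thesis .
  qed
  have b': "j mod b + (b - j mod b) = b" "b - k mod b + k mod b = b"
    using b by (simp_all add: less_imp_le)
  have eq: "?e1 @ ?e2 @ ?e3 = block f b g \<phi>"
    unfolding entry1_def entry2_def entry3_def segments_core block_core
    using assms(1-6) b' \<phi> by (simp add: x_def[symmetric] y_def[symmetric])
  have "blocks f b g \<phi> (Suc \<phi>) @ blocks f b g (Suc \<phi>) (2 ^ H) = blocks f b g \<phi> (2 ^ H)"
    "blocks f b g 0 \<phi> @ blocks f b g \<phi> (2 ^ H) = blocks f b g 0 (2 ^ H)"
    using \<phi>_less by (auto intro: blocks_append)
  then have "concat Q1 @ (?e1 @ ?e2 @ ?e3) @ concat Q2 = blocks f b g 0 (2 ^ H)"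
    unfolding eq Q1(2) Q2(2) blocks_single by simp
  \<comment> \<open>Level \<open>H\<close> contributes the empty word on both sides, since block
    \<open>\<phi>\<close> itself is left to the middle.\<close>
  then have 4: "concat (([] # Q1) @ [?e1, ?e2, ?e3] @ (Q2 @ [[]])) = blocks f b g 0 (2 ^ H)"
    by simp
  have 1: "picks ([] # Q1) (map (padding f b g H) (rev [0..<Suc H]))"
    using Q1(1) by (simp add: Nil_padding)
  have 3: "picks (Q2 @ [[]]) (map (padding f b g H) [0..<Suc H])"
    using Q2(1) by (simp add: Nil_padding list_all2_appendI)
  have 2: "picks [?e1, ?e2, ?e3] [map (entry1 f M b N) [0..<N * N],
      map (entry2 f M b N) [0..<N * N], map (entry3 f M b N) [0..<N * N]]"
    using less assms(1-3) by simp
  have "picks (([] # Q1) @ [?e1, ?e2, ?e3] @ (Q2 @ [[]])) (middle f M b g H N)"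
    unfolding middle_def by (rule list_all2_appendI[OF 1 list_all2_appendI[OF 2 3]])
  then show ?thesis using 4 by blast
qed

section \<open>Occurrences between two end markers\<close>

lemma nth_drop_take: "q < j - i \<Longrightarrow> j \<le> length T \<Longrightarrow> drop i (take j T) ! q = T ! (i + q)"
  by simp

text \<open>The marker \<open>l\<close> occurs only in the first set and \<open>r\<close> only in
  the last, so an occurrence spans all positions. Its end pieces, a suffix of \<open>[l]\<close> and
  a prefix of \<open>[r]\<close> that contain the markers, are whole words; inner pieces are whole
  words by definition. A match is thus a choice of one word per set.\<close>

lemma occurrence_iff_picks:
  assumes "l \<noteq> r" and free: "\<And>X w. X \<in> set L \<Longrightarrow> w \<in> set X \<Longrightarrow> l \<notin> set w \<and> r \<notin> set w"
  shows "occurrence_ends (l # p @ [r]) (map set ([[l]] # L @ [[[r]]])) \<noteq> {} \<longleftrightarrow>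
    (\<exists>Qs. picks Qs L \<and> concat Qs = p)"
proof
  let ?T = "map set ([[l]] # L @ [[[r]]])"
  define n where "n = length ?T"
  have n: "n = length L + 2" by (simp add: n_def)
  have l: "m = 0 \<and> w = [l]" if "m < n" "w \<in> ?T ! m" "l \<in> set w" for m w
  proof (cases m)
    case 0
    then show ?thesis using that by simp
  next
    case (Suc m')
    then have "w \<in> (map set L @ [{[r]}]) ! m'" using that by simp
    then show ?thesis
      using that assms(1) free[OF nth_mem] Suc n
      by (cases "m' < length L") (auto simp: nth_append less_Suc_eq)
  qed
  have r: "m = n - 1 \<and> w = [r]" if "m < n" "w \<in> ?T ! m" "r \<in> set w" for m w
  proof (cases m)
    case 0
    then show ?thesis using that assms(1) by simp
  next
    case (Suc m')
    then have "w \<in> (map set L @ [{[r]}]) ! m'" using that by simp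
    then show ?thesis
      using that free[OF nth_mem] Suc n
      by (cases "m' < length L") (auto simp: nth_append less_Suc_eq)
  qed
  {
    assume "occurrence_ends (l # p @ [r]) ?T \<noteq> {}"
    then obtain i j where ij: "1 \<le> i" "i \<le> j" "j \<le> n"
      and m: "matches (l # p @ [r]) (drop (i - 1) (take j ?T))"
      unfolding occurrence_ends_def n_def by blast
    define X where "X = drop (i - 1) (take j ?T)"
    have X: "X ! q = ?T ! (i - 1 + q)" if "q < length X" for q
      using that ij unfolding X_def n_def by (intro nth_drop_take) auto
    have lenX: "length X = j - (i - 1)" using ij unfolding X_def n_def by simp
    from m[folded X_def] show "\<exists>Qs. picks Qs L \<and> concat Qs = p"
      unfolding matches_def
    proof (elim disjE conjE exE bexE)
      fix w assume len: "length X = 1" and w: "w \<in> X ! 0" "sublist (l # p @ [r]) w"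
      then have "w \<in> ?T ! (i - 1)" using X[of 0] by simp
      moreover have "l \<in> set w" "r \<in> set w" using set_mono_sublist[OF w(2)] by auto
      moreover have "i - 1 < n" using ij by simp
      ultimately have "i - 1 = 0" "i - 1 = n - 1" using l r by blast+
      \<comment> \<open>A single position would have to be both first and last, but the text has at
        least two.\<close>
      then show ?thesis using n by simp
    next
      fix Ps u v assume len: "1 < length X" "length Ps = length X" and P: "l # p @ [r] = concat Ps"
        and u: "u \<in> X ! 0" "suffix (Ps ! 0) u"
        and v: "v \<in> X ! (length X - 1)" "prefix (Ps ! (length X - 1)) v"
        and mid: "\<forall>i. 0 < i \<and> i < length X - 1 \<longrightarrow> Ps ! i \<in> X ! i"
      \<comment> \<open>A piece at either end is only part of a word, but inclusion of its letters
        is enough to locate the markers.\<close>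
      have piece: "\<exists>w \<in> ?T ! (i - 1 + q). set (Ps ! q) \<subseteq> set w" if "q < length X" for q
      proof -
        have "q = 0 \<or> q = length X - 1 \<or> 0 < q \<and> q < length X - 1" using that by linarith
        then consider "q = 0" | "q = length X - 1" | "0 < q \<and> q < length X - 1" by blast
        then have "\<exists>w \<in> X ! q. set (Ps ! q) \<subseteq> set w"
          using u v mid set_mono_suffix set_mono_prefix by cases blast+
        then show ?thesis using X[OF that] by simp
      qed
      have "l \<in> set (concat Ps)" "r \<in> set (concat Ps)" by (simp_all flip: P)
      then obtain ql qr where ql: "ql < length X" "l \<in> set (Ps ! ql)" and qr: "qr < length X" "r \<in> set (Ps ! qr)"
        using len(2) by (metis (no_types, lifting) UN_E in_set_conv_nth set_concat)
      have "i - 1 + ql < n" "i - 1 + qr < n" using ql qr ij lenX by linarith+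
      then have "i - 1 + ql = 0" "i - 1 + qr = n - 1" using piece[OF ql(1)] piece[OF qr(1)] ql qr l r by blast+
      then have i: "i = 1" "ql = 0" "qr = n - 1" using ij by auto
      then have "j = n" using qr ij lenX by simp
      then have X_eq: "X = ?T" using i by (simp add: X_def n_def)
      have "Ps ! 0 = [l]" "Ps ! (n - 1) = [r]"
        using u v ql qr i X_eq n
        by (auto simp: suffix_Cons prefix_Cons n_def[symmetric] nth_append)
      moreover have "length Ps = length L + 2" using len X_eq n n_def by simp
      then obtain a Qs c where Ps: "Ps = a # Qs @ [c]" and lenQs: "length Qs = length L"
        by (cases Ps; cases "tl Ps" rule: rev_cases) auto
      ultimately have "a = [l]" "c = [r]" using n lenQs by (auto simp: nth_append)
      then have "concat Qs = p" using P Ps by simp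
      moreover have "picks Qs L"
      proof (rule list_all2_all_nthI[OF lenQs])
        fix q assume q: "q < length Qs"
        then have "0 < Suc q \<and> Suc q < length X - 1" using lenQs X_eq by simp
        then have "Ps ! Suc q \<in> X ! Suc q" using mid by blast
        then show "Qs ! q \<in> set (L ! q)" using q lenQs by (simp add: Ps X_eq nth_append)
      qed
      ultimately show ?thesis by blast
    qed
  }
  {
    assume "\<exists>Qs. picks Qs L \<and> concat Qs = p"
    then obtain Qs where Qs: "picks Qs L" "concat Qs = p" by blast
    then have len: "length Qs = length L" by (simp add: list_all2_lengthD)
    have "matches (l # p @ [r]) ?T"
      unfolding matches_def
    proof (intro disjI2 conjI exI[of _ "[l] # Qs @ [[r]]"] allI impI)
      fix q assume "0 < q \<and> q < length ?T - 1"
      then obtain q' where "q = Suc q'" "q' < length L" by (cases q) auto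
      then show "([l] # Qs @ [[r]]) ! q \<in> ?T ! q"
        using list_all2_nthD[OF Qs(1), of q'] len by (simp add: nth_append)
    qed (use Qs len in \<open>simp_all add: nth_append\<close>)
    then have "n \<in> occurrence_ends (l # p @ [r]) ?T"
      unfolding occurrence_ends_def n_def by (intro CollectI exI[of _ 1]) simp
    then show "occurrence_ends (l # p @ [r]) ?T \<noteq> {}" by blast
  }
qed

lemma set_segment: "set (segment (\<lambda>x. x) b u d1 d2 d3 c w) \<subseteq> {0, 1, 2, c}"
  using set_core[of b d1 d2 d3 c] by (auto simp: segment_def)

lemma set_blocks: "set (blocks (\<lambda>x. x) b g m n) \<subseteq> {0, 1, 2}"
proof -
  have "set (block (\<lambda>x. x) b g \<phi>) \<subseteq> {0, 1, 2}" for \<phi>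
    unfolding block_def Let_def set_append by (intro Un_least order_trans[OF set_segment]) auto
  then show ?thesis unfolding blocks_def by (auto simp only: set_concat set_map)
qed

lemma set_middle:
  assumes "X \<in> set (middle (\<lambda>x. x) M b g H N)" "w \<in> set X" and M: "\<And>a e. M a e < 2"
  shows "set w \<subseteq> {0, 1, 2}"
proof -
  have M': "M a e \<in> {0, 1, 2}" for a e using M[of a e] by auto
  have pad: "set w \<subseteq> {0, 1, 2}" if "w \<in> set (padding (\<lambda>x. x) b g H h)" for h
  proof -
    have "w = [] \<or> (\<exists>m n. w = blocks (\<lambda>x. x) b g m n)"
      using that unfolding padding_def by (auto simp del: mult_Suc)
    then show ?thesis using set_blocks[of b g] by (metis empty_subsetI list.set(1))
  qed
  have ent: "set (entry1 (\<lambda>x. x) M b N e) \<subseteq> {0, 1, 2}" "set (entry2 (\<lambda>x. x) M b N e) \<subseteq> {0, 1, 2}"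
    "set (entry3 (\<lambda>x. x) M b N e) \<subseteq> {0, 1, 2}" for e
    unfolding entry1_def entry2_def entry3_def
    by (rule order_trans[OF set_segment]; use M' in auto)+
  have "(\<exists>h. w \<in> set (padding (\<lambda>x. x) b g H h)) \<or> (\<exists>e. w = entry1 (\<lambda>x. x) M b N e) \<or>
      (\<exists>e. w = entry2 (\<lambda>x. x) M b N e) \<or> (\<exists>e. w = entry3 (\<lambda>x. x) M b N e)"
    using assms(1,2) unfolding middle_def by (auto simp del: upt_Suc)
  then show ?thesis using pad ent by metis
qed

text \<open>\<open>N \<le> b * b\<close> makes two digits enough for a vertex,
  \<open>N \<le> g * b\<close> makes the intervals cover the range, and
  \<open>N * g * g \<le> 2 ^ H\<close> provides a block for every triple. Surplus blocks do no harm,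
  as a match with any block yields a triangle.\<close>

theorem occurrence_iff_triangle:
  assumes M: "\<And>a e. M a e < 2" and "N \<le> b * b" "N \<le> g * b" "N * g * g \<le> 2 ^ H"
  shows "occurrence_ends (pattern (\<lambda>x. x) b g (2 ^ H)) (map set (ed_text (\<lambda>x. x) M b g H N)) \<noteq> {} \<longleftrightarrow>
    (\<exists>i<N. \<exists>j<N. \<exists>k<N. M 0 (i * N + j) = 1 \<and> M 1 (j * N + k) = 1 \<and> M 2 (k * N + i) = 1)"
proof -
  have "occurrence_ends (pattern (\<lambda>x. x) b g (2 ^ H)) (map set (ed_text (\<lambda>x. x) M b g H N)) \<noteq> {} \<longleftrightarrow>
      (\<exists>Qs. picks Qs (middle (\<lambda>x. x) M b g H N) \<and> concat Qs = blocks (\<lambda>x. x) b g 0 (2 ^ H))"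
    unfolding pattern_def ed_text_middle
  proof (rule occurrence_iff_picks)
    show "3 \<notin> set w \<and> 4 \<notin> set w" if "X \<in> set (middle (\<lambda>x. x) M b g H N)" "w \<in> set X" for X w
      using set_middle[where M = M, OF that M] by auto
  qed simp
  also have "\<dots> \<longleftrightarrow> (\<exists>i<N. \<exists>j<N. \<exists>k<N. M 0 (i * N + j) = 1 \<and> M 1 (j * N + k) = 1 \<and> M 2 (k * N + i) = 1)"
    using picks_imp_triangle[where M = M and b = b and g = g and H = H and N = N, OF _ _ assms(2) M]
      triangle_imp_picks[where M = M and b = b and g = g and H = H and N = N and f = "\<lambda>x. x", OF _ _ _ _ _ _ assms(3,4)]
    by blast
  finally show ?thesis .
qed

section \<open>Well-formedness and size of the instance\<close>

lemma enumerates_ed_text: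
  assumes M: "\<And>a e. M a e < 2" and "N \<le> b * b" "0 < g" "g \<le> b" "2 ^ H \<le> b * b * g * g"
  shows "enumerates (ed_text (\<lambda>x. x) M b g H N) (map set (ed_text (\<lambda>x. x) M b g H N))"
proof -
  have "distinct X" if "X \<in> set (ed_text (\<lambda>x. x) M b g H N)" for X
    using that distinct_entries[where M = M, OF assms(2) M] distinct_padding[OF assms(3,4,5)]
    unfolding ed_text_def by (auto simp del: upt_Suc simp: less_Suc_eq_le)
  then show ?thesis unfolding enumerates_def by (simp add: list_all2_map2 list_all2_same)
qed

lemma ed_string_ed_text:
  assumes M: "\<And>a e. M a e < 2" and "0 < N"
  shows "ed_string {..<5} (map set (ed_text (\<lambda>x. x) M b g H N))"
proof -
  have "X \<noteq> [] \<and> (\<forall>w \<in> set X. set w \<subseteq> {..<5})" if "X \<in> set (ed_text (\<lambda>x. x) M b g H N)" for X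
  proof
    show "X \<noteq> []" using that assms(2) unfolding ed_text_def by (auto simp: padding_def simp del: upt_Suc)
    show "\<forall>w \<in> set X. set w \<subseteq> {..<5}"
      using that set_middle[where M = M, OF _ _ M, of X b g H N] unfolding ed_text_middle by fastforce
  qed
  then show ?thesis unfolding ed_string_def by (fastforce simp: lists_eq_set)
qed

lemma ed_size_enumerates:
  "enumerates E T \<Longrightarrow> ed_size T = length (concat (concat E))"
  unfolding enumerates_def ed_size_def
  by (induction rule: list_all2_induct)
    (auto simp: length_concat sum_list_distinct_conv_sum_set)

lemma length_padding: "h \<le> H \<Longrightarrow> length (concat (padding f b g H h)) = 2 ^ H * (11 * b + 3)"
  by (simp add: padding_def length_concat comp_def length_blocks sum_list_triv flip: power_add mult.assoc)

lemma length_ed_text: "length (ed_text f M b g H N) = 2 * H + 7"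
  by (simp add: ed_text_def)

text \<open>The first bound is the requirement of EDSM that the text be at least as large as the
  pattern: one padding level already contains all blocks. In the second, \<open>13 * b + 3\<close>
  is the sum of \<open>4 * b + 1\<close>, \<open>5 * b + 1\<close> and \<open>4 * b + 1\<close>, the
  middle word having fillers at both ends.\<close>

lemma length_concat_ed_text:
  assumes "0 < b"
  shows "length (concat (concat (ed_text f M b g H N))) \<ge> length (pattern f b g (2 ^ H))"
  "length (concat (concat (ed_text f M b g H N))) \<le>
     2 + 2 * (H + 1) * (2 ^ H * (11 * b + 3)) + N * N * (13 * b + 3)"
proof -
  let ?E = "\<lambda>e. map (e f M b N) [0..<N * N]"
  have "length (concat (concat (map (padding f b g H) hs))) = length hs * (2 ^ H * (11 * b + 3))"
    if "\<forall>h \<in> set hs. h \<le> H" for hs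
    using that by (induction hs) (auto simp: length_padding)
  from this[of "rev [0..<Suc H]"] this[of "[0..<Suc H]"]
  have pad: "length (concat (concat (map (padding f b g H) (rev [0..<Suc H])))) = (H + 1) * (2 ^ H * (11 * b + 3))"
    "length (concat (concat (map (padding f b g H) [0..<Suc H]))) = (H + 1) * (2 ^ H * (11 * b + 3))"
    by (simp_all del: upt_Suc)
  have len: "length (concat (concat (ed_text f M b g H N))) = 2 + 2 * ((H + 1) * (2 ^ H * (11 * b + 3))) +
      (length (concat (?E entry1)) + length (concat (?E entry2)) + length (concat (?E entry3)))"
    unfolding ed_text_middle middle_def using pad by (simp del: upt_Suc)
  have le: "length (concat (map w [0..<n])) \<le> n * k" if "\<And>e. length (w e) \<le> k" for w :: "nat \<Rightarrow> 'b list" and n k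
  proof (induction n)
    case (Suc n)
    then show ?case using that[of n] by simp
  qed simp
  have mod: "v mod b \<le> b" for v using assms by (auto intro: less_imp_le)
  have "length (concat (?E entry1)) \<le> N * N * (4 * b + 1)" "length (concat (?E entry2)) \<le> N * N * (5 * b + 1)"
    "length (concat (?E entry3)) \<le> N * N * (4 * b + 1)"
    by (intro le, simp add: entry1_def entry2_def entry3_def length_segment mod add_mono)+
  then show "length (concat (concat (ed_text f M b g H N))) \<le>
      2 + 2 * (H + 1) * (2 ^ H * (11 * b + 3)) + N * N * (13 * b + 3)"
    unfolding len by (simp add: algebra_simps)
  show "length (concat (concat (ed_text f M b g H N))) \<ge> length (pattern f b g (2 ^ H))"
    unfolding len length_pattern by simp
qed

section \<open>The program\<close>

lemma triple_Seq_agree: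
  assumes "triple R c G T (agree V R)" "\<And>R'. agree V R R' \<Longrightarrow> triple R' d H U (agree V' R')" "V \<subseteq> V'"
  shows "triple R (c ;; d) (join G H) (T + U) (agree V' R)"
proof (rule triple_Seq[OF assms(1)])
  fix R' assume *: "agree V R R'"
  show "triple R' d H U (agree V' R)"
    by (rule triple_weaken[OF assms(2)[OF *]]) (use * assms(3) in \<open>auto simp: agree_def\<close>)
qed

lemma triple_agree_mono: "triple R c G T (agree V R) \<Longrightarrow> V \<subseteq> V' \<Longrightarrow> T \<le> T' \<Longrightarrow> triple R c G T' (agree V' R)"
  by (erule triple_weaken) (auto simp: agree_def)

lemma triple_eq:
  "triple R c G T Q \<Longrightarrow> G = G' \<Longrightarrow> T \<le> T' \<Longrightarrow> (\<And>R'. Q R' \<Longrightarrow> Q' R') \<Longrightarrow> triple R c G' T' Q'"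
  using triple_weaken by blast

lemma triple_assign:
  assumes "triple R c (\<lambda>_. []) T (\<lambda>R'. R' = R(x := v))" "triple (R(x := v)) d G U (agree V (R(x := v)))" "x \<in> V"
  shows "triple R (c ;; d) G (T + U) (agree V R)"
  by (rule triple_step[OF assms(1) triple_weaken[OF assms(2)]]) (use assms(3) in \<open>auto simp: agree_def\<close>)

lemma triple_Push_agree: "a < 4 \<Longrightarrow> x < 40 \<Longrightarrow> triple R (Push a x) (only a [Lit (R x)]) 3 (agree V R)"
  by (erule triple_weaken[OF triple_Push]) auto

lemma triple_Copy_agree:
  "a < 4 \<Longrightarrow> b < 43 \<Longrightarrow> x < 40 \<Longrightarrow> triple R (Copy a b x) (only a [Entry b (R x)]) 4 (agree V R)"
  by (erule triple_weaken[OF triple_Copy]) auto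

lemma triple_Op_agree:
  assumes "x < 40" "y < 40" "z < 40" "x \<in> V"
    and "triple (R(x := binop_val f (R y) (R z))) d G U (agree V (R(x := binop_val f (R y) (R z))))"
  shows "triple R (Op f x y z ;; d) G (Suc U) (agree V R)"
  using triple_assign[OF triple_Op[OF assms(1-3)] assms(5,4)] by simp

lemma triple_Const_agree:
  assumes "x < 40" "x \<in> V" "triple (R(x := v)) d G U (agree V (R(x := v)))"
  shows "triple R (Const x v ;; d) G (Suc U) (agree V R)"
  using triple_assign[OF triple_Const[OF assms(1)] assms(3,2)] by simp

lemma concat_only:
  "(\<lambda>b. concat (map (\<lambda>i. only a (w i) b) xs)) = only a (concat (map w xs))"
  by (auto simp: only_def)

text \<open>Streams 2 and 3 are the arrays of lengths and letters in \<open>edsm_input\<close>;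
  \<open>sets_out\<close> adds the cardinalities in stream 1. Writing one word after another appends
  to each separately, so concatenation of lists becomes \<open>join\<close>.\<close>

definition words_out :: "symbol list list \<Rightarrow> streams" where
  "words_out ws =
     (\<lambda>a. if a = 2 then map (\<lambda>w. Lit (length w)) ws else if a = 3 then concat ws else [])"

definition sets_out :: "symbol list list list \<Rightarrow> streams" where
  "sets_out E =
     (\<lambda>a. if a = 1 then map (\<lambda>ws. Lit (length ws)) E else words_out (concat E) a)"

lemma join_words_out: "join (words_out u) (words_out v) = words_out (u @ v)"
  by (auto simp: join_def words_out_def)

lemma join_sets_out: "join (sets_out u) (sets_out v) = sets_out (u @ v)"
  by (auto simp: join_def sets_out_def words_out_def)

lemma concat_words_out:
  "(\<lambda>a. concat (map (\<lambda>i. words_out (W i) a) xs)) = words_out (concat (map W xs))"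
  by (rule ext) (induction xs; auto simp: words_out_def)

lemma concat_sets_out:
  "(\<lambda>a. concat (map (\<lambda>i. sets_out (W i) a) xs)) = sets_out (concat (map W xs))"
  by (rule ext) (induction xs; auto simp: sets_out_def words_out_def)

text \<open>Scratch registers: 10, 11 temporary; 12 to 15 digits; 16, 17 lengths of fillers; 18, 20
  stream lengths when a word or a set begins; 19 current block or matrix entry; 28 level of the
  padding; 29 level loop; 30 to 35 preparation.\<close>

definition write_filler :: "nat \<Rightarrow> nat \<Rightarrow> com" where
  "write_filler a u = For 10 u (Push a 2)"

definition write_one_hot :: "nat \<Rightarrow> nat \<Rightarrow> com" where
  "write_one_hot a d = For 10 5 (Op Equal 11 10 d ;; Push a 11)"

text \<open>The command \<open>c\<close> writes the letter after the code: a constant 1 for a block,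
  a copied matrix entry in the middle sets. Matrix entries enter the output nowhere else.\<close>

definition write_segment :: "nat \<Rightarrow> nat \<Rightarrow> nat \<Rightarrow> nat \<Rightarrow> nat \<Rightarrow> com \<Rightarrow> nat \<Rightarrow> com" where
  "write_segment a u d1 d2 d3 c w =
     write_filler a u ;; write_one_hot a d1 ;; write_one_hot a d2 ;; write_one_hot a d3 ;; c ;;
     write_filler a w"

definition write_block :: "nat \<Rightarrow> com" where
  "write_block a =
     Op Mod 15 19 4 ;; Op Div 14 19 4 ;; Op Div 12 14 4 ;; Op Mod 14 14 4 ;; Op Mod 13 12 5 ;;
     Op Div 12 12 5 ;;
     write_segment a 1 12 13 14 (Push a 3) 5 ;;
     write_segment a 1 14 15 1 (Push a 3) 5 ;;
     write_segment a 1 12 13 15 (Push a 3) 1"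

text \<open>Cardinalities and lengths need not be known in advance: they go to another stream than
  the content and can be written afterwards, as the growth of stream \<open>a\<close>.\<close>

definition counted :: "nat \<Rightarrow> nat \<Rightarrow> nat \<Rightarrow> com \<Rightarrow> com" where
  "counted x a a' c = Len x a ;; c ;; Len 11 a ;; Op Sub 11 11 x ;; Push a' 11"

definition write_word :: "com \<Rightarrow> com" where
  "write_word c = counted 18 3 2 c"

definition write_set :: "com \<Rightarrow> com" where
  "write_set c = counted 20 2 1 c"

definition write_marker :: "nat \<Rightarrow> com" where
  "write_marker v = write_set (write_word (Const 11 v ;; Push 3 11))"

text \<open>Doubling by increments takes time proportional to the value, but keeps the program
  within \<open>incremental\<close>; the powers computed this way are within the time
  budget.\<close>

definition double :: "nat \<Rightarrow> com" where
  "double x = Op Sub 25 x 1 ;; For 26 25 (Inc x)"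

definition power_two :: "nat \<Rightarrow> nat \<Rightarrow> com" where
  "power_two x y = Const x 1 ;; For 27 y (double x)"

text \<open>Registers 21 and 22 hold the length \<open>2 ^ h\<close> of a run and the number
  \<open>2 ^ (H - h)\<close> of runs. Register 19 counts blocks through the whole level and is not
  reset between runs.\<close>

definition write_padding :: com where
  "write_padding =
     power_two 21 28 ;; Op Div 22 8 21 ;;
     write_set (write_word (Const 11 0) ;; Const 19 0 ;;
       For 23 22 (write_word (For 24 21 (write_block 3 ;; Inc 19))))"

definition write_entry1 :: com where
  "write_entry1 =
     Op Div 12 19 0 ;; Op Mod 16 19 0 ;; Op Div 14 16 5 ;; Op Mod 16 16 5 ;; Op Mod 13 12 5 ;;
     Op Div 12 12 5 ;; write_word (write_segment 3 1 12 13 14 (Copy 3 0 19) 16)"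

definition write_entry2 :: com where
  "write_entry2 =
     Op Div 14 19 0 ;; Op Mod 16 14 5 ;; Op Div 14 14 5 ;; Op Mod 15 19 0 ;; Op Mod 17 15 5 ;;
     Op Div 15 15 5 ;; Op Sub 16 5 16 ;; Op Sub 17 5 17 ;;
     write_word (write_segment 3 16 14 15 1 (Copy 3 1 19) 17)"

definition write_entry3 :: com where
  "write_entry3 =
     Op Div 15 19 0 ;; Op Mod 16 15 5 ;; Op Div 15 15 5 ;; Op Mod 12 19 0 ;; Op Mod 13 12 5 ;;
     Op Div 12 12 5 ;; write_word (write_segment 3 16 12 13 15 (Copy 3 2 19) 1)"

definition write_text :: com where
  "write_text =
     write_marker 3 ;; For 29 7 (Op Sub 28 6 29 ;; write_padding) ;;
     write_set (For 19 9 write_entry1) ;; write_set (For 19 9 write_entry2) ;;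
     write_set (For 19 9 write_entry3) ;;
     For 29 7 (Op Sub 28 29 1 ;; write_padding) ;; write_marker 4"

definition write_pattern :: com where
  "write_pattern = Const 11 3 ;; Push 0 11 ;; For 19 8 (write_block 0) ;; Const 11 4 ;; Push 0 11"

text \<open>The logarithm is found in exactly \<open>N\<close> rounds without early exit. The inner
  loop on register 11, whose bound is 0 or 1, serves as a conditional that doubles only while the
  power is below \<open>N\<close>.\<close>

definition prepare :: "nat \<Rightarrow> com" where
  "prepare q =
     Const 1 0 ;; Const 2 2 ;; Const 3 1 ;; Const 9 0 ;; For 34 0 (For 35 0 (Inc 9)) ;;
     Const 30 1 ;; Const 31 0 ;; For 34 0 (Op Less 11 30 0 ;; For 35 11 (double 30 ;; Inc 31)) ;;
     Const 33 q ;; Op Div 32 31 33 ;; power_two 4 32 ;; Op Div 5 30 4 ;;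
     Op Sub 6 31 1 ;; For 34 32 (Inc 6 ;; Inc 6) ;; power_two 8 6 ;; Op Sub 7 6 1 ;; Inc 7"

text \<open>Registers below 10 do not change after the preparation.\<close>

definition ready :: "nat \<Rightarrow> nat \<Rightarrow> nat \<Rightarrow> nat \<Rightarrow> (nat \<Rightarrow> nat) \<Rightarrow> bool" where
  "ready N b g H R \<longleftrightarrow>
     R 0 = N \<and> R 1 = 0 \<and> R 2 = 2 \<and> R 3 = 1 \<and> R 4 = g \<and> R 5 = b \<and> R 6 = H \<and> R 7 = Suc H \<and>
     R 8 = 2 ^ H \<and> R 9 = N * N"

lemma ready_agree: "ready N b g H R \<Longrightarrow> agree V R R' \<Longrightarrow> V \<subseteq> {10..} \<Longrightarrow> ready N b g H R'"
proof -
  assume *: "ready N b g H R" "agree V R R'" "V \<subseteq> {10..}"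
  then have "R' x = R x" if "x < 10" for x
    using that by (intro agreeD) auto
  then show ?thesis using *(1) by (simp add: ready_def)
qed

section \<open>Output and running time of the pieces of the program\<close>

lemma triple_filler:
  assumes "a < 4" "u < 40" "u \<noteq> 10" "R 2 = 2"
  shows "triple R (write_filler a u) (only a (replicate (R u) (Lit 2))) (7 * R u + 3) (agree {10} R)"
proof -
  have "triple R (write_filler a u) (\<lambda>b. concat (map (\<lambda>i. only a [Lit 2] b) [0..<R u])) (R u * (3 + 4) + 3) (agree {10} R)"
    unfolding write_filler_def
  proof (rule triple_For_agree[where V' = "{}"])
    fix i R' assume "agree {10} R R'"
    then have "R' 2 = 2" using assms by (simp add: agree_def)
    then show "triple R' (Push a 2) (only a [Lit 2]) 3 (agree {} R')"
      using triple_weaken[OF triple_Push[of a 2 R'], of 3 "agree {} R'"] assms by simp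
  qed (use assms in auto)
  then show ?thesis
    by (rule triple_eq) (simp_all only: concat_only, simp_all add: map_replicate_const)
qed

lemma triple_one_hot:
  assumes "a < 4" "d < 40" "d \<notin> {10, 11}"
  shows "triple R (write_one_hot a d) (only a (one_hot Lit (R 5) (R d))) (8 * R 5 + 3) (agree {10, 11} R)"
proof -
  have "triple R (write_one_hot a d) (\<lambda>b. concat (map (\<lambda>i. only a [Lit (of_bool (i = R d))] b) [0..<R 5]))
      (R 5 * (4 + 4) + 3) (agree {10, 11} R)"
    unfolding write_one_hot_def
  proof (rule triple_For_agree[where V' = "{11}"])
    fix i R' assume *: "agree {10, 11} R R'" "R' 10 = i"
    then have "R' d = R d" using assms by (simp add: agree_def)
    then have v: "binop_val Equal (R' 10) (R' d) = of_bool (i = R d)" using *(2) by simp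
    define v where "v = (of_bool (i = R d) :: nat)"
    have "triple (R'(11 := v)) (Push a 11) (only a [Lit v]) 3 (agree {11} (R'(11 := v)))"
      using triple_Push_agree[of a 11 "R'(11 := v)"] assms by simp
    then have "triple R' (Op Equal 11 10 d ;; Push a 11) (only a [Lit v]) (Suc 3) (agree {11} R')"
      using assms by (intro triple_Op_agree) (simp_all only: v v_def, simp_all)
    then show "triple R' (Op Equal 11 10 d ;; Push a 11) (only a [Lit (of_bool (i = R d))]) 4 (agree {11} R')"
      by (simp add: v_def)
  qed (use assms in auto)
  then show ?thesis
    by (rule triple_eq) (simp_all only: concat_only, simp_all add: one_hot_def)
qed

lemma triple_segment:
  assumes a: "a < 4" and regs: "{u, d1, d2, d3, w} \<subseteq> {..<40} - {10, 11}" and two: "R 2 = 2"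
    and c: "\<And>R'. agree {10, 11} R R' \<Longrightarrow> triple R' c (only a [e]) 4 (agree {} R')"
  shows "triple R (write_segment a u d1 d2 d3 c w)
    (only a (segment Lit (R 5) (R u) (R d1) (R d2) (R d3) e (R w)))
    (7 * R u + 7 * R w + 24 * R 5 + 20) (agree {10, 11} R)"
proof -
  let ?V = "{10, 11}"
  have fill: "triple R' (write_filler a v) (only a (replicate (R v) (Lit 2))) (7 * R v + 3) (agree ?V R')"
    if "agree ?V R R'" "v < 40" "v \<notin> ?V" for R' v
  proof -
    have "R' v = R v" "R' 2 = 2" using that two by (auto simp: agree_def)
    then show ?thesis using triple_agree_mono[OF triple_filler[of a v R']] that a by simp
  qed
  have digit: "triple R' (write_one_hot a d) (only a (one_hot Lit (R 5) (R d))) (8 * R 5 + 3) (agree ?V R')"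
    if "agree ?V R R'" "d < 40" "d \<notin> ?V" for R' d
  proof -
    have "R' d = R d" "R' 5 = R 5" using that by (auto simp: agree_def)
    then show ?thesis using triple_one_hot[of a d R'] that a by simp
  qed
  have c': "triple R' c (only a [e]) 4 (agree ?V R')" if "agree ?V R R'" for R'
    by (rule triple_agree_mono[OF c[OF that]]) auto
  have "triple R (write_segment a u d1 d2 d3 c w)
    (join (only a (replicate (R u) (Lit 2))) (join (only a (one_hot Lit (R 5) (R d1)))
      (join (only a (one_hot Lit (R 5) (R d2))) (join (only a (one_hot Lit (R 5) (R d3)))
      (join (only a [e]) (only a (replicate (R w) (Lit 2))))))))
    ((7 * R u + 3) + ((8 * R 5 + 3) + ((8 * R 5 + 3) + ((8 * R 5 + 3) + (4 + (7 * R w + 3)))))) (agree ?V R)"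
    unfolding write_segment_def
    by (intro triple_Seq_agree[OF _ _ order_refl] fill digit c')
      (use regs in \<open>auto simp: agree_def\<close>)
  then show ?thesis
    by (rule triple_eq) (simp_all add: join_only segment_def core_def)
qed


lemma triple_block:
  assumes "ready N b g H R" "a < 4"
  shows "triple R (write_block a) (only a (block Lit b g (R 19))) (86 * b + 66) (agree {10..<18} R)"
proof -
  define \<phi> where "\<phi> = R 19"
  let ?s1 = "segment Lit b 0 (\<phi> div g div g div b) (\<phi> div g div g mod b) (\<phi> div g mod g) (Lit 1) b"
  let ?s2 = "segment Lit b 0 (\<phi> div g mod g) (\<phi> mod g) 0 (Lit 1) b"
  let ?s3 = "segment Lit b 0 (\<phi> div g div g div b) (\<phi> div g div g mod b) (\<phi> mod g) (Lit 1) 0"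
  \<comment> \<open>Digits and constants sit outside registers 10 and 11, so they survive the
    writing of all three segments.\<close>
  define regs :: "(nat \<Rightarrow> nat) \<Rightarrow> bool" where "regs Q \<longleftrightarrow> Q 12 = \<phi> div g div g div b \<and> Q 13 = \<phi> div g div g mod b \<and>
    Q 14 = \<phi> div g mod g \<and> Q 15 = \<phi> mod g \<and> Q 1 = 0 \<and> Q 2 = 2 \<and> Q 3 = 1 \<and> Q 5 = b" for Q
  have regs_agree: "regs R''" if "regs R'" "agree {10, 11} R' R''" for R' R''
    using that by (auto simp: regs_def agree_def)
  have push: "triple R'' (Push a 3) (only a [Lit 1]) 4 (agree {} R'')" if "regs R'" "agree {10, 11} R' R''" for R' R''
  proof -
    have "R'' 3 = 1" using regs_agree[OF that] by (simp add: regs_def)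
    then show ?thesis using triple_weaken[OF triple_Push_agree[of a 3 R'' "{}"], of 4] assms by simp
  qed
  have seg: "triple R' (write_segment a 1 12 13 14 (Push a 3) 5) (only a ?s1) (31 * b + 20) (agree {10, 11} R')"
    "triple R' (write_segment a 1 14 15 1 (Push a 3) 5) (only a ?s2) (31 * b + 20) (agree {10, 11} R')"
    "triple R' (write_segment a 1 12 13 15 (Push a 3) 1) (only a ?s3) (24 * b + 20) (agree {10, 11} R')"
    if r: "regs R'" for R'
  proof -
    note * = triple_segment[OF assms(2) _ _ push[OF r]]
    show "triple R' (write_segment a 1 12 13 14 (Push a 3) 5) (only a ?s1) (31 * b + 20) (agree {10, 11} R')"
      by (rule triple_eq[OF *]) (use r in \<open>auto simp: regs_def\<close>)
    show "triple R' (write_segment a 1 14 15 1 (Push a 3) 5) (only a ?s2) (31 * b + 20) (agree {10, 11} R')"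
      by (rule triple_eq[OF *]) (use r in \<open>auto simp: regs_def\<close>)
    show "triple R' (write_segment a 1 12 13 15 (Push a 3) 1) (only a ?s3) (24 * b + 20) (agree {10, 11} R')"
      by (rule triple_eq[OF *]) (use r in \<open>auto simp: regs_def\<close>)
  qed
  have rest: "triple R' (write_segment a 1 12 13 14 (Push a 3) 5 ;; write_segment a 1 14 15 1 (Push a 3) 5 ;;
      write_segment a 1 12 13 15 (Push a 3) 1) (join (only a ?s1) (join (only a ?s2) (only a ?s3)))
      (31 * b + 20 + (31 * b + 20 + (24 * b + 20))) (agree {10..<18} R')"
    if r: "regs R'" for R'
  proof (rule triple_agree_mono)
    show "triple R' (write_segment a 1 12 13 14 (Push a 3) 5 ;; write_segment a 1 14 15 1 (Push a 3) 5 ;;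
      write_segment a 1 12 13 15 (Push a 3) 1) (join (only a ?s1) (join (only a ?s2) (only a ?s3)))
      (31 * b + 20 + (31 * b + 20 + (24 * b + 20))) (agree {10, 11} R')"
      by (rule triple_Seq_agree[OF seg(1)[OF r] triple_Seq_agree[OF seg(2) seg(3)]])
        (use r regs_agree in auto)
  qed auto
  show ?thesis
    unfolding write_block_def
    apply (rule triple_eq[where Q = "agree {10..<18} R"])
       apply ((rule triple_Op_agree, simp, simp, simp, simp)+, rule rest)
    using assms(1) by (simp_all add: regs_def ready_def join_only block_def Let_def \<phi>_def)
qed

lemma triple_counted:
  assumes "a < 4" "a' < 4" "x < 40" "x \<noteq> 11" "x \<notin> V"
    and c: "\<And>n. triple (R(x := n)) c G T (\<lambda>R'. agree V (R(x := n)) R' \<and> Q R')"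
    and Q: "\<And>R' v. Q R' \<Longrightarrow> Q (R'(11 := v))"
  shows "triple R (counted x a a' c) (join G (only a' [Lit (length (G a))])) (T + 8)
    (\<lambda>R'. agree (V \<union> {11, x}) R R' \<and> Q R')"
  unfolding triple_def
proof (intro allI impI)
  fix s0 F s assume "represents s0 R F s"
  then obtain s1 where 1: "runs (Len x a) s 2 s1" "represents s0 (R(x := length (F a))) F s1"
    using runs_Len assms by blast
  then obtain t s2 R2 where 2: "runs c s1 t s2" "t \<le> T" "represents s0 R2 (join F G) s2"
    "agree V (R(x := length (F a))) R2" "Q R2"
    using c unfolding triple_def by blast
  define l where "l = length (join F G a)"
  from runs_Len[OF 2(3) assms(1), of 11] obtain s3
    where 3: "runs (Len 11 a) s2 2 s3" "represents s0 (R2(11 := l)) (join F G) s3"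
    unfolding l_def by auto
  have "R2 x = length (F a)" using 2(4) assms(5) by (simp add: agree_def)
  then have "l - R2 x = length (G a)" by (simp add: l_def join_def)
  define R4 where "R4 = R2(11 := length (G a))"
  have "triple (R2(11 := l)) (Op Sub 11 11 x ;; Push a' 11) (only a' [Lit (R4 11)]) (1 + 3) (\<lambda>R'. R' = R4)"
  proof (rule triple_step)
    show "triple (R2(11 := l)) (Op Sub 11 11 x) (\<lambda>_. []) 1 (\<lambda>R'. R' = R4)"
      by (rule triple_weaken[OF triple_Op])
        (use assms(3,4) \<open>l - R2 x = length (G a)\<close> in \<open>auto simp: R4_def\<close>)
  qed (use assms(2) triple_Push in simp)
  then obtain t' s4 where 4: "runs (Op Sub 11 11 x ;; Push a' 11) s3 t' s4" "t' \<le> 4"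
    "represents s0 R4 (join (join F G) (only a' [Lit (R4 11)])) s4"
    using 3(2) unfolding triple_def by fastforce
  have "runs (counted x a a' c) s (2 + (t + (2 + t'))) s4"
    unfolding counted_def by (intro runs_Seq[OF 1(1)] runs_Seq[OF 2(1)] runs_Seq[OF 3(1)] 4(1))
  moreover have "agree (V \<union> {11, x}) R R4" using 2(4) by (simp add: agree_def R4_def)
  moreover have "Q R4" using Q[OF 2(5)] by (simp add: R4_def)
  moreover have "R4 11 = length (G a)" by (simp add: R4_def)
  ultimately show "\<exists>t s' R'. runs (counted x a a' c) s t s' \<and> t \<le> T + 8 \<and>
      represents s0 R' (join F (join G (only a' [Lit (length (G a))]))) s' \<and>
      agree (V \<union> {11, x}) R R' \<and> Q R'"
    using 2(2) 4(2,3) by (intro exI[of _ "2 + (t + (2 + t'))"] exI[of _ s4] exI[of _ R4]) (simp add: join_assoc)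
qed

text \<open>\<open>agree\<close> only tells which registers may change; \<open>Q\<close> carries an
  exact value across the word, such as that of the block counter 19. It has to be stable under
  writes to register 11, where \<open>counted\<close> computes the length.\<close>

lemma triple_word_Q:
  assumes "18 \<notin> V" "\<And>n. triple (R(18 := n)) c (only 3 w) T (\<lambda>R'. agree V (R(18 := n)) R' \<and> Q R')"
    "\<And>R' v. Q R' \<Longrightarrow> Q (R'(11 := v))"
  shows "triple R (write_word c) (words_out [w]) (T + 8) (\<lambda>R'. agree (V \<union> {11, 18}) R R' \<and> Q R')"
proof -
  have "join (only 3 w) (only 2 [Lit (length (only 3 w 3))]) = words_out [w]"
    by (auto simp: join_def only_def words_out_def)
  then show ?thesis
    unfolding write_word_def using triple_counted[of 3 2 18 V R c "only 3 w" T Q] assms by simp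
qed

lemma triple_word:
  assumes "18 \<notin> V" "\<And>n. triple (R(18 := n)) c (only 3 w) T (agree V (R(18 := n)))"
  shows "triple R (write_word c) (words_out [w]) (T + 8) (agree (V \<union> {11, 18}) R)"
  using triple_word_Q[where Q = "\<lambda>_. True"] assms by simp

lemma triple_set:
  assumes "20 \<notin> V" "\<And>n. triple (R(20 := n)) c (words_out ws) T (agree V (R(20 := n)))"
  shows "triple R (write_set c) (sets_out [ws]) (T + 8) (agree (V \<union> {11, 20}) R)"
proof -
  have "join (words_out ws) (only 1 [Lit (length (words_out ws 2))]) = sets_out [ws]"
    by (auto simp: join_def only_def words_out_def sets_out_def)
  then show ?thesis
    unfolding write_set_def
    using triple_counted[of 2 1 20 V R c "words_out ws" T "\<lambda>_. True"] assms by simp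
qed

lemma triple_add:
  assumes "x < 40" "y < 40" "z < 40" "x \<noteq> y" "x \<noteq> z" "y \<noteq> z"
  shows "triple R (For x y (Inc z)) (\<lambda>_. []) (6 * R y + 3) (agree {x} (R(z := R z + R y)))"
proof -
  have "triple R (For x y (Inc z)) (\<lambda>a. concat (map (\<lambda>i. (\<lambda>_. []) a) [0..<R y])) (R y * (2 + 4) + 3)
    ((\<lambda>i. agree {x} (R(z := R z + i))) (R y))"
  proof (rule triple_For)
    fix i R' assume *: "agree {x} (R(z := R z + i)) R'" "R' x = i" "R' y = R y"
    show "triple R' (Inc z) (\<lambda>_. []) 2
        (\<lambda>R''. R'' x = i \<and> R'' y = R y \<and> agree {x} (R(z := R z + Suc i)) (R''(x := Suc i)))"
      by (rule triple_weaken[OF triple_Inc]) (use * assms in \<open>auto simp: agree_def\<close>)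
  qed (use assms in \<open>auto simp: agree_def\<close>)
  then show ?thesis by (rule triple_eq) auto
qed

lemma triple_double:
  assumes "R 1 = 0" "x < 40" "x \<notin> {1, 25, 26}"
  shows "triple R (double x) (\<lambda>_. []) (6 * R x + 4) (agree {25, 26} (R(x := 2 * R x)))"
proof -
  have "triple R (double x) (\<lambda>_. []) (1 + (6 * R x + 3)) (agree {25, 26} (R(x := 2 * R x)))"
    unfolding double_def
  proof (rule triple_step)
    show "triple R (Op Sub 25 x 1) (\<lambda>_. []) 1 (\<lambda>R'. R' = R(25 := R x))"
      using triple_Op[of 25 x 1 R Sub] assms by simp
    show "triple (R(25 := R x)) (For 26 25 (Inc x)) (\<lambda>_. []) (6 * R x + 3) (agree {25, 26} (R(x := 2 * R x)))"
      by (rule triple_eq[OF triple_add]) (use assms in \<open>auto simp: agree_def\<close>)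
  qed
  then show ?thesis by (rule triple_eq) auto
qed

lemma triple_power_two:
  assumes "R 1 = 0" "x < 40" "y < 40" "x \<notin> {1, 25, 26, 27}" "y \<notin> {x, 25, 26, 27}"
  shows "triple R (power_two x y) (\<lambda>_. []) (R y * (6 * 2 ^ R y + 8) + 4) (agree {25, 26, 27} (R(x := 2 ^ R y)))"
proof -
  have "triple (R(x := 1)) (For 27 y (double x)) (\<lambda>a. concat (map (\<lambda>i. (\<lambda>_. []) a) [0..<R y]))
      (R y * ((6 * 2 ^ R y + 4) + 4) + 3) ((\<lambda>i. agree {25, 26, 27} (R(x := 2 ^ i))) (R y))"
  proof (rule triple_For)
    fix i R' assume *: "i < R y" "agree {25, 26, 27} (R(x := 2 ^ i)) R'" "R' 27 = i" "R' y = R y"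
    have x: "R' x = 2 ^ i" "R' 1 = 0" using *(2) assms by (auto simp: agree_def)
    have "(2::nat) ^ i \<le> 2 ^ R y" using *(1) by simp
    then show "triple R' (double x) (\<lambda>_. []) (6 * 2 ^ R y + 4)
        (\<lambda>R''. R'' 27 = i \<and> R'' y = R y \<and> agree {25, 26, 27} (R(x := 2 ^ Suc i)) (R''(27 := Suc i)))"
      by (intro triple_weaken[OF triple_double]) (use * x assms in \<open>auto simp: agree_def\<close>)
  qed (use assms in \<open>auto simp: agree_def\<close>)
  then have "triple (R(x := 1)) (For 27 y (double x)) (\<lambda>_. []) (R y * (6 * 2 ^ R y + 8) + 3)
      (agree {25, 26, 27} (R(x := 2 ^ R y)))" by (rule triple_eq) auto
  from triple_step[OF triple_Const[OF assms(2)] this]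
  show ?thesis unfolding power_two_def by (rule triple_eq) auto
qed

lemma concat_map_blocks:
  "concat (map (\<lambda>i. block f b g (m + i)) [0..<n]) = blocks f b g m (m + n)"
  unfolding blocks_def by (induction n) auto

lemma triple_blocks:
  assumes r: "ready N b g H R"
  shows "triple R (For 24 21 (write_block 3 ;; Inc 19)) (only 3 (blocks Lit b g (R 19) (R 19 + R 21)))
    (R 21 * (86 * b + 72) + 3) (\<lambda>R'. agree ({10..<18} \<union> {19, 24}) R R' \<and> R' 19 = R 19 + R 21)"
proof -
  let ?V = "{10..<18} \<union> {19, 24}"
  have "triple R (For 24 21 (write_block 3 ;; Inc 19))
      (\<lambda>a. concat (map (\<lambda>i. only 3 (block Lit b g (R 19 + i)) a) [0..<R 21]))
      (R 21 * ((86 * b + 68) + 4) + 3) ((\<lambda>i R'. agree ?V R R' \<and> R' 19 = R 19 + i) (R 21))"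
  proof (rule triple_For)
    fix i R' assume *: "agree ?V R R' \<and> R' 19 = R 19 + i" "R' 24 = i" "R' 21 = R 21"
    have r': "ready N b g H R'" by (rule ready_agree[OF r]) (use * in auto)
    have "triple R' (write_block 3 ;; Inc 19) (join (only 3 (block Lit b g (R' 19))) (\<lambda>_. [])) ((86 * b + 66) + 2)
      (\<lambda>R''. R'' 24 = i \<and> R'' 21 = R 21 \<and> agree ?V R (R''(24 := Suc i)) \<and> (R''(24 := Suc i)) 19 = R 19 + Suc i)"
    proof (rule triple_Seq[OF triple_block[OF r']])
      fix R1 assume "agree {10..<18} R' R1"
      then show "triple R1 (Inc 19) (\<lambda>_. []) 2
          (\<lambda>R''. R'' 24 = i \<and> R'' 21 = R 21 \<and> agree ?V R (R''(24 := Suc i)) \<and> (R''(24 := Suc i)) 19 = R 19 + Suc i)"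
        by (intro triple_weaken[OF triple_Inc]) (use * in \<open>auto simp: agree_def\<close>)
    qed simp
    then show "triple R' (write_block 3 ;; Inc 19) (only 3 (block Lit b g (R 19 + i))) (86 * b + 68)
      (\<lambda>R''. R'' 24 = i \<and> R'' 21 = R 21 \<and> agree ?V R (R''(24 := Suc i)) \<and> (R''(24 := Suc i)) 19 = R 19 + Suc i)"
      by (rule triple_eq) (use * in auto)
  qed (auto simp: agree_def)
  then show ?thesis
    by (rule triple_eq) (simp_all add: concat_only concat_map_blocks)
qed

lemma triple_padding:
  assumes r: "ready N b g H R" and h: "R 28 = h" "h \<le> H"
  shows "triple R write_padding (sets_out [padding Lit b g H h])
    (H * (6 * 2 ^ H + 8) + 2 ^ H * (86 * b + 87) + 40) (agree {10..<28} R)"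
proof -
  let ?W = "{10..<20} \<union> {23, 24}"
  let ?T = "2 ^ h * (86 * b + 72) + 3"
  have loop: "triple R' (For 23 22 (write_word (For 24 21 (write_block 3 ;; Inc 19))))
      (words_out (map (\<lambda>a. blocks Lit b g (a * 2 ^ h) (Suc a * 2 ^ h)) [0..<2 ^ (H - h)]))
      (2 ^ (H - h) * ((?T + 8) + 4) + 3) (agree ?W R')"
    if r': "ready N b g H R'" "R' 21 = 2 ^ h" "R' 22 = 2 ^ (H - h)" "R' 19 = 0" for R'
  proof -
    have "triple R' (For 23 22 (write_word (For 24 21 (write_block 3 ;; Inc 19))))
      (\<lambda>a. concat (map (\<lambda>i. words_out [blocks Lit b g (i * 2 ^ h) (Suc i * 2 ^ h)] a) [0..<2 ^ (H - h)]))
      (2 ^ (H - h) * ((?T + 8) + 4) + 3) ((\<lambda>i R''. agree ?W R' R'' \<and> R'' 19 = i * 2 ^ h) (2 ^ (H - h)))"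
    proof (rule triple_For)
      fix i R1 assume *: "agree ?W R' R1 \<and> R1 19 = i * 2 ^ h" "R1 23 = i" "R1 22 = 2 ^ (H - h)"
      have r1: "ready N b g H (R1(18 := n))" for n
        by (rule ready_agree[OF r'(1), where V = ?W]) (use * in \<open>auto simp: agree_def\<close>)
      have 21: "R1 21 = 2 ^ h" using * r' by (auto simp: agree_def)
      have "triple R1 (write_word (For 24 21 (write_block 3 ;; Inc 19)))
        (words_out [blocks Lit b g (i * 2 ^ h) (Suc i * 2 ^ h)]) (?T + 8)
        (\<lambda>R'. agree (({10..<18} \<union> {19, 24}) \<union> {11, 18}) R1 R' \<and> R' 19 = Suc i * 2 ^ h)"
      proof (rule triple_word_Q)
        show "triple (R1(18 := n)) (For 24 21 (write_block 3 ;; Inc 19)) (only 3 (blocks Lit b g (i * 2 ^ h) (Suc i * 2 ^ h))) ?T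
            (\<lambda>R'. agree ({10..<18} \<union> {19, 24}) (R1(18 := n)) R' \<and> R' 19 = Suc i * 2 ^ h)" for n
          by (rule triple_eq[OF triple_blocks[OF r1[of n]]]) (use * 21 in \<open>auto simp: add.commute\<close>)
      qed auto
      then show "triple R1 (write_word (For 24 21 (write_block 3 ;; Inc 19)))
        (words_out [blocks Lit b g (i * 2 ^ h) (Suc i * 2 ^ h)]) (?T + 8)
        (\<lambda>R''. R'' 23 = i \<and> R'' 22 = 2 ^ (H - h) \<and> agree ?W R' (R''(23 := Suc i)) \<and> (R''(23 := Suc i)) 19 = Suc i * 2 ^ h)"
        by (rule triple_weaken) (use * in \<open>auto simp: agree_def\<close>)
    qed (use r' in \<open>auto simp: agree_def\<close>)
    then show ?thesis
      by (rule triple_eq) (simp_all add: concat_words_out del: mult_Suc)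
  qed
  have body: "triple R' (write_word (Const 11 0) ;; Const 19 0 ;;
       For 23 22 (write_word (For 24 21 (write_block 3 ;; Inc 19)))) (words_out (padding Lit b g H h))
       (2 ^ (H - h) * ((?T + 8) + 4) + 13) (agree ?W R')"
    if r': "ready N b g H R'" "R' 21 = 2 ^ h" "R' 22 = 2 ^ (H - h)" for R'
  proof -
    have "triple R' (write_word (Const 11 0)) (words_out [[]]) (1 + 8) (agree ({11} \<union> {11, 18}) R')"
      by (rule triple_word, simp, rule triple_eq[OF triple_Const]) (auto simp: only_def agree_def)
    then have 1: "triple R' (write_word (Const 11 0)) (words_out [[]]) 9 (agree ?W R')"
      by (rule triple_agree_mono) auto
    have 2: "triple R'' (Const 19 0 ;; For 23 22 (write_word (For 24 21 (write_block 3 ;; Inc 19))))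
      (words_out (map (\<lambda>a. blocks Lit b g (a * 2 ^ h) (Suc a * 2 ^ h)) [0..<2 ^ (H - h)]))
      (Suc (2 ^ (H - h) * ((?T + 8) + 4) + 3)) (agree ?W R'')" if a: "agree ?W R' R''" for R''
    proof (rule triple_Const_agree)
      show "triple (R''(19 := 0)) (For 23 22 (write_word (For 24 21 (write_block 3 ;; Inc 19))))
        (words_out (map (\<lambda>a. blocks Lit b g (a * 2 ^ h) (Suc a * 2 ^ h)) [0..<2 ^ (H - h)]))
        (2 ^ (H - h) * ((?T + 8) + 4) + 3) (agree ?W (R''(19 := 0)))"
      proof (rule loop)
        show "ready N b g H (R''(19 := 0))"
          by (rule ready_agree[OF r'(1), where V = ?W]) (use a in \<open>auto simp: agree_def\<close>)
      qed (use a r' in \<open>auto simp: agree_def\<close>)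
    qed auto
    show ?thesis
      by (rule triple_eq[OF triple_Seq_agree[OF 1 2]]) (auto simp: join_words_out padding_def)
  qed
  have *: "triple R write_padding (join (\<lambda>_. []) (sets_out [padding Lit b g H h]))
    ((h * (6 * 2 ^ h + 8) + 4) + Suc (2 ^ (H - h) * ((?T + 8) + 4) + 13 + 8)) (agree {10..<28} R)"
    unfolding write_padding_def
  proof (rule triple_Seq)
    show "triple R (power_two 21 28) (\<lambda>_. []) (h * (6 * 2 ^ h + 8) + 4) (agree {25, 26, 27} (R(21 := 2 ^ h)))"
      using triple_power_two[of R 21 28] r h by (simp add: ready_def)
    fix R' assume *: "agree {25, 26, 27} (R(21 := 2 ^ h)) R'"
    have "ready N b g H R'"
      by (rule ready_agree[OF r, where V = "{21, 25, 26, 27}"]) (use * in \<open>auto simp: agree_def\<close>)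
    moreover have "(2::nat) ^ H div 2 ^ h = 2 ^ (H - h)" using h by (simp add: power_diff)
    moreover have 21: "R' 21 = 2 ^ h" using * by (simp add: agree_def)
    ultimately have 22: "binop_val Div (R' 8) (R' 21) = 2 ^ (H - h)" by (simp add: ready_def)
    have "triple R' (Op Div 22 8 21 ;; write_set (write_word (Const 11 0) ;; Const 19 0 ;;
       For 23 22 (write_word (For 24 21 (write_block 3 ;; Inc 19))))) (sets_out [padding Lit b g H h])
       (Suc (2 ^ (H - h) * ((?T + 8) + 4) + 13 + 8)) (agree {10..<28} R')"
    proof (rule triple_Op_agree, simp_all only: 22)
      show "triple (R'(22 := 2 ^ (H - h))) (write_set (write_word (Const 11 0) ;; Const 19 0 ;;
         For 23 22 (write_word (For 24 21 (write_block 3 ;; Inc 19))))) (sets_out [padding Lit b g H h])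
         (2 ^ (H - h) * ((?T + 8) + 4) + 13 + 8) (agree {10..<28} (R'(22 := 2 ^ (H - h))))"
      proof (rule triple_agree_mono, rule triple_set[where V = ?W], simp, rule body)
        show "ready N b g H (R'(22 := 2 ^ (H - h), 20 := n))" for n
          by (rule ready_agree[OF r, where V = "{20, 21, 22, 25, 26, 27}"]) (use * in \<open>auto simp: agree_def\<close>)
      qed (use 21 in auto)
    qed simp_all
    then show "triple R' (Op Div 22 8 21 ;; write_set (write_word (Const 11 0) ;; Const 19 0 ;;
       For 23 22 (write_word (For 24 21 (write_block 3 ;; Inc 19))))) (sets_out [padding Lit b g H h])
       (Suc (2 ^ (H - h) * ((?T + 8) + 4) + 13 + 8)) (agree {10..<28} R)"
      by (rule triple_weaken) (use * in \<open>auto simp: agree_def\<close>)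
  qed
  \<comment> \<open>The bound is uniform in \<open>h\<close>: the runs of a level have
    \<open>2 ^ H\<close> blocks altogether, and the overhead of 15 per run is at most
    \<open>15 * 2 ^ H\<close>, which turns 72 into 87.\<close>
  have "(h * (6 * 2 ^ h + 8) + 4) + Suc (2 ^ (H - h) * ((?T + 8) + 4) + 13 + 8) \<le>
      H * (6 * 2 ^ H + 8) + 2 ^ H * (86 * b + 87) + 40"
  proof -
    have "(2::nat) ^ (H - h) \<le> 2 ^ H" "(2::nat) ^ h \<le> 2 ^ H" by (simp_all add: h)
    moreover from this have "h * (6 * 2 ^ h + 8) \<le> H * (6 * 2 ^ H + 8)" by (intro mult_le_mono h) auto
    moreover have "2 ^ (H - h) * ((?T + 8) + 4) = 2 ^ H * (86 * b + 72) + 15 * 2 ^ (H - h)"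
    proof -
      have "2 ^ (H - h) * ((?T + 8) + 4) = (2 ^ (H - h) * 2 ^ h) * (86 * b + 72) + 15 * 2 ^ (H - h)"
        by (simp add: algebra_simps)
      also have "(2::nat) ^ (H - h) * 2 ^ h = 2 ^ H" using h by (simp flip: power_add)
      finally show ?thesis .
    qed
    ultimately show ?thesis by (simp only: distrib_left distrib_right)
  qed
  then show ?thesis by (intro triple_eq[OF *]) auto
qed

lemma triple_entry_word:
  assumes "ready N b g H R" and regs: "{u, d1, d2, d3, w} \<subseteq> {..<40} - {10, 11, 18}"
    and c: "\<And>R'. R' 19 = R 19 \<Longrightarrow> triple R' c (only 3 [e]) 4 (agree {} R')" and "R u \<le> b" "R w \<le> b"
  shows "triple R (write_word (write_segment 3 u d1 d2 d3 c w))
    (words_out [segment Lit b (R u) (R d1) (R d2) (R d3) e (R w)]) (38 * b + 28) (agree {10..<19} R)"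
proof -
  have "triple R (write_word (write_segment 3 u d1 d2 d3 c w))
    (words_out [segment Lit b (R u) (R d1) (R d2) (R d3) e (R w)]) (38 * b + 20 + 8) (agree ({10, 11} \<union> {11, 18}) R)"
  proof (rule triple_word)
    fix n
    have "triple (R(18 := n)) (write_segment 3 u d1 d2 d3 c w)
      (only 3 (segment Lit ((R(18 := n)) 5) ((R(18 := n)) u) ((R(18 := n)) d1) ((R(18 := n)) d2) ((R(18 := n)) d3) e ((R(18 := n)) w)))
      (7 * (R(18 := n)) u + 7 * (R(18 := n)) w + 24 * (R(18 := n)) 5 + 20) (agree {10, 11} (R(18 := n)))"
      by (rule triple_segment) (use assms(1) regs in \<open>auto simp: ready_def agree_def intro!: c\<close>)
    then show "triple (R(18 := n)) (write_segment 3 u d1 d2 d3 c w)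
      (only 3 (segment Lit b (R u) (R d1) (R d2) (R d3) e (R w))) (38 * b + 20) (agree {10, 11} (R(18 := n)))"
      by (rule triple_eq) (use assms(1,4,5) regs in \<open>auto simp: ready_def\<close>)
  qed simp
  then show ?thesis by (rule triple_agree_mono) auto
qed

lemma triple_Copy_entry:
  "b < 43 \<Longrightarrow> R' 19 = e \<Longrightarrow> triple R' (Copy 3 b 19) (only 3 [Entry b e]) 4 (agree {} R')"
  using triple_Copy_agree[of 3 b 19 R' "{}"] by simp

lemma triple_Op_val:
  assumes "binop_val f (R y) (R z) = v" "x < 40" "y < 40" "z < 40" "x \<in> V"
    and "triple (R(x := v)) d G U (agree V (R(x := v)))"
  shows "triple R (Op f x y z ;; d) G (Suc U) (agree V R)"
  using triple_Op_agree assms by blast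

lemma agree_update: "x \<in> V \<Longrightarrow> agree V R (R'(x := v)) \<longleftrightarrow> agree V R R'"
  by (auto simp: agree_def)

lemma triple_entry1:
  assumes r: "ready N b g H R" and "0 < b"
  shows "triple R write_entry1 (words_out [entry1 Lit Entry b N (R 19)]) (38 * b + 36) (agree {10..<19} R)"
proof -
  have "triple R' (write_word (write_segment 3 1 12 13 14 (Copy 3 0 19) 16)) (words_out [entry1 Lit Entry b N (R 19)])
      (38 * b + 28) (agree {10..<19} R')"
    if "agree {10..<19} R R'" "R' 12 = R 19 div N div b" "R' 13 = R 19 div N mod b" "R' 14 = R 19 mod N div b"
      "R' 16 = R 19 mod N mod b" for R'
  proof -
    have r': "ready N b g H R'" by (rule ready_agree[OF r that(1)]) auto
    have "R' 19 = R 19" "R' 1 = 0" "R' 16 \<le> b"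
      using that r' assms(2) by (auto simp: agree_def ready_def intro: less_imp_le)
    then show ?thesis
      using triple_entry_word[OF r', of 1 12 13 14 16 "Copy 3 0 19" "Entry 0 (R 19)"] that
      by (simp add: triple_Copy_entry entry1_def)
  qed
  note rest = this
  show ?thesis
    unfolding write_entry1_def
    apply (rule triple_eq[where Q = "agree {10..<19} R"])
       apply ((rule triple_Op_agree, simp, simp, simp, simp)+, rule rest)
    using r by (simp_all add: ready_def agree_update)
qed

lemma triple_entry2:
  assumes r: "ready N b g H R" and "0 < b"
  shows "triple R write_entry2 (words_out [entry2 Lit Entry b N (R 19)]) (38 * b + 36) (agree {10..<19} R)"
proof -
  have "triple R' (write_word (write_segment 3 16 14 15 1 (Copy 3 1 19) 17)) (words_out [entry2 Lit Entry b N (R 19)])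
      (38 * b + 28) (agree {10..<19} R')"
    if "agree {10..<19} R R'" "R' 14 = R 19 div N div b" "R' 16 = b - R 19 div N mod b" "R' 15 = R 19 mod N div b"
      "R' 17 = b - R 19 mod N mod b" for R'
  proof -
    have r': "ready N b g H R'" by (rule ready_agree[OF r that(1)]) auto
    have "R' 19 = R 19" "R' 1 = 0"
      using that r' by (auto simp: agree_def ready_def)
    then show ?thesis
      using triple_entry_word[OF r', of 16 14 15 1 17 "Copy 3 1 19" "Entry 1 (R 19)"] that
      by (simp add: triple_Copy_entry entry2_def)
  qed
  note rest = this
  have r': "R 0 = N" "R 5 = b" using r by (simp_all add: ready_def)
  show ?thesis
    unfolding write_entry2_def
    apply (rule triple_eq[where Q = "agree {10..<19} R"])
       apply (rule triple_Op_val[where v = "R 19 div N"], simp add: r', simp, simp, simp, simp)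
       apply (rule triple_Op_val[where v = "R 19 div N mod b"], simp add: r', simp, simp, simp, simp)
       apply (rule triple_Op_val[where v = "R 19 div N div b"], simp add: r', simp, simp, simp, simp)
       apply (rule triple_Op_val[where v = "R 19 mod N"], simp add: r', simp, simp, simp, simp)
       apply (rule triple_Op_val[where v = "R 19 mod N mod b"], simp add: r', simp, simp, simp, simp)
       apply (rule triple_Op_val[where v = "R 19 mod N div b"], simp add: r', simp, simp, simp, simp)
       apply (rule triple_Op_val[where v = "b - R 19 div N mod b"], simp add: r', simp, simp, simp, simp)
       apply (rule triple_Op_val[where v = "b - R 19 mod N mod b"], simp add: r', simp, simp, simp, simp)
       apply (rule rest)
    by (simp_all add: agree_update)
qed

lemma triple_entry3:
  assumes r: "ready N b g H R" and "0 < b"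
  shows "triple R write_entry3 (words_out [entry3 Lit Entry b N (R 19)]) (38 * b + 36) (agree {10..<19} R)"
proof -
  have "triple R' (write_word (write_segment 3 16 12 13 15 (Copy 3 2 19) 1)) (words_out [entry3 Lit Entry b N (R 19)])
      (38 * b + 28) (agree {10..<19} R')"
    if "agree {10..<19} R R'" "R' 15 = R 19 div N div b" "R' 16 = R 19 div N mod b" "R' 12 = R 19 mod N div b"
      "R' 13 = R 19 mod N mod b" for R'
  proof -
    have r': "ready N b g H R'" by (rule ready_agree[OF r that(1)]) auto
    have "R' 19 = R 19" "R' 1 = 0" "R' 16 \<le> b"
      using that r' assms(2) by (auto simp: agree_def ready_def intro: less_imp_le)
    then show ?thesis
      using triple_entry_word[OF r', of 16 12 13 15 1 "Copy 3 2 19" "Entry 2 (R 19)"] that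
      by (simp add: triple_Copy_entry entry3_def)
  qed
  note rest = this
  show ?thesis
    unfolding write_entry3_def
    apply (rule triple_eq[where Q = "agree {10..<19} R"])
       apply ((rule triple_Op_agree, simp, simp, simp, simp)+, rule rest)
    using r by (simp_all add: ready_def agree_update)
qed

lemma triple_entries:
  assumes r: "ready N b g H R"
    and c: "\<And>R'. ready N b g H R' \<Longrightarrow> triple R' c (words_out [e (R' 19)]) (38 * b + 36) (agree {10..<19} R')"
  shows "triple R (write_set (For 19 9 c)) (sets_out [map e [0..<N * N]]) (N * N * (38 * b + 40) + 11) (agree {10..<30} R)"
proof -
  have "triple R (write_set (For 19 9 c)) (sets_out [map e [0..<N * N]])
    (N * N * ((38 * b + 36) + 4) + 3 + 8) (agree ({10..<20} \<union> {11, 20}) R)"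
  proof (rule triple_set)
    fix n
    have r': "ready N b g H (R(20 := n))" by (rule ready_agree[OF r, of "{20}"]) (auto simp: agree_def)
    have "triple (R(20 := n)) (For 19 9 c) (\<lambda>a. concat (map (\<lambda>i. words_out [e i] a) [0..<(R(20 := n)) 9]))
      ((R(20 := n)) 9 * ((38 * b + 36) + 4) + 3) (agree {10..<20} (R(20 := n)))"
    proof (rule triple_For_agree)
      fix i R' assume *: "agree {10..<20} (R(20 := n)) R'" "R' 19 = i"
      have "ready N b g H R'" by (rule ready_agree[OF r' *(1)]) auto
      from c[OF this] show "triple R' c (words_out [e i]) (38 * b + 36) (agree {10..<19} R')" using * by simp
    qed auto
    then show "triple (R(20 := n)) (For 19 9 c) (words_out (map e [0..<N * N]))
      (N * N * ((38 * b + 36) + 4) + 3) (agree {10..<20} (R(20 := n)))"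
      by (rule triple_eq) (use r in \<open>auto simp: ready_def concat_words_out\<close>)
  qed simp
  then show ?thesis by (rule triple_agree_mono) auto
qed

lemma triple_marker: "triple R (write_marker v) (sets_out [[[Lit v]]]) 20 (agree {10..<30} R)"
proof -
  have "triple R' (Const 11 v ;; Push 3 11) (only 3 [Lit v]) (Suc 3) (agree {11} R')" for R'
    by (rule triple_Const_agree) (use triple_Push_agree[of 3 11 "R'(11 := v)"] in auto)
  then have "triple R (write_marker v) (sets_out [[[Lit v]]]) (Suc 3 + 8 + 8) (agree ({11} \<union> {11, 18} \<union> {11, 20}) R)"
    unfolding write_marker_def by (intro triple_set triple_word) auto
  then show ?thesis by (rule triple_agree_mono) auto
qed

definition padding_time :: "nat \<Rightarrow> nat \<Rightarrow> nat" where
  "padding_time b H = H * (6 * 2 ^ H + 8) + 2 ^ H * (86 * b + 87) + 40"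

text \<open>One lemma serves both sides: the level \<open>h i\<close> is \<open>H - i\<close> before
  the middle and \<open>i\<close> after it, obtained by a single subtraction in either case.\<close>

lemma triple_paddings:
  assumes r: "ready N b g H R" and h: "\<And>i. i \<le> H \<Longrightarrow> h i \<le> H"
    and c: "\<And>i R' R. R 29 = i \<Longrightarrow> ready N b g H R \<Longrightarrow> binop_val Sub (R y) (R z) = h i" "y < 40" "z < 40"
  shows "triple R (For 29 7 (Op Sub 28 y z ;; write_padding)) (sets_out (map (\<lambda>i. padding Lit b g H (h i)) [0..<Suc H]))
    (Suc H * (padding_time b H + 5) + 3) (agree {10..<30} R)"
proof -
  have "triple R (For 29 7 (Op Sub 28 y z ;; write_padding))
    (\<lambda>a. concat (map (\<lambda>i. sets_out [padding Lit b g H (h i)] a) [0..<R 7]))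
    (R 7 * (Suc (padding_time b H) + 4) + 3) (agree {10..<30} R)"
  proof (rule triple_For_agree)
    fix i R' assume *: "i < R 7" "agree {10..<30} R R'" "R' 29 = i"
    have i: "i \<le> H" using *(1) r by (simp add: ready_def)
    have r': "ready N b g H R'" by (rule ready_agree[OF r *(2)]) auto
    then have v: "binop_val Sub (R' y) (R' z) = h i" using c(1) * by blast
    show "triple R' (Op Sub 28 y z ;; write_padding) (sets_out [padding Lit b g H (h i)])
        (Suc (padding_time b H)) (agree {10..<29} R')"
    proof (rule triple_Op_agree, simp_all only: v)
      have "ready N b g H (R'(28 := h i))" by (rule ready_agree[OF r', of "{28}"]) (auto simp: agree_def)
      from triple_padding[OF this _ h[OF i]]
      show "triple (R'(28 := h i)) write_padding (sets_out [padding Lit b g H (h i)])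
          (padding_time b H) (agree {10..<29} (R'(28 := h i)))"
        unfolding padding_time_def by (rule triple_agree_mono) auto
    qed (use c in auto)
  qed auto
  then show ?thesis
    by (rule triple_eq) (use r in \<open>auto simp: ready_def concat_sets_out simp del: upt_Suc\<close>)
qed

definition text_time :: "nat \<Rightarrow> nat \<Rightarrow> nat \<Rightarrow> nat" where
  "text_time b H N = 2 * (Suc H * (padding_time b H + 5) + 3) + 3 * (N * N * (38 * b + 40) + 11) + 40"

lemma triple_text:
  assumes r: "ready N b g H R" and "0 < b"
  shows "triple R write_text (sets_out (ed_text Lit Entry b g H N)) (text_time b H N) (agree {10..<30} R)"
proof -
  have r': "ready N b g H R'" if "agree {10..<30} R R'" for R' by (rule ready_agree[OF r that]) auto
  have down: "triple R' (For 29 7 (Op Sub 28 6 29 ;; write_padding))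
      (sets_out (map (\<lambda>i. padding Lit b g H (H - i)) [0..<Suc H])) (Suc H * (padding_time b H + 5) + 3) (agree {10..<30} R')"
    and up: "triple R' (For 29 7 (Op Sub 28 29 1 ;; write_padding))
      (sets_out (map (padding Lit b g H) [0..<Suc H])) (Suc H * (padding_time b H + 5) + 3) (agree {10..<30} R')"
    and e1: "triple R' (write_set (For 19 9 write_entry1)) (sets_out [map (entry1 Lit Entry b N) [0..<N * N]])
      (N * N * (38 * b + 40) + 11) (agree {10..<30} R')"
    and e2: "triple R' (write_set (For 19 9 write_entry2)) (sets_out [map (entry2 Lit Entry b N) [0..<N * N]])
      (N * N * (38 * b + 40) + 11) (agree {10..<30} R')"
    and e3: "triple R' (write_set (For 19 9 write_entry3)) (sets_out [map (entry3 Lit Entry b N) [0..<N * N]])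
      (N * N * (38 * b + 40) + 11) (agree {10..<30} R')"
    if "agree {10..<30} R R'" for R'
  proof -
    note rr = r'[OF that]
    show "triple R' (For 29 7 (Op Sub 28 6 29 ;; write_padding))
      (sets_out (map (\<lambda>i. padding Lit b g H (H - i)) [0..<Suc H])) (Suc H * (padding_time b H + 5) + 3) (agree {10..<30} R')"
      by (rule triple_paddings[OF rr]) (auto simp: ready_def)
    show "triple R' (For 29 7 (Op Sub 28 29 1 ;; write_padding))
      (sets_out (map (padding Lit b g H) [0..<Suc H])) (Suc H * (padding_time b H + 5) + 3) (agree {10..<30} R')"
      by (rule triple_paddings[OF rr]) (auto simp: ready_def)
    show "triple R' (write_set (For 19 9 write_entry1)) (sets_out [map (entry1 Lit Entry b N) [0..<N * N]])
      (N * N * (38 * b + 40) + 11) (agree {10..<30} R')"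
      by (rule triple_entries[OF rr triple_entry1[OF _ assms(2)]])
    show "triple R' (write_set (For 19 9 write_entry2)) (sets_out [map (entry2 Lit Entry b N) [0..<N * N]])
      (N * N * (38 * b + 40) + 11) (agree {10..<30} R')"
      by (rule triple_entries[OF rr triple_entry2[OF _ assms(2)]])
    show "triple R' (write_set (For 19 9 write_entry3)) (sets_out [map (entry3 Lit Entry b N) [0..<N * N]])
      (N * N * (38 * b + 40) + 11) (agree {10..<30} R')"
      by (rule triple_entries[OF rr triple_entry3[OF _ assms(2)]])
  qed
  note S = triple_Seq_agree[OF _ _ order_refl]
  have "triple R write_text
    (join (sets_out [[[Lit 3]]]) (join (sets_out (map (\<lambda>i. padding Lit b g H (H - i)) [0..<Suc H]))
     (join (sets_out [map (entry1 Lit Entry b N) [0..<N * N]]) (join (sets_out [map (entry2 Lit Entry b N) [0..<N * N]])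
     (join (sets_out [map (entry3 Lit Entry b N) [0..<N * N]]) (join (sets_out (map (padding Lit b g H) [0..<Suc H]))
     (sets_out [[[Lit 4]]])))))))
    (20 + ((Suc H * (padding_time b H + 5) + 3) + ((N * N * (38 * b + 40) + 11) + ((N * N * (38 * b + 40) + 11) +
      ((N * N * (38 * b + 40) + 11) + ((Suc H * (padding_time b H + 5) + 3) + 20)))))) (agree {10..<30} R)"
    unfolding write_text_def
    by (intro S down up e1 e2 e3 triple_marker) (auto simp: agree_def)
  then show ?thesis
    by (rule triple_eq) (auto simp: join_sets_out ed_text_def text_time_def simp del: upt_Suc)
qed

lemma triple_pattern:
  assumes r: "ready N b g H R"
  shows "triple R write_pattern (only 0 (pattern Lit b g (2 ^ H))) (2 ^ H * (86 * b + 70) + 11) (agree {10..<30} R)"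
proof -
  let ?V = "{10..<30}"
  have push: "triple R' (Const 11 v ;; Push 0 11) (only 0 [Lit v]) (Suc 3) (agree ?V R')" for R' v
    by (rule triple_Const_agree) (use triple_Push_agree[of 0 11 "R'(11 := v)"] in auto)
  have loop: "triple R' (For 19 8 (write_block 0)) (only 0 (blocks Lit b g 0 (2 ^ H))) (2 ^ H * (86 * b + 70) + 3) (agree ?V R')"
    if a: "agree ?V R R'" for R'
  proof -
    have r': "ready N b g H R'" by (rule ready_agree[OF r a]) auto
    have "triple R' (For 19 8 (write_block 0)) (\<lambda>a. concat (map (\<lambda>i. only 0 (block Lit b g i) a) [0..<R' 8]))
      (R' 8 * ((86 * b + 66) + 4) + 3) (agree ?V R')"
    proof (rule triple_For_agree)
      fix i R'' assume *: "agree ?V R' R''" "R'' 19 = i"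
      have "ready N b g H R''" by (rule ready_agree[OF r' *(1)]) auto
      from triple_block[OF this, of 0] show "triple R'' (write_block 0) (only 0 (block Lit b g i)) (86 * b + 66) (agree {10..<18} R'')"
        using * by simp
    qed auto
    then show ?thesis
      by (rule triple_eq) (use r' in \<open>auto simp: ready_def concat_only blocks_def\<close>)
  qed
  have 1: "triple R' (Push 0 11 ;; For 19 8 (write_block 0) ;; Const 11 4 ;; Push 0 11)
      (join (only 0 [Lit (R' 11)]) (join (only 0 (blocks Lit b g 0 (2 ^ H))) (only 0 [Lit 4])))
      (3 + ((2 ^ H * (86 * b + 70) + 3) + Suc 3)) (agree ?V R')" if "agree ?V R R'" for R'
    by (intro triple_Seq_agree[OF _ _ order_refl] loop push triple_Push_agree)
      (use that in \<open>auto simp: agree_def\<close>)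
  have "triple R write_pattern (join (only 0 [Lit 3]) (join (only 0 (blocks Lit b g 0 (2 ^ H))) (only 0 [Lit 4])))
      (Suc (3 + ((2 ^ H * (86 * b + 70) + 3) + Suc 3))) (agree ?V R)"
    unfolding write_pattern_def
    by (rule triple_Const_agree) (use 1[of "R(11 := 3)"] in \<open>auto simp: agree_def\<close>)
  then show ?thesis
    by (rule triple_eq) (auto simp: join_only pattern_def)
qed


text \<open>The binary logarithm rounded up, so that \<open>g\<close> and \<open>b\<close> can be
  powers of two with product \<open>2 ^ lg N\<close>, which is at least \<open>N\<close>.\<close>

definition lg :: "nat \<Rightarrow> nat" where
  "lg N = (LEAST l. N \<le> 2 ^ l)"

lemma le_two_power_lg: "N \<le> 2 ^ lg N"
  unfolding lg_def by (rule LeastI_ex) (use less_exp less_imp_le in blast)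

lemma two_power_less_iff: "2 ^ i < N \<longleftrightarrow> i < lg N"
proof
  assume "2 ^ i < N"
  then have "(2::nat) ^ i < 2 ^ lg N" using le_two_power_lg by (rule less_le_trans)
  then show "i < lg N" by simp
next
  assume "i < lg N"
  then show "2 ^ i < N" using not_less_Least unfolding lg_def by (metis not_le)
qed

lemma lg_le: "lg N \<le> N"
  unfolding lg_def by (rule Least_le) (simp add: less_imp_le)

lemma triple_Const_step: "x < 40 \<Longrightarrow> triple (R(x := v)) d G U Q \<Longrightarrow> triple R (Const x v ;; d) G (Suc U) Q"
  using triple_step[OF triple_Const] by fastforce

lemma triple_Op_step:
  "x < 40 \<Longrightarrow> y < 40 \<Longrightarrow> z < 40 \<Longrightarrow> triple (R(x := binop_val f (R y) (R z))) d G U Q \<Longrightarrow>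
    triple R (Op f x y z ;; d) G (Suc U) Q"
  using triple_step[OF triple_Op] by fastforce

lemma triple_Seq_silent:
  assumes "triple R c (\<lambda>_. []) T Q" "\<And>R'. Q R' \<Longrightarrow> triple R' d (\<lambda>_. []) U Q'"
  shows "triple R (c ;; d) (\<lambda>_. []) (T + U) Q'"
  using triple_Seq[OF assms] by simp

lemma triple_For_silent:
  assumes "x \<noteq> y" "x < 40" "y < 40" "R y = n" "I 0 (R(x := 0))"
    and "\<And>i R'. i < n \<Longrightarrow> I i R' \<Longrightarrow> R' x = i \<Longrightarrow> R' y = n \<Longrightarrow>
      triple R' c (\<lambda>_. []) T (\<lambda>R''. R'' x = i \<and> R'' y = n \<and> I (Suc i) (R''(x := Suc i)))"
  shows "triple R (For x y c) (\<lambda>_. []) (n * (T + 4) + 3) (I n)"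
proof -
  have "triple R (For x y c) (\<lambda>a. concat (map (\<lambda>i. (\<lambda>_. []) a) [0..<n])) (n * (T + 4) + 3) (I n)"
    using assms by (rule triple_For)
  then show ?thesis by (rule triple_eq) auto
qed

lemma triple_square:
  assumes "R 0 = N" "R 9 = 0"
  shows "triple R (For 34 0 (For 35 0 (Inc 9))) (\<lambda>_. []) (N * (6 * N + 7) + 3)
    (agree {34, 35} (R(9 := N * N)))"
proof -
  have "triple R (For 34 0 (For 35 0 (Inc 9))) (\<lambda>_. []) (N * ((6 * N + 3) + 4) + 3)
    ((\<lambda>i. agree {34, 35} (R(9 := i * N))) N)"
  proof (rule triple_For_silent[where I = "\<lambda>i. agree {34, 35} (R(9 := i * N))"])
    fix i R' assume *: "agree {34, 35} (R(9 := i * N)) R'" "R' 34 = i" "R' 0 = N"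
    have "R' 9 = i * N" using * by (simp add: agree_def)
    then show "triple R' (For 35 0 (Inc 9)) (\<lambda>_. []) (6 * N + 3)
        (\<lambda>R''. R'' 34 = i \<and> R'' 0 = N \<and> agree {34, 35} (R(9 := Suc i * N)) (R''(34 := Suc i)))"
      by (intro triple_eq[OF triple_add]) (use * in \<open>auto simp: agree_def\<close>)
  qed (use assms in \<open>auto simp: agree_def\<close>)
  then show ?thesis by (rule triple_weaken) auto
qed

text \<open>After \<open>i\<close> rounds the exponent is \<open>min i (lg N)\<close>; since
  \<open>lg N \<le> N\<close>, it has reached \<open>lg N\<close> after \<open>N\<close>
  rounds.\<close>

lemma triple_lg:
  assumes "R 0 = N" "R 1 = 0" "R 30 = 1" "R 31 = 0"
  shows "triple R (For 34 0 (Op Less 11 30 0 ;; For 35 11 (double 30 ;; Inc 31))) (\<lambda>_. [])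
    (N * (6 * 2 ^ lg N + 18) + 3) (agree {11, 25, 26, 34, 35} (R(30 := 2 ^ lg N, 31 := lg N)))"
proof -
  let ?V = "{11, 25, 26, 34, 35}"
  define S where "S i = R(30 := 2 ^ i, 31 := i)" for i
  have "triple R (For 34 0 (Op Less 11 30 0 ;; For 35 11 (double 30 ;; Inc 31))) (\<lambda>_. [])
    (N * (Suc ((6 * 2 ^ lg N + 6 + 4) + 3) + 4) + 3) ((\<lambda>i. agree ?V (S (min i (lg N)))) N)"
  proof (rule triple_For_silent[where I = "\<lambda>i. agree ?V (S (min i (lg N)))"])
    fix i R' assume *: "agree ?V (S (min i (lg N))) R'" "R' 34 = i" "R' 0 = N"
    define t where "t = (if i < lg N then 1 else 0 :: nat)"
    have "R' 30 = 2 ^ min i (lg N)" using * by (simp add: agree_def S_def)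
    then have t: "binop_val Less (R' 30) (R' 0) = t"
      using * two_power_less_iff by (simp add: t_def min_def)
    have "triple (R'(11 := t)) (For 35 11 (double 30 ;; Inc 31)) (\<lambda>_. []) (t * ((6 * 2 ^ lg N + 4 + 2) + 4) + 3)
      ((\<lambda>k R''. agree ?V (S (min i (lg N) + k)) R'' \<and> R'' 34 = i) t)"
    proof (rule triple_For_silent)
      fix k R1 assume k: "k < t" "agree ?V (S (min i (lg N) + k)) R1 \<and> R1 34 = i" "R1 35 = k" "R1 11 = t"
      then have i: "i < lg N" "k = 0" "t = 1" by (auto simp: t_def split: if_splits)
      have r: "R1 30 = 2 ^ i" "R1 31 = i" "R1 1 = 0" using k i assms by (auto simp: agree_def S_def)
      have le: "(2::nat) ^ i \<le> 2 ^ lg N" using i by simp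
      show "triple R1 (double 30 ;; Inc 31) (\<lambda>_. []) (6 * 2 ^ lg N + 4 + 2)
        (\<lambda>R''. R'' 35 = k \<and> R'' 11 = t \<and> agree ?V (S (min i (lg N) + Suc k)) (R''(35 := Suc k)) \<and> (R''(35 := Suc k)) 34 = i)"
      proof (rule triple_Seq_silent)
        show "triple R1 (double 30) (\<lambda>_. []) (6 * 2 ^ lg N + 4) (agree {25, 26} (R1(30 := 2 * 2 ^ i)))"
          by (rule triple_eq[OF triple_double]) (use r le in auto)
        fix R2 assume "agree {25, 26} (R1(30 := 2 * 2 ^ i)) R2"
        then show "triple R2 (Inc 31) (\<lambda>_. []) 2
          (\<lambda>R''. R'' 35 = k \<and> R'' 11 = t \<and> agree ?V (S (min i (lg N) + Suc k)) (R''(35 := Suc k)) \<and> (R''(35 := Suc k)) 34 = i)"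
          by (intro triple_weaken[OF triple_Inc]) (use k i r in \<open>auto simp: agree_def S_def\<close>)
      qed
    qed (use * in \<open>auto simp: agree_def S_def\<close>)
    note loop = this
    have "triple R' (Op Less 11 30 0 ;; For 35 11 (double 30 ;; Inc 31)) (\<lambda>_. [])
      (Suc (t * ((6 * 2 ^ lg N + 4 + 2) + 4) + 3))
      (\<lambda>R''. agree ?V (S (min i (lg N) + t)) R'' \<and> R'' 34 = i)"
    proof (rule triple_Op_step)
      show "triple (R'(11 := binop_val Less (R' 30) (R' 0))) (For 35 11 (double 30 ;; Inc 31)) (\<lambda>_. [])
        (t * ((6 * 2 ^ lg N + 4 + 2) + 4) + 3) (\<lambda>R''. agree ?V (S (min i (lg N) + t)) R'' \<and> R'' 34 = i)"
        unfolding t by (rule loop)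
    qed simp_all
    then show "triple R' (Op Less 11 30 0 ;; For 35 11 (double 30 ;; Inc 31)) (\<lambda>_. []) (Suc ((6 * 2 ^ lg N + 6 + 4) + 3))
      (\<lambda>R''. R'' 34 = i \<and> R'' 0 = N \<and> agree ?V (S (min (Suc i) (lg N))) (R''(34 := Suc i)))"
    proof (rule triple_weaken)
      fix R'' assume a: "agree ?V (S (min i (lg N) + t)) R'' \<and> R'' 34 = i"
      have "min i (lg N) + t = min (Suc i) (lg N)" by (auto simp: t_def min_def)
      then show "R'' 34 = i \<and> R'' 0 = N \<and> agree ?V (S (min (Suc i) (lg N))) (R''(34 := Suc i))"
        using a assms(1) by (auto simp: agree_def S_def)
    qed (auto simp: t_def)
  qed (use assms in \<open>auto simp: agree_def S_def\<close>)
  then show ?thesis by (rule triple_weaken) (simp_all add: S_def lg_le min_absorb2)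
qed

definition prepare_time :: "nat \<Rightarrow> nat \<Rightarrow> nat" where
  "prepare_time q N =
     (let l = lg N; k = l div q; H = l + 2 * k in
      N * (6 * N + 7) + N * (6 * 2 ^ l + 18) + k * (6 * 2 ^ k + 8) + k * 8 + H * (6 * 2 ^ H + 8) + 40)"

lemma triple_prepare:
  fixes q :: nat
  assumes N: "R 0 = N"
  defines "l \<equiv> lg N"
  defines "k \<equiv> l div q"
  shows "triple R (prepare q) (\<lambda>_. []) (prepare_time q N) (ready N (2 ^ (l - k)) (2 ^ k) (l + 2 * k))"
proof -
  let ?Q = "ready N (2 ^ (l - k)) (2 ^ k) (l + 2 * k)"
  let ?H = "l + 2 * k"
  define P where "P R \<longleftrightarrow> R 0 = N \<and> R 1 = 0 \<and> R 2 = 2 \<and> R 3 = 1" for R :: "nat \<Rightarrow> nat"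
  have P_agree: "P R'" if "agree V R R'" "V \<subseteq> {4..}" "P R" for V R R'
  proof -
    have "R' x = R x" if "x < 4" for x using that \<open>V \<subseteq> {4..}\<close> by (intro agreeD[OF \<open>agree V R R'\<close>]) auto
    then show ?thesis using that(3) by (simp add: P_def)
  qed
  have k: "k \<le> l" by (simp add: k_def)
  have 7: "triple R' (Op Sub 7 6 1 ;; Inc 7) (\<lambda>_. []) (Suc 2) ?Q"
    if "P R'" "R' 9 = N * N" "R' 4 = 2 ^ k" "R' 5 = 2 ^ (l - k)" "R' 6 = ?H" "R' 8 = 2 ^ ?H" for R'
    by (rule triple_Op_step; (rule triple_weaken[OF triple_Inc])?) (use that in \<open>auto simp: ready_def P_def\<close>)
  have 6: "triple R' (power_two 8 6 ;; Op Sub 7 6 1 ;; Inc 7) (\<lambda>_. []) ((?H * (6 * 2 ^ ?H + 8) + 4) + Suc 2) ?Q"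
    if "P R'" "R' 9 = N * N" "R' 4 = 2 ^ k" "R' 5 = 2 ^ (l - k)" "R' 6 = ?H" for R'
  proof (rule triple_Seq_silent)
    show "triple R' (power_two 8 6) (\<lambda>_. []) (?H * (6 * 2 ^ ?H + 8) + 4) (agree {25, 26, 27} (R'(8 := 2 ^ ?H)))"
      using triple_power_two[of R' 8 6] that by (simp add: P_def)
    fix R'' assume a: "agree {25, 26, 27} (R'(8 := 2 ^ ?H)) R''"
    show "triple R'' (Op Sub 7 6 1 ;; Inc 7) (\<lambda>_. []) (Suc 2) ?Q"
      by (rule 7) (use a that in \<open>auto simp: agree_def P_def\<close>)
  qed
  have 5: "triple R' (Op Sub 6 31 1 ;; For 34 32 (Inc 6 ;; Inc 6) ;; power_two 8 6 ;; Op Sub 7 6 1 ;; Inc 7)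
      (\<lambda>_. []) (Suc ((k * (2 + 2 + 4) + 3) + ((?H * (6 * 2 ^ ?H + 8) + 4) + Suc 2))) ?Q"
    if "P R'" "R' 9 = N * N" "R' 4 = 2 ^ k" "R' 5 = 2 ^ (l - k)" "R' 31 = l" "R' 32 = k" for R'
  proof (rule triple_Op_step)
    have v: "binop_val Sub (R' 31) (R' 1) = l" using that by (simp add: P_def)
    show "triple (R'(6 := binop_val Sub (R' 31) (R' 1))) (For 34 32 (Inc 6 ;; Inc 6) ;; power_two 8 6 ;; Op Sub 7 6 1 ;; Inc 7)
      (\<lambda>_. []) ((k * (2 + 2 + 4) + 3) + ((?H * (6 * 2 ^ ?H + 8) + 4) + Suc 2)) ?Q"
      unfolding v
    proof (rule triple_Seq_silent)
      show "triple (R'(6 := l)) (For 34 32 (Inc 6 ;; Inc 6)) (\<lambda>_. []) (k * (2 + 2 + 4) + 3)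
          ((\<lambda>i. agree {34} (R'(6 := l + 2 * i))) k)"
      proof (rule triple_For_silent)
        fix i R1 assume *: "agree {34} (R'(6 := l + 2 * i)) R1" "R1 34 = i" "R1 32 = k"
        show "triple R1 (Inc 6 ;; Inc 6) (\<lambda>_. []) (2 + 2)
            (\<lambda>R''. R'' 34 = i \<and> R'' 32 = k \<and> agree {34} (R'(6 := l + 2 * Suc i)) (R''(34 := Suc i)))"
          by (rule triple_step[OF triple_Inc], simp, rule triple_weaken[OF triple_Inc])
            (use * in \<open>auto simp: agree_def\<close>)
      qed (use that in \<open>auto simp: agree_def\<close>)
      fix R'' assume a: "agree {34} (R'(6 := l + 2 * k)) R''"
      show "triple R'' (power_two 8 6 ;; Op Sub 7 6 1 ;; Inc 7) (\<lambda>_. []) ((?H * (6 * 2 ^ ?H + 8) + 4) + Suc 2) ?Q"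
        by (rule 6) (use a that in \<open>auto simp: agree_def P_def\<close>)
    qed
  qed simp_all
  have 4: "triple R' (power_two 4 32 ;; Op Div 5 30 4 ;; Op Sub 6 31 1 ;; For 34 32 (Inc 6 ;; Inc 6) ;; power_two 8 6 ;;
      Op Sub 7 6 1 ;; Inc 7) (\<lambda>_. [])
      ((k * (6 * 2 ^ k + 8) + 4) + Suc (Suc ((k * (2 + 2 + 4) + 3) + ((?H * (6 * 2 ^ ?H + 8) + 4) + Suc 2)))) ?Q"
    if "P R'" "R' 9 = N * N" "R' 30 = 2 ^ l" "R' 31 = l" "R' 32 = k" for R'
  proof (rule triple_Seq_silent)
    show "triple R' (power_two 4 32) (\<lambda>_. []) (k * (6 * 2 ^ k + 8) + 4) (agree {25, 26, 27} (R'(4 := 2 ^ k)))"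
      using triple_power_two[of R' 4 32] that by (simp add: P_def)
    fix R'' assume a: "agree {25, 26, 27} (R'(4 := 2 ^ k)) R''"
    then have r: "P R''" "R'' 9 = N * N" "R'' 4 = 2 ^ k" "R'' 30 = 2 ^ l" "R'' 31 = l" "R'' 32 = k"
      using that by (auto simp: agree_def P_def)
    then have "binop_val Div (R'' 30) (R'' 4) = 2 ^ (l - k)" using k by (simp add: power_diff)
    then show "triple R'' (Op Div 5 30 4 ;; Op Sub 6 31 1 ;; For 34 32 (Inc 6 ;; Inc 6) ;; power_two 8 6 ;;
      Op Sub 7 6 1 ;; Inc 7) (\<lambda>_. []) (Suc (Suc ((k * (2 + 2 + 4) + 3) + ((?H * (6 * 2 ^ ?H + 8) + 4) + Suc 2)))) ?Q"
      by (intro triple_Op_step 5) (use r in \<open>auto simp: P_def\<close>)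
  qed
  define rest where "rest = power_two 4 32 ;; Op Div 5 30 4 ;; Op Sub 6 31 1 ;; For 34 32 (Inc 6 ;; Inc 6) ;;
      power_two 8 6 ;; Op Sub 7 6 1 ;; Inc 7"
  define U where "U = (k * (6 * 2 ^ k + 8) + 4) + Suc (Suc ((k * (2 + 2 + 4) + 3) + ((?H * (6 * 2 ^ ?H + 8) + 4) + Suc 2)))"
  have 3: "triple R' (Const 30 1 ;; Const 31 0 ;; For 34 0 (Op Less 11 30 0 ;; For 35 11 (double 30 ;; Inc 31)) ;;
      Const 33 q ;; Op Div 32 31 33 ;; rest) (\<lambda>_. []) (Suc (Suc ((N * (6 * 2 ^ l + 18) + 3) + Suc (Suc U)))) ?Q"
    if "P R'" "R' 9 = N * N" for R'
  proof (intro triple_Const_step)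
    show "triple (R'(30 := 1, 31 := 0)) (For 34 0 (Op Less 11 30 0 ;; For 35 11 (double 30 ;; Inc 31)) ;;
      Const 33 q ;; Op Div 32 31 33 ;; rest) (\<lambda>_. []) ((N * (6 * 2 ^ l + 18) + 3) + Suc (Suc U)) ?Q"
    proof (rule triple_Seq_silent)
      show "triple (R'(30 := 1, 31 := 0)) (For 34 0 (Op Less 11 30 0 ;; For 35 11 (double 30 ;; Inc 31))) (\<lambda>_. [])
          (N * (6 * 2 ^ l + 18) + 3) (agree {11, 25, 26, 34, 35} (R'(30 := 2 ^ l, 31 := l)))"
        unfolding l_def by (rule triple_eq[OF triple_lg]) (use that in \<open>auto simp: P_def agree_def\<close>)
      fix R'' assume a: "agree {11, 25, 26, 34, 35} (R'(30 := 2 ^ l, 31 := l)) R''"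
      show "triple R'' (Const 33 q ;; Op Div 32 31 33 ;; rest) (\<lambda>_. []) (Suc (Suc U)) ?Q"
        unfolding rest_def U_def
        by (intro triple_Const_step triple_Op_step 4) (use a that in \<open>auto simp: agree_def P_def k_def\<close>)
    qed
  qed simp_all
  have "triple R (prepare q) (\<lambda>_. []) (Suc (Suc (Suc (Suc ((N * (6 * N + 7) + 3) + Suc (Suc ((N * (6 * 2 ^ l + 18) + 3) + Suc (Suc U)))))))) ?Q"
    unfolding prepare_def rest_def[symmetric]
  proof (intro triple_Const_step)
    show "triple (R(1 := 0, 2 := 2, 3 := 1, 9 := 0)) (For 34 0 (For 35 0 (Inc 9)) ;;
      Const 30 1 ;; Const 31 0 ;; For 34 0 (Op Less 11 30 0 ;; For 35 11 (double 30 ;; Inc 31)) ;;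
      Const 33 q ;; Op Div 32 31 33 ;; rest) (\<lambda>_. []) ((N * (6 * N + 7) + 3) + Suc (Suc ((N * (6 * 2 ^ l + 18) + 3) + Suc (Suc U)))) ?Q"
    proof (rule triple_Seq_silent[OF triple_square])
      fix R'' assume a: "agree {34, 35} (R(1 := 0, 2 := 2, 3 := 1, 9 := 0, 9 := N * N)) R''"
      show "triple R'' (Const 30 1 ;; Const 31 0 ;; For 34 0 (Op Less 11 30 0 ;; For 35 11 (double 30 ;; Inc 31)) ;;
        Const 33 q ;; Op Div 32 31 33 ;; rest) (\<lambda>_. []) (Suc (Suc ((N * (6 * 2 ^ l + 18) + 3) + Suc (Suc U)))) ?Q"
        by (rule 3) (use a N in \<open>auto simp: agree_def P_def\<close>)
    qed (use N in auto)
  qed simp_all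
  then show ?thesis
    by (rule triple_weaken) (simp_all add: prepare_time_def U_def Let_def l_def k_def)
qed

section \<open>The reduction as a projection\<close>

text \<open>Zeroing the scratch registers makes the final store an explicit function of the initial
  one; register 42 could otherwise keep the last matrix entry copied.\<close>

primrec clear :: "nat \<Rightarrow> com" where
  "clear 0 = Skip"
| "clear (Suc n) = clear n ;; Const n 0"

lemma runs_clear:
  "runs (clear n) s (n + 1) (\<lambda>l. case l of Reg x \<Rightarrow> (if x < n then 0 else s l) | Cell a i \<Rightarrow> s l)"
proof (induction n)
  case 0
  have "(\<lambda>l. case l of Reg x \<Rightarrow> (if x < 0 then 0 else s l) | Cell a i \<Rightarrow> s l) = s"
    by (auto split: loc.split)
  then show ?case using runs_Skip[of s] by simp
next
  case (Suc n)
  have "(\<lambda>l. case l of Reg x \<Rightarrow> (if x < n then 0 else s l) | Cell a i \<Rightarrow> s l)(Reg n := 0) =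
      (\<lambda>l. case l of Reg x \<Rightarrow> (if x < Suc n then 0 else s l) | Cell a i \<Rightarrow> s l)"
    by (auto split: loc.split)
  then show ?case using runs_Seq[OF Suc runs_Const[of n 0]] by simp
qed

text \<open>A projection is judged on arbitrary initial stores, so the stream lengths are set to 0
  explicitly.\<close>

definition reduction :: "nat \<Rightarrow> com" where
  "reduction q =
     Const 43 0 ;; Const 44 0 ;; Const 45 0 ;; Const 46 0 ;;
     (prepare q ;; write_pattern ;; write_text) ;; clear 43"

text \<open>\<open>g\<close> is about \<open>N powr (1 / q)\<close>, \<open>b\<close> about \<open>N / g\<close> and the number \<open>2 ^ H\<close> of blocks about \<open>N g\<^sup>2\<close>.\<close>

definition block_size :: "nat \<Rightarrow> nat \<Rightarrow> nat" where
  "block_size q N = 2 ^ (lg N - lg N div q)"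

definition num_blocks :: "nat \<Rightarrow> nat \<Rightarrow> nat" where
  "num_blocks q N = 2 ^ (lg N div q)"

definition height :: "nat \<Rightarrow> nat \<Rightarrow> nat" where
  "height q N = lg N + 2 * (lg N div q)"

definition edsm_pattern :: "(nat \<Rightarrow> 'v) \<Rightarrow> nat \<Rightarrow> nat \<Rightarrow> 'v list" where
  "edsm_pattern f q N = pattern f (block_size q N) (num_blocks q N) (2 ^ height q N)"

definition edsm_text :: "(nat \<Rightarrow> 'v) \<Rightarrow> (nat \<Rightarrow> nat \<Rightarrow> 'v) \<Rightarrow> nat \<Rightarrow> nat \<Rightarrow> 'v list list list" where
  "edsm_text f M q N = ed_text f M (block_size q N) (num_blocks q N) (height q N) N"

definition reduction_out :: "nat \<Rightarrow> nat \<Rightarrow> streams" where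
  "reduction_out q N = join (only 0 (edsm_pattern Lit q N)) (sets_out (edsm_text Lit Entry q N))"

definition reduction_time :: "nat \<Rightarrow> nat \<Rightarrow> nat" where
  "reduction_time q N =
     prepare_time q N + (2 ^ height q N * (86 * block_size q N + 70) + 11) +
     text_time (block_size q N) (height q N) N + 48"

text \<open>\<open>F\<close> depends on register 0 only, so the registers determine which symbol
  stands in a cell; its value is a constant or that of one initial cell. Cells past the end of a
  stream keep their contents.\<close>

definition reduction_store :: "nat \<Rightarrow> store \<Rightarrow> store" where
  "reduction_store q s =
     (let F = reduction_out q (s (Reg 0)) in
      (\<lambda>l. case l of
        Reg x \<Rightarrow> (if x < 43 then 0 else if x < 47 then length (F (x - 43)) else s l)
      | Cell a i \<Rightarrow>
          (if 43 \<le> a \<and> a < 47 \<and> i < length (F (a - 43)) then symbol_val s (F (a - 43) ! i) else s l)))"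

lemma runs_reduction:
  "\<exists>t. runs (reduction q) s t (reduction_store q s) \<and> t \<le> reduction_time q (s (Reg 0))"
proof -
  define N where "N = s (Reg 0)"
  let ?b = "block_size q N" and ?g = "num_blocks q N" and ?H = "height q N"
  define s1 where "s1 = s(Reg 43 := 0, Reg 44 := 0, Reg 45 := 0, Reg 46 := 0)"
  define R where "R x = s (Reg x)" for x
  have "represents s R (\<lambda>_. []) s1"
    unfolding represents_def s1_def R_def by (auto simp: less_Suc_eq numeral_eq_Suc)
  moreover have "triple R (prepare q ;; write_pattern ;; write_text) (join (\<lambda>_. []) (reduction_out q N))
      (prepare_time q N + ((2 ^ ?H * (86 * ?b + 70) + 11) + text_time ?b ?H N)) (\<lambda>_. True)"
  proof (rule triple_Seq)
    show "triple R (prepare q) (\<lambda>_. []) (prepare_time q N) (ready N ?b ?g ?H)"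
      unfolding block_size_def num_blocks_def height_def by (rule triple_prepare) (simp add: R_def N_def)
    fix R' assume r: "ready N ?b ?g ?H R'"
    show "triple R' (write_pattern ;; write_text) (reduction_out q N)
        ((2 ^ ?H * (86 * ?b + 70) + 11) + text_time ?b ?H N) (\<lambda>_. True)"
      unfolding reduction_out_def edsm_pattern_def edsm_text_def
    proof (rule triple_Seq[OF triple_pattern[OF r]])
      fix R'' assume "agree {10..<30} R' R''"
      then have r': "ready N ?b ?g ?H R''" by (rule ready_agree[OF r]) auto
      have "0 < ?b" by (simp add: block_size_def)
      then show "triple R'' write_text (sets_out (ed_text Lit Entry ?b ?g ?H N)) (text_time ?b ?H N) (\<lambda>_. True)"
        by (rule triple_weaken[OF triple_text[OF r']]) simp_all
    qed
  qed
  ultimately obtain t s2 R2 where 2: "runs (prepare q ;; write_pattern ;; write_text) s1 t s2"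
    "t \<le> prepare_time q N + ((2 ^ ?H * (86 * ?b + 70) + 11) + text_time ?b ?H N)"
    "represents s R2 (reduction_out q N) s2"
    unfolding triple_def by fastforce
  let ?s3 = "\<lambda>l. case l of Reg x \<Rightarrow> (if x < 43 then 0 else s2 l) | Cell a i \<Rightarrow> s2 l"
  have "runs (reduction q) s (1 + (1 + (1 + (1 + (t + (43 + 1)))))) ?s3"
    unfolding reduction_def
    by (intro runs_Seq[OF runs_Const] runs_Seq[OF 2(1)[unfolded s1_def]] runs_clear)
  moreover have "?s3 = reduction_store q s"
  proof
    fix l show "?s3 l = reduction_store q s l"
    proof (cases l)
      case (Reg x)
      have "s2 (Reg x) = length (reduction_out q N (x - 43))" if "43 \<le> x" "x < 47"
      proof -
        define x' where "x' = x - 43"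
        then have "x = 43 + x'" "x' < 4" using that by auto
        then show ?thesis using 2(3) unfolding represents_def by simp
      qed
      moreover have "s2 (Reg x) = s (Reg x)" if "47 \<le> x" using 2(3) that unfolding represents_def by blast
      ultimately show ?thesis using Reg by (simp add: reduction_store_def Let_def N_def)
    next
      case (Cell a i)
      have "s2 (Cell a i) = (if i < length (reduction_out q N (a - 43)) then symbol_val s (reduction_out q N (a - 43) ! i) else s (Cell a i))"
        if "43 \<le> a" "a < 47"
      proof -
        define a' where "a' = a - 43"
        then have "a = 43 + a'" "a' < 4" using that by auto
        then show ?thesis using 2(3) unfolding represents_def by simp
      qed
      moreover have "s2 (Cell a i) = s (Cell a i)" if "a < 43 \<or> 47 \<le> a"
        using 2(3) that unfolding represents_def by blast
      ultimately show ?thesis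
        using Cell by (cases "43 \<le> a \<and> a < 47") (auto simp: reduction_store_def Let_def N_def)
    qed
  qed
  ultimately show ?thesis
    using 2(2) unfolding reduction_time_def N_def[symmetric] by (intro exI conjI) auto
qed

lemma exec_reduction: "exec W (reduction q) s t s' \<Longrightarrow> s' = reduction_store q s"
  using runs_reduction exec_deterministic unfolding runs_def by blast

lemma projection_reduction: "projection (reduction q)"
  unfolding projection_def
proof (intro allI)
  fix \<rho> :: "nat \<Rightarrow> nat" and l
  let ?F = "reduction_out q (\<rho> 0)"
  \<comment> \<open>The cell copied to \<open>l\<close>, or \<open>l\<close> itself if it is
    unchanged; where the registers alone determine the value, \<open>(0, 0)\<close> is an arbitrary
    choice.\<close>
  let ?c = "case l of Reg x \<Rightarrow> (0, 0) | Cell a i \<Rightarrow>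
    (if 43 \<le> a \<and> a < 47 \<and> i < length (?F (a - 43)) then
      (case ?F (a - 43) ! i of Lit v \<Rightarrow> (0, 0) | Entry a' i' \<Rightarrow> (a', i')) else (a, i))"
  have *: "s' l = r' l"
    if "\<forall>x. s (Reg x) = \<rho> x" "\<forall>x. r (Reg x) = \<rho> x" "s (Cell (fst ?c) (snd ?c)) = r (Cell (fst ?c) (snd ?c))"
      "exec W (reduction q) s t s'" "exec W (reduction q) r u r'" for W s t s' r u r'
  proof -
    have s': "s' = reduction_store q s" "r' = reduction_store q r"
      using that exec_reduction by blast+
    show ?thesis
      using that(1-3) unfolding s' reduction_store_def Let_def
      by (auto split: loc.splits symbol.splits if_splits)
  qed
  show "\<exists>a i. \<forall>W s t s' r u r'.
      (\<forall>x. s (Reg x) = \<rho> x) \<and> (\<forall>x. r (Reg x) = \<rho> x) \<and> s (Cell a i) = r (Cell a i) \<and>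
      exec W (reduction q) s t s' \<and> exec W (reduction q) r u r' \<longrightarrow> s' l = r' l"
    by (intro exI[of _ "fst ?c"] exI[of _ "snd ?c"] allI impI) (elim conjE, rule *; assumption)
qed

text \<open>Register 43 is register 0 of the renamed EDSM program and holds the number of reported
  entries; any report at all means a triangle.\<close>

definition answer :: com where
  "answer = Const 0 0 ;; Op Less 0 0 43"

lemma exec_answer:
  assumes "1 < W"
  shows "exec W answer s 2 (s(Reg 0 := of_bool (0 < s (Reg 43))))"
proof -
  let ?s = "s(Reg 0 := 0)"
  have "exec W (Op Less 0 0 43) ?s 1 (?s(Reg 0 := of_bool (0 < s (Reg 43))))"
    using assms by (intro exec.Op) auto
  from exec.Seq[OF exec.Const this] show ?thesis
    unfolding answer_def using assms by (simp add: numeral_2_eq_2)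
qed

lemma projection_answer: "projection answer"
  unfolding projection_def
proof (intro allI)
  fix \<rho> :: "nat \<Rightarrow> nat" and l
  let ?c = "case l of Reg x \<Rightarrow> (0, 0) | Cell a i \<Rightarrow> (a, i)"
  have *: "s' l = r' l"
    if "\<forall>x. s (Reg x) = \<rho> x" "\<forall>x. r (Reg x) = \<rho> x" "s (Cell (fst ?c) (snd ?c)) = r (Cell (fst ?c) (snd ?c))"
      "exec W answer s t s'" "exec W answer r u r'" for W s t s' r u r'
  proof -
    have s': "s' = s(Reg 0 := of_bool (0 < s (Reg 43)))" "r' = r(Reg 0 := of_bool (0 < r (Reg 43)))"
      using exec_deterministic[OF that(4) exec_answer[of 2]] exec_deterministic[OF that(5) exec_answer[of 2]]
      by simp_all
    show ?thesis using that(1-3) unfolding s' by (auto split: loc.splits)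
  qed
  show "\<exists>a i. \<forall>W s t s' r u r'.
      (\<forall>x. s (Reg x) = \<rho> x) \<and> (\<forall>x. r (Reg x) = \<rho> x) \<and> s (Cell a i) = r (Cell a i) \<and>
      exec W answer s t s' \<and> exec W answer r u r' \<longrightarrow> s' l = r' l"
    by (intro exI[of _ "fst ?c"] exI[of _ "snd ?c"] allI impI) (elim conjE, rule *; assumption)
qed

lemma incremental_clear: "D \<ge> 1 \<Longrightarrow> incremental D (clear n)"
  by (induction n) auto

text \<open>The constants in the program are \<open>q\<close> and numbers up to the end marker 4,
  hence the bound \<open>q + 4\<close>.\<close>

lemma incremental_reduction: "incremental (q + 4) (reduction q)"
  unfolding reduction_def prepare_def write_pattern_def write_text_def write_marker_def write_padding_def
    write_entry1_def write_entry2_def write_entry3_def write_block_def write_segment_def write_filler_def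
    write_one_hot_def write_word_def write_set_def counted_def power_two_def double_def For_def Inc_def Push_def
    Copy_def Len_def
  by (simp add: incremental_clear del: clear.simps)

section \<open>Matrices in row-major order and the input seen by the subroutine\<close>

lemma concat_map_upt_nth:
  "i < m \<Longrightarrow> j < n \<Longrightarrow> concat (map (\<lambda>i. map (f i) [0..<n]) [0..<m]) ! (i * n + j) = f i j"
proof (induction m)
  case (Suc m)
  have len: "length (concat (map (\<lambda>i. map (f i) [0..<n]) [0..<m])) = m * n"
    by (simp add: length_concat comp_def sum_list_triv)
  show ?case
  proof (cases "i < m")
    case True
    have "i * n + j < Suc i * n" using Suc.prems by simp
    also have "\<dots> \<le> m * n" using True by (intro mult_le_mono1) simp
    finally show ?thesis using Suc True len by (simp add: nth_append)
  next
    case False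
    then have "i = m" using Suc.prems by simp
    then show ?thesis using Suc.prems len by (simp add: nth_append)
  qed
qed simp

lemma length_concat_mat_to_list: "A \<in> carrier_mat N N \<Longrightarrow> length (concat (mat_to_list A)) = N * N"
  by (auto simp: mat_to_list_def length_concat comp_def sum_list_triv)

lemma td_input_Cell:
  assumes "A \<in> carrier_mat N N" "B \<in> carrier_mat N N" "C \<in> carrier_mat N N" "i < N" "j < N"
  shows "td_input N A B C (Cell 0 (i * N + j)) = of_bool (A $$ (i, j))"
    "td_input N A B C (Cell 1 (i * N + j)) = of_bool (B $$ (i, j))"
    "td_input N A B C (Cell 2 (i * N + j)) = of_bool (C $$ (i, j))"
proof -
  have less: "i * N + j < N * N"
  proof -
    have "i * N + j < Suc i * N" using assms by simp
    also have "\<dots> \<le> N * N" using assms by (intro mult_le_mono1) simp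
    finally show ?thesis .
  qed
  have "nth_default 0 (map of_bool (concat (mat_to_list M))) (i * N + j) = (of_bool (M $$ (i, j)) :: nat)"
    if M: "M \<in> carrier_mat N N" for M
  proof -
    have "concat (mat_to_list M) ! (i * N + j) = M $$ (i, j)"
      using concat_map_upt_nth[OF assms(4,5), of "\<lambda>i j. M $$ (i, j)"] M by (auto simp: mat_to_list_def)
    then show ?thesis using less length_concat_mat_to_list[OF M] by (simp add: nth_default_def)
  qed
  then show "td_input N A B C (Cell 0 (i * N + j)) = of_bool (A $$ (i, j))"
    "td_input N A B C (Cell 1 (i * N + j)) = of_bool (B $$ (i, j))"
    "td_input N A B C (Cell 2 (i * N + j)) = of_bool (C $$ (i, j))"
    using assms by (simp_all add: td_input_def input_store_def nth_default_def)
qed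

lemma td_input_le: "l \<noteq> Reg 0 \<Longrightarrow> td_input N A B C l \<le> 1"
  by (cases l)
    (auto simp: td_input_def input_store_def nth_default_def less_Suc_eq numeral_eq_Suc split: if_splits)

lemma td_input_0: "td_input N A B C (Reg 0) = N"
  by (simp add: td_input_def input_store_def)

lemma td_input_eq_0: "3 \<le> a \<Longrightarrow> td_input N A B C (Cell a i) = 0" "0 < x \<Longrightarrow> td_input N A B C (Reg x) = 0"
  by (simp_all add: td_input_def input_store_def nth_default_def)

text \<open>43 is both the offset of the streams and the amount of renaming, so the subroutine sees
  stream lengths and streams as its registers and arrays 0 to 3. Elsewhere it sees 0, because a TD
  input fills only one register and three arrays; this matches the defaults of
  \<open>nth_default\<close>.\<close>

lemma shifted_reduction_store:
  assumes "s = td_input N A B C"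
  shows "shifted 43 (edsm_input (edsm_pattern (\<lambda>x. x) q N) (edsm_text (\<lambda>x. x) (\<lambda>a e. s (Cell a e)) q N))
    (reduction_store q s)"
proof -
  define P where "P = edsm_pattern Lit q N"
  define E where "E = edsm_text Lit Entry q N"
  define F where "F = reduction_out q N"
  let ?P = "edsm_pattern (\<lambda>x. x) q N" and ?E = "edsm_text (\<lambda>x. x) (\<lambda>a e. s (Cell a e)) q N"
  have id: "symbol_val s \<circ> Lit = (\<lambda>x. x)" by auto
  have P: "?P = map (symbol_val s) P"
    unfolding P_def edsm_pattern_def map_pattern id ..
  have E: "?E = map (map (map (symbol_val s))) E"
    unfolding E_def edsm_text_def map_ed_text id by simp
  have lens: "map length ?E = map length E" "map length (concat ?E) = map length (concat E)"
    "concat (concat ?E) = map (symbol_val s) (concat (concat E))" "length ?E = length E"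
    "length (concat ?E) = length (concat E)"
    unfolding E by (simp_all add: comp_def flip: map_concat)
  have F: "F 0 = P" "F 1 = map (\<lambda>X. Lit (length X)) E" "F 2 = map (\<lambda>w. Lit (length w)) (concat E)"
    "F 3 = concat (concat E)"
    by (simp_all add: F_def reduction_out_def join_def only_def sets_out_def words_out_def P_def E_def)
  have N: "s (Reg 0) = N" by (simp add: assms td_input_0)
  show ?thesis
    unfolding shifted_def
  proof (intro conjI allI)
    fix x :: nat
    have z: "s (Reg (x + 43)) = 0" by (simp add: assms td_input_eq_0)
    consider "x = 0" | "x = 1" | "x = 2" | "x = 3" | "4 \<le> x" by linarith
    then show "reduction_store q s (Reg (x + 43)) = edsm_input ?P ?E (Reg x)"
      unfolding reduction_store_def N F_def[symmetric] Let_def edsm_input_def input_store_def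
      by cases (use z in \<open>simp_all add: F F[unfolded One_nat_def] P lens nth_default_def\<close>)
  next
    fix a i :: nat
    have z: "s (Cell (a + 43) i) = 0" by (simp add: assms td_input_eq_0)
    consider "a = 0" | "a = 1" | "a = 2" | "a = 3" | "4 \<le> a" by linarith
    then show "reduction_store q s (Cell (a + 43) i) = edsm_input ?P ?E (Cell a i)"
      unfolding reduction_store_def N F_def[symmetric] Let_def edsm_input_def input_store_def
      by cases (use z in \<open>simp_all add: F F[unfolded One_nat_def] P lens nth_default_def\<close>)
  qed
qed

section \<open>Running time\<close>

lemma two_power_lg_le:
  assumes "1 \<le> N"
  shows "2 ^ lg N \<le> 2 * N"
proof (cases "lg N")
  case (Suc n)
  then have "2 ^ n < N" using two_power_less_iff by simp
  then show ?thesis using Suc by simp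
qed (use assms in simp)

lemma block_size_num_blocks: "block_size q N * num_blocks q N = 2 ^ lg N"
  unfolding block_size_def num_blocks_def by (simp flip: power_add)

lemma two_power_height: "2 ^ height q N = 2 ^ lg N * num_blocks q N * num_blocks q N"
  unfolding height_def num_blocks_def by (simp add: power_add mult_2)

lemma block_size_pos: "0 < block_size q N" "0 < num_blocks q N"
  by (simp_all add: block_size_def num_blocks_def)

text \<open>\<open>2 \<le> q\<close> gives \<open>g \<le> b\<close>, as at most half of the exponent
  \<open>lg N\<close> goes to \<open>g\<close>. The rest follows from
  \<open>b * g = 2 ^ lg N\<close> and \<open>2 ^ H = b * g * g * g\<close>.\<close>

lemma parameters:
  fixes q N :: nat
  assumes "2 \<le> q"
  defines "b \<equiv> block_size q N" and "g \<equiv> num_blocks q N" and "H \<equiv> height q N"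
  shows "N \<le> g * b" "g \<le> b" "N \<le> b * b" "2 ^ H \<le> b * b * g * g" "N * g * g \<le> 2 ^ H"
proof -
  have bg: "b * g = 2 ^ lg N" by (simp add: b_def g_def block_size_num_blocks)
  have "lg N div q \<le> lg N div 2" using assms(1) by (intro div_le_mono2) auto
  then show "g \<le> b" unfolding g_def b_def block_size_def num_blocks_def by simp
  show "N \<le> g * b" using le_two_power_lg[of N] bg by (simp add: mult.commute)
  also have "\<dots> \<le> b * b" using \<open>g \<le> b\<close> by simp
  finally show "N \<le> b * b" .
  have H: "2 ^ H = b * g * g * g" by (simp add: H_def two_power_height g_def[symmetric] bg)
  show "2 ^ H \<le> b * b * g * g" unfolding H using \<open>g \<le> b\<close> by simp
  show "N * g * g \<le> 2 ^ H" unfolding H using \<open>N \<le> g * b\<close> by (simp add: mult.commute)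
qed

text \<open>The cost of the padding: one factor for the number of levels, one for computing powers
  of two by increments at each level, and one for the letters of a level up to a constant.\<close>

definition main_term :: "nat \<Rightarrow> nat \<Rightarrow> nat" where
  "main_term q N = (height q N + 1) * (height q N + 1) * (2 ^ height q N * block_size q N)"

definition entry_term :: "nat \<Rightarrow> nat \<Rightarrow> nat" where
  "entry_term q N = N * N * block_size q N"

text \<open>With \<open>u = 2 ^ H * b\<close>, every summand is at most a multiple of
  \<open>u\<close> or \<open>H * u\<close>, and 227 = 14 + 86 + 87 + 40.\<close>

lemma padding_time_le:
  assumes "0 < b"
  shows "padding_time b H \<le> 227 * ((H + 1) * (2 ^ H * b))"
proof -
  define u where "u = 2 ^ H * b"
  have u: "(2::nat) ^ H \<le> u" "1 \<le> u" using assms by (simp_all add: u_def)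
  have "H * (6 * 2 ^ H + 8) \<le> H * (14 * u)" using u by (intro mult_le_mono2) simp
  then have "H * (6 * 2 ^ H + 8) \<le> 14 * (H * u)" by simp
  moreover have "2 ^ H * (86 * b + 87) = 86 * u + 87 * 2 ^ H" by (simp add: u_def algebra_simps)
  moreover have "227 * ((H + 1) * u) = 227 * (H * u) + 227 * u" by simp
  ultimately show ?thesis using u unfolding padding_time_def u_def[symmetric] by linarith
qed

lemma reduction_time_le:
  assumes "1 \<le> N"
  shows "reduction_time q N \<le> 1000 * (main_term q N + entry_term q N)"
proof -
  define b H where "b = block_size q N" and "H = height q N"
  define u where "u = 2 ^ H * b"
  define h where "h = H + 1"
  define Y where "Y = N * N * b"
  have b: "0 < b" by (simp add: b_def block_size_pos)
  have u: "(2::nat) ^ H \<le> u" "1 \<le> u" using b by (simp_all add: u_def)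
  have X: "h * u \<le> h * h * u" "u \<le> h * u" by (simp_all add: h_def)
  have X': "h \<le> h * u" using mult_le_mono2[OF u(2), of h] by simp
  have Y: "N * N \<le> Y" "1 \<le> N * N" using b assms by (simp_all add: Y_def)
  have Y1: "1 \<le> Y" using order_trans[OF Y(2,1)] .
  have N: "N \<le> N * N" using assms by simp
  have "2 ^ lg N \<le> 2 * N" using two_power_lg_le[OF assms] .
  then have "N * (6 * 2 ^ lg N + 18) \<le> N * (12 * N + 18)" by (intro mult_le_mono2) simp
  moreover have "N * (12 * N + 18) = 12 * (N * N) + 18 * N" by (simp add: algebra_simps)
  ultimately have 1: "N * (6 * 2 ^ lg N + 18) \<le> 30 * Y" using N Y by linarith
  have "N * (6 * N + 7) = 6 * (N * N) + 7 * N" by (simp add: algebra_simps)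
  then have 2: "N * (6 * N + 7) \<le> 13 * Y" using N Y by linarith
  define k where "k = lg N div q"
  have k: "k \<le> H" by (simp add: k_def H_def height_def)
  have "(2::nat) ^ k \<le> 2 ^ H" using k by simp
  then have "6 * 2 ^ k + 8 \<le> 14 * u" using u by linarith
  then have "k * (6 * 2 ^ k + 8) \<le> h * (14 * u)" using k by (intro mult_le_mono) (auto simp: h_def)
  then have 3: "k * (6 * 2 ^ k + 8) \<le> 14 * (h * u)" by simp
  have "H * (6 * 2 ^ H + 8) \<le> h * (14 * u)" using u by (intro mult_le_mono) (auto simp: h_def)
  then have 4: "H * (6 * 2 ^ H + 8) \<le> 14 * (h * u)" by simp
  have 5: "k * 8 \<le> 8 * (h * u)" using k X' h_def by linarith
  have "prepare_time q N = N * (6 * N + 7) + N * (6 * 2 ^ lg N + 18) + k * (6 * 2 ^ k + 8) + k * 8 + H * (6 * 2 ^ H + 8) + 40"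
    by (simp add: prepare_time_def Let_def k_def H_def height_def)
  then have 6: "prepare_time q N \<le> 43 * Y + 76 * (h * u)" using 1 2 3 4 5 u X X' by linarith
  have "2 ^ H * (86 * b + 70) = 86 * u + 70 * 2 ^ H" by (simp add: u_def algebra_simps)
  then have 7: "2 ^ H * (86 * b + 70) + 11 \<le> 167 * u" using u by linarith
  have "Suc H * (padding_time b H + 5) = h * padding_time b H + 5 * h" by (simp add: h_def algebra_simps)
  also have "h * padding_time b H \<le> h * (227 * (h * u))"
    using padding_time_le[OF b, of H] by (intro mult_le_mono2) (simp add: h_def u_def)
  finally have 8: "Suc H * (padding_time b H + 5) \<le> 227 * (h * h * u) + 5 * h" by (simp add: mult.assoc mult.left_commute)
  have "N * N * (38 * b + 40) = 38 * Y + 40 * (N * N)" by (simp add: Y_def algebra_simps)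
  then have 9: "N * N * (38 * b + 40) \<le> 78 * Y" using Y by linarith
  have *: "2 * (v + 3) + 3 * (w + 11) + 40 \<le> 464 * x + 300 * Y + 40"
    if "v \<le> 227 * x + 5 * h" "w \<le> 78 * Y" "h \<le> x" for v w x
    using that Y1 by simp
  have 10: "text_time b H N \<le> 464 * (h * h * u) + 300 * Y + 40"
    unfolding text_time_def by (rule *[OF 8 9 order_trans[OF X' X(1)]])
  \<comment> \<open>Since \<open>u \<le> y \<le> x\<close>, the coefficients of \<open>x\<close> add
    up to 76 + 167 + 464 = 707; those of \<open>Y\<close> to 431, including the constants 40 and 48,
    which are absorbed by \<open>1 \<le> Y\<close>.\<close>
  have **: "r + s + t + 48 \<le> 1000 * (x + Y)"
    if "r \<le> 43 * Y + 76 * y" "s \<le> 167 * u" "t \<le> 464 * x + 300 * Y + 40" "y \<le> x" "u \<le> y" for r s t x y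
    using that Y1 by simp
  have "reduction_time q N \<le> 1000 * (h * h * u + Y)"
    unfolding reduction_time_def b_def[symmetric] H_def[symmetric] by (rule **[OF 6 7 10 X])
  then show ?thesis by (simp add: main_term_def entry_term_def b_def H_def u_def h_def Y_def)
qed

lemma pattern_length_le: "length (edsm_pattern f q N) \<le> 16 * (2 ^ height q N * block_size q N)"
proof -
  define b H where "b = block_size q N" and "H = height q N"
  have "0 < b" by (simp add: b_def block_size_pos)
  then have "(2::nat) ^ H \<le> 2 ^ H * b" "1 \<le> 2 ^ H * b" by simp_all
  moreover have "2 ^ H * (11 * b + 3) = 11 * (2 ^ H * b) + 3 * 2 ^ H" by (simp add: algebra_simps)
  ultimately show ?thesis
    unfolding edsm_pattern_def length_pattern b_def[symmetric] H_def[symmetric] by linarith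
qed

lemma text_length_le:
  assumes "1 \<le> N"
  shows "length (concat (concat (edsm_text f M q N))) \<le> 30 * (main_term q N + entry_term q N)"
proof -
  define b H where "b = block_size q N" and "H = height q N"
  define u where "u = 2 ^ H * b"
  define h where "h = H + 1"
  define Y where "Y = N * N * b"
  have b: "0 < b" by (simp add: b_def block_size_pos)
  have u: "(2::nat) ^ H \<le> u" "1 \<le> u" using b by (simp_all add: u_def)
  have X: "h * u \<le> h * h * u" "u \<le> h * u" by (use u in \<open>simp_all add: h_def\<close>)
  have Y: "N * N \<le> Y" using b by (simp add: Y_def)
  have "2 ^ H * (11 * b + 3) = 11 * u + 3 * 2 ^ H" by (simp add: u_def algebra_simps)
  then have "h * (2 ^ H * (11 * b + 3)) \<le> h * (14 * u)" using u by (intro mult_le_mono2) linarith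
  moreover define P where "P = h * (2 ^ H * (11 * b + 3))"
  ultimately have P: "P \<le> 14 * (h * u)" by simp
  define Q where "Q = N * N * (13 * b + 3)"
  have "Q = 13 * Y + 3 * (N * N)" by (simp add: Q_def Y_def algebra_simps)
  then have Q: "Q \<le> 16 * Y" using Y by linarith
  have "length (concat (concat (edsm_text f M q N))) \<le> 2 + 2 * h * (2 ^ H * (11 * b + 3)) + N * N * (13 * b + 3)"
    unfolding edsm_text_def b_def h_def H_def
    using length_concat_ed_text(2)[OF block_size_pos(1)] by simp
  also have "\<dots> = 2 + 2 * P + Q" by (simp add: P_def Q_def)
  also have "\<dots> \<le> 30 * (h * h * u) + 30 * Y" using P Q X u(2) by linarith
  also have "\<dots> = 30 * (h * h * u + Y)" by simp
  finally show ?thesis by (simp add: main_term_def entry_term_def b_def H_def u_def h_def Y_def)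
qed

text \<open>Two roundings occur: \<open>lg\<close> rounds up, which can only enlarge the number, and
  \<open>div\<close> rounds down, which can only diminish it. Each moves the exponent of 2 by at
  most 1 and so costs at most a factor 2.\<close>

lemma num_blocks_bounds:
  assumes "2 \<le> q" "1 \<le> N"
  shows "real (num_blocks q N) \<le> 2 * real N powr (1 / real q)"
    "real N powr (1 / real q) \<le> 2 * real (num_blocks q N)"
proof -
  define l k where "l = lg N" and "k = l div q"
  have q: "0 < real q" using assms by simp
  have g: "real (num_blocks q N) = 2 powr real k"
    by (simp add: num_blocks_def l_def k_def powr_realpow)
  have l: "(2 powr real l) powr (1 / real q) = 2 powr (real l / real q)" by (simp add: powr_powr)
  have "real k \<le> real l / real q" unfolding k_def by (rule of_nat_div_le_of_nat)
  then have "2 powr real k \<le> (2 powr real l) powr (1 / real q)" unfolding l by simp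
  also have "\<dots> \<le> (2 * real N) powr (1 / real q)"
  proof (rule powr_mono2)
    have "real (2 ^ l) \<le> real (2 * N)" unfolding l_def using two_power_lg_le[OF assms(2)] of_nat_le_iff by blast
    then show "2 powr real l \<le> 2 * real N" by (simp add: powr_realpow)
  qed (use q in auto)
  also have "\<dots> = 2 powr (1 / real q) * real N powr (1 / real q)" by (simp add: powr_mult)
  also have "\<dots> \<le> 2 * real N powr (1 / real q)"
  proof (rule mult_right_mono)
    have "2 powr (1 / real q) \<le> 2 powr (1::real)" using assms by (intro powr_mono) auto
    then show "2 powr (1 / real q) \<le> 2" by simp
  qed simp
  finally show "real (num_blocks q N) \<le> 2 * real N powr (1 / real q)" unfolding g .
  have "real N powr (1 / real q) \<le> (2 powr real l) powr (1 / real q)"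
  proof (rule powr_mono2)
    have "real N \<le> real (2 ^ l)" unfolding l_def using le_two_power_lg[of N] of_nat_le_iff by blast
    then show "real N \<le> 2 powr real l" by (simp add: powr_realpow)
  qed (use q in auto)
  also have "\<dots> \<le> 2 powr (real k + 1)"
    unfolding l
  proof (rule powr_mono)
    have "l < (k + 1) * q" unfolding k_def using assms
      by (metis Suc_eq_plus1 dividend_less_times_div less_le_trans mult.commute mult_Suc_right pos2)
    then have "real l < real ((k + 1) * q)" by (simp only: of_nat_less_iff)
    then show "real l / real q \<le> real k + 1" using q by (simp add: divide_le_eq algebra_simps)
  qed simp
  finally show "real N powr (1 / real q) \<le> 2 * real (num_blocks q N)" unfolding g by (simp add: powr_add)
qed

text \<open>Logarithms are traded for an arbitrarily small power of \<open>N\<close> through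
  \<open>ln x \<le> x powr \<delta> / \<delta>\<close>; this absorbs the logarithmic factors in all
  the time bounds.\<close>

lemma height_bound:
  assumes "0 < \<delta>" "2 \<le> q" "1 \<le> N"
  shows "real (height q N + 1) \<le> (4 + 3 / (\<delta> * ln 2)) * real N powr \<delta>"
proof -
  have N: "1 \<le> real N" using assms by simp
  have "lg N div q \<le> lg N" by simp
  then have "height q N + 1 \<le> 3 * lg N + 1" unfolding height_def by linarith
  then have 1: "real (height q N + 1) \<le> 3 * real (lg N) + 1" using of_nat_le_iff[where 'a = real] by fastforce
  have "real (2 ^ lg N) \<le> real (2 * N)" using two_power_lg_le[OF assms(3)] of_nat_le_iff by blast
  then have "ln (2 ^ lg N) \<le> ln (2 * real N)" using assms by (subst ln_le_cancel_iff) auto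
  then have "real (lg N) * ln 2 \<le> ln 2 + ln (real N)" using N by (simp add: ln_realpow ln_mult)
  also have "ln (real N) \<le> real N powr \<delta> / \<delta>" by (rule ln_powr_bound[OF N assms(1)])
  finally have "real (lg N) \<le> (ln 2 + real N powr \<delta> / \<delta>) / ln 2" by (simp add: le_divide_eq)
  also have "\<dots> = 1 + real N powr \<delta> / (\<delta> * ln 2)" by (simp add: add_divide_distrib)
  finally have "real (height q N + 1) \<le> 4 + 3 / (\<delta> * ln 2) * real N powr \<delta>" using 1 by simp
  moreover have "4 \<le> 4 * real N powr \<delta>" using N assms(1) by (simp add: ge_one_powr_ge_zero)
  ultimately show ?thesis by (simp add: distrib_right)
qed

text \<open>\<open>2 ^ H * b\<close> equals \<open>2 ^ lg N * (b * g) * g\<close>, and each of these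
  three factors is within a factor 2 of its ideal value, whence 8. For the entries, dividing
  \<open>b * g \<le> 2 * N\<close> by the lower bound on \<open>g\<close> costs another 2, whence
  4.\<close>

lemma size_bounds:
  assumes q: "2 \<le> q" and N: "1 \<le> N"
  shows "real (2 ^ height q N * block_size q N) \<le> 8 * real N powr (2 + 1 / real q)"
    "real (entry_term q N) \<le> 4 * real N powr (3 - 1 / real q)"
proof -
  define x where "x = real N powr (1 / real q)"
  define g b where "g = real (num_blocks q N)" and "b = real (block_size q N)"
  have x: "0 < x" using N by (simp add: x_def)
  have g: "g \<le> 2 * x" "x \<le> 2 * g" using num_blocks_bounds[OF q N] by (simp_all add: g_def x_def)
  have l: "real (2 ^ lg N) \<le> 2 * real N"
    using two_power_lg_le[OF N] by (metis of_nat_le_iff of_nat_mult of_nat_numeral)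
  have bg: "b * g = real (2 ^ lg N)" unfolding b_def g_def of_nat_mult[symmetric] block_size_num_blocks ..
  have sq: "real N * real N = real N powr 2" using N by (simp add: powr_numeral power2_eq_square)
  have "real (2 ^ height q N * block_size q N) = real (2 ^ lg N) * (b * g) * g"
    unfolding two_power_height by (simp add: g_def b_def mult_ac)
  also have "\<dots> \<le> (2 * real N) * (2 * real N) * (2 * x)"
    unfolding bg using l g(1) by (intro mult_mono) (auto simp: g_def)
  also have "\<dots> = 8 * (real N powr 2 * x)" by (simp flip: sq)
  also have "\<dots> = 8 * real N powr (2 + 1 / real q)" by (simp add: x_def powr_add)
  finally show "real (2 ^ height q N * block_size q N) \<le> 8 * real N powr (2 + 1 / real q)" .
  have "b * x \<le> b * (2 * g)" using g(2) by (intro mult_left_mono) (auto simp: b_def)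
  also have "\<dots> \<le> 4 * real N" using bg l by simp
  finally have "b \<le> 4 * real N / x" using x by (simp add: le_divide_eq)
  then have "real N * real N * b \<le> real N * real N * (4 * real N / x)" by (intro mult_left_mono) auto
  also have "\<dots> = 4 * (real N powr 3 / x)" using N by (simp add: powr_numeral power3_eq_cube)
  also have "\<dots> = 4 * real N powr (3 - 1 / real q)" by (simp add: x_def powr_diff)
  finally show "real (entry_term q N) \<le> 4 * real N powr (3 - 1 / real q)"
    by (simp add: entry_term_def b_def)
qed

text \<open>As \<open>1 / q = 4 * \<delta>\<close>, the three exponents are
  \<open>2 + 6 * \<delta>\<close>, \<open>3 - 4 * \<delta>\<close> and \<open>\<delta> + (2 + 4 *
  \<delta>) * (1.5 - 4 * \<delta>) = 3 - \<delta> - 16 * \<delta> * \<delta>\<close>. All are at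
  most \<open>3 - \<delta>\<close>, the first because \<open>2 \<le> q\<close> gives
  \<open>\<delta> \<le> 1 / 8\<close>.\<close>

lemma subcubic_bounds:
  fixes q :: nat
  assumes q: "2 \<le> q"
  defines "\<delta> \<equiv> 1 / (4 * real q)"
  shows "\<exists>C\<ge>0. \<forall>N\<ge>1. real (main_term q N) \<le> C * real N powr (3 - \<delta>) \<and>
    real (entry_term q N) \<le> C * real N powr (3 - \<delta>) \<and>
    real (2 * height q N + 7) * real (length (edsm_pattern (\<lambda>x. x) q N)) powr (1.5 - 1 / real q) \<le> C * real N powr (3 - \<delta>)"
proof -
  have \<delta>: "0 < \<delta>" "\<delta> \<le> 1 / 8" using q by (auto simp: \<delta>_def field_simps)
  have q4: "1 / real q = 4 * \<delta>" by (simp add: \<delta>_def)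
  define K where "K = 4 + 3 / (\<delta> * ln 2)"
  have K: "0 \<le> K" using \<delta> by (simp add: K_def)
  define C where "C = K * K * 8 + 4 + 7 * K * 128 powr 1.5"
  have C: "K * K * 8 \<le> C" "4 \<le> C" "7 * K * 128 powr 1.5 \<le> C" "0 \<le> C" using K by (simp_all add: C_def)
  have "real (main_term q N) \<le> C * real N powr (3 - \<delta>) \<and> real (entry_term q N) \<le> C * real N powr (3 - \<delta>) \<and>
    real (2 * height q N + 7) * real (length (edsm_pattern (\<lambda>x. x) q N)) powr (1.5 - 1 / real q) \<le> C * real N powr (3 - \<delta>)"
    if N: "1 \<le> N" for N
  proof (intro conjI)
    have N1: "1 \<le> real N" using N by simp
    have mono: "c * real N powr a \<le> C * real N powr (3 - \<delta>)" if "c \<le> C" "a \<le> 3 - \<delta>" for c a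
      using that C(4) N1 by (intro mult_mono powr_mono) auto
    define h where "h = real (height q N + 1)"
    have h: "h \<le> K * real N powr \<delta>" "0 \<le> h" using height_bound[OF \<delta>(1) q N] by (simp_all add: h_def K_def)
    define u where "u = real (2 ^ height q N * block_size q N)"
    have u: "u \<le> 8 * real N powr (2 + 4 * \<delta>)" "0 \<le> u" using size_bounds(1)[OF q N] q4 by (simp_all add: u_def)
    have "real (main_term q N) = h * h * u" unfolding main_term_def h_def u_def of_nat_mult ..
    also have "\<dots> \<le> (K * real N powr \<delta>) * (K * real N powr \<delta>) * (8 * real N powr (2 + 4 * \<delta>))"
      using h u K by (intro mult_mono) auto
    also have "\<dots> = K * K * 8 * (real N powr \<delta> * real N powr \<delta> * real N powr (2 + 4 * \<delta>))" by simp
    also have "real N powr \<delta> * real N powr \<delta> * real N powr (2 + 4 * \<delta>) = real N powr (2 + 6 * \<delta>)"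
      by (simp add: algebra_simps flip: powr_add)
    also have "K * K * 8 * real N powr (2 + 6 * \<delta>) \<le> C * real N powr (3 - \<delta>)"
      using C(1) \<delta> by (intro mono) auto
    finally show "real (main_term q N) \<le> C * real N powr (3 - \<delta>)" .
    have "real (entry_term q N) \<le> 4 * real N powr (3 - 4 * \<delta>)" using size_bounds(2)[OF q N] q4 by simp
    also have "\<dots> \<le> C * real N powr (3 - \<delta>)" using C(2) \<delta> by (intro mono) auto
    finally show "real (entry_term q N) \<le> C * real N powr (3 - \<delta>)" .
    define m where "m = real (length (edsm_pattern (\<lambda>x. x) q N))"
    define e where "e = 1.5 - 4 * \<delta>"
    have e: "0 \<le> e" "e \<le> 1.5" using \<delta> by (simp_all add: e_def)
    have "m \<le> real (16 * (2 ^ height q N * block_size q N))"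
      unfolding m_def using pattern_length_le of_nat_le_iff by blast
    then have "m \<le> 16 * u" by (simp add: u_def)
    then have "m \<le> 128 * real N powr (2 + 4 * \<delta>)" using u by simp
    then have "m powr e \<le> (128 * real N powr (2 + 4 * \<delta>)) powr e"
      using e by (intro powr_mono2) (auto simp: m_def)
    also have "\<dots> = 128 powr e * real N powr ((2 + 4 * \<delta>) * e)" by (simp add: powr_mult powr_powr)
    also have "\<dots> \<le> 128 powr 1.5 * real N powr (3 - 2 * \<delta>)"
    proof (intro mult_mono powr_mono)
      have "(2 + 4 * \<delta>) * e = 3 - 2 * \<delta> - 16 * \<delta> * \<delta>" by (simp add: e_def algebra_simps)
      then show "(2 + 4 * \<delta>) * e \<le> 3 - 2 * \<delta>" using \<delta> by simp
    qed (use e N1 in auto)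
    finally have m: "m powr e \<le> 128 powr 1.5 * real N powr (3 - 2 * \<delta>)" .
    have "real (2 * height q N + 7) \<le> 7 * h" by (simp add: h_def)
    then have "real (2 * height q N + 7) \<le> 7 * (K * real N powr \<delta>)" using h by linarith
    then have "real (2 * height q N + 7) * m powr e \<le> 7 * (K * real N powr \<delta>) * (128 powr 1.5 * real N powr (3 - 2 * \<delta>))"
      using m K by (intro mult_mono) auto
    also have "\<dots> = 7 * K * 128 powr 1.5 * (real N powr \<delta> * real N powr (3 - 2 * \<delta>))" by simp
    also have "real N powr \<delta> * real N powr (3 - 2 * \<delta>) = real N powr (3 - \<delta>)" by (simp flip: powr_add)
    also have "7 * K * 128 powr 1.5 * real N powr (3 - \<delta>) \<le> C * real N powr (3 - \<delta>)"
      using C(3) by (intro mono) auto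
    finally show "real (2 * height q N + 7) * real (length (edsm_pattern (\<lambda>x. x) q N)) powr (1.5 - 1 / real q) \<le> C * real N powr (3 - \<delta>)"
      unfolding q4 e_def m_def .
  qed
  then show ?thesis using C(4) by blast
qed

section \<open>Triangle detection\<close>

text \<open>A word bound is a power of \<open>N * N + 2\<close> with fixed exponent, so constant
  factors must move into the exponent: \<open>c < 2 ^ c \<le> (N * N + 2) ^ c\<close>.\<close>

lemma polynomial_bound:
  fixes f :: "nat \<Rightarrow> nat"
  assumes "\<And>N. 1 \<le> N \<Longrightarrow> real (f N) \<le> C * real N powr 3"
  shows "\<exists>j. \<forall>N\<ge>1. f N < (N * N + 2) ^ j"
proof (intro exI allI impI)
  fix N :: nat assume N: "1 \<le> N"
  define c where "c = nat \<lceil>C\<rceil>"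
  have "C \<le> real c" unfolding c_def by (rule real_nat_ceiling_ge)
  then have "C * real N powr 3 \<le> real c * real N powr 3" by (intro mult_right_mono) auto
  with assms[OF N] have "real (f N) \<le> real c * real N powr 3" by (rule order_trans)
  also have "\<dots> = real (c * N ^ 3)" using N by (simp add: powr_numeral)
  finally have "real (f N) \<le> real (c * N ^ 3)" .
  then have "f N \<le> c * N ^ 3" by (simp only: of_nat_le_iff)
  also have "\<dots> < 2 ^ c * (N * N + 2) ^ 2"
  proof (rule mult_strict_mono')
    have "N ^ 3 \<le> (N * N) * (N * N)" using N by (simp add: power3_eq_cube)
    also have "\<dots> < (N * N + 2) ^ 2" by (simp add: power2_eq_square mult_strict_mono')
    finally show "N ^ 3 < (N * N + 2) ^ 2" .
  qed (auto simp: less_exp)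
  also have "\<dots> \<le> (N * N + 2) ^ c * (N * N + 2) ^ 2"
    by (intro mult_right_mono power_mono) auto
  finally show "f N < (N * N + 2) ^ (c + 2)" by (simp only: power_add)
qed

lemma triangle_in_td_input:
  assumes "A \<in> carrier_mat N N" "B \<in> carrier_mat N N" "C \<in> carrier_mat N N"
  shows "(\<exists>i<N. \<exists>j<N. \<exists>k<N. td_input N A B C (Cell 0 (i * N + j)) = 1 \<and>
      td_input N A B C (Cell 1 (j * N + k)) = 1 \<and> td_input N A B C (Cell 2 (k * N + i)) = 1) \<longleftrightarrow>
    has_triangle N A B C"
proof -
  have "td_input N A B C (Cell 0 (i * N + j)) = 1 \<and> td_input N A B C (Cell 1 (j * N + k)) = 1 \<and>
      td_input N A B C (Cell 2 (k * N + i)) = 1 \<longleftrightarrow> A $$ (i, j) \<and> B $$ (j, k) \<and> C $$ (k, i)"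
    if "i < N" "j < N" "k < N" for i j k
    unfolding td_input_Cell(1)[OF assms that(1,2)] td_input_Cell(2)[OF assms that(2,3)]
      td_input_Cell(3)[OF assms that(3,1)] by simp
  then show ?thesis unfolding has_triangle_def by blast
qed

theorem theorem1:
  fixes combinatorial :: "com \<Rightarrow> bool"
  assumes closed: "projection_closed combinatorial"
    and edsm: "\<exists>\<epsilon>>0. \<forall>\<sigma>. \<exists>p. combinatorial p \<and>
      solves_EDSM \<sigma> (\<lambda>m n N. real n * real m powr (1.5 - \<epsilon>) + real N) p"
  shows "\<exists>p. combinatorial p \<and> truly_subcubic_TD p"
proof -
  \<comment> \<open>The instance uses the letters 0 to 4 only, so the assumption is taken at
    alphabet size 5.\<close>
  obtain \<epsilon> p where \<epsilon>: "0 < \<epsilon>" and p: "combinatorial p"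
    and solves: "solves_EDSM 5 (\<lambda>m n N. real n * real m powr (1.5 - \<epsilon>) + real N) p"
    using edsm by blast
  obtain c k where edsm: "\<And>P T E. P \<in> lists {..<5} \<and> P \<noteq> [] \<and> ed_string {..<5} T \<and> length P \<le> ed_size T \<and> enumerates E T \<Longrightarrow>
      \<exists>t s. exec (word_bound k (length T + ed_size T)) p (edsm_input P E) t s \<and>
        real t \<le> c * (real (length T) * real (length P) powr (1.5 - \<epsilon>) + real (ed_size T)) \<and>
        reported s = occurrence_ends P T"
    using solves unfolding solves_EDSM_def by blast
  \<comment> \<open>This gives \<open>1 / q \<le> \<epsilon>\<close>, so the assumed time bound is
    good enough for the exponent \<open>1.5 - 1 / q\<close>, and \<open>2 \<le> q\<close>, as
    \<open>parameters\<close> requires.\<close>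
  define q where "q = max 2 (nat \<lceil>1 / \<epsilon>\<rceil>)"
  have q: "2 \<le> q" by (simp add: q_def)
  have "1 / \<epsilon> \<le> real q" unfolding q_def using real_nat_ceiling_ge[of "1 / \<epsilon>"] by simp
  then have q_\<epsilon>: "1 / real q \<le> \<epsilon>" using \<epsilon> q by (simp add: divide_le_eq mult.commute)
  define \<delta> where "\<delta> = 1 / (4 * real q)"
  have \<delta>: "0 < \<delta>" "\<delta> < 1" using q by (simp_all add: \<delta>_def)
  obtain K where K: "0 \<le> K" and bounds: "\<And>N. 1 \<le> N \<Longrightarrow> real (main_term q N) \<le> K * real N powr (3 - \<delta>) \<and>
    real (entry_term q N) \<le> K * real N powr (3 - \<delta>) \<and>
    real (2 * height q N + 7) * real (length (edsm_pattern (\<lambda>x. x) q N)) powr (1.5 - 1 / real q) \<le> K * real N powr (3 - \<delta>)"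
    using subcubic_bounds[OF q] unfolding \<delta>_def by blast
  define sz where "sz N = 30 * (main_term q N + entry_term q N)" for N
  \<comment> \<open>Collects what words must accommodate: initial values and constants, at most
    \<open>N + q + 4\<close>, plus the time of the reduction, and the base
    \<open>length T + ed_size T + 2\<close> of the word bound of \<open>p\<close>.\<close>
  define f where "f N = N + q + 5 + reduction_time q N + (2 * height q N + 7) + sz N + 2" for N
  have f: "real (f N) \<le> (13 + real q + 2062 * K) * real N powr 3" if N: "1 \<le> N" for N
  proof -
    have N3: "real N powr (3 - \<delta>) \<le> real N powr 3" "1 \<le> real N powr 3" "real N \<le> real N powr 3"
    proof -
      show "real N powr (3 - \<delta>) \<le> real N powr 3" using N \<delta> by (intro powr_mono) auto
      show "1 \<le> real N powr 3" using N by (simp add: ge_one_powr_ge_zero)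
      show "real N \<le> real N powr 3" using N powr_mono[of 1 3 "real N"] by simp
    qed
    have "K * real N powr (3 - \<delta>) \<le> K * real N powr 3" using N3 K by (intro mult_left_mono) auto
    then have mt: "real (main_term q N) \<le> K * real N powr 3" "real (entry_term q N) \<le> K * real N powr 3"
      using bounds[OF N] by linarith+
    have "1 * 1 \<le> 2 ^ height q N * block_size q N" using block_size_pos(1)[of q N] by (intro mult_le_mono) auto
    then have "(height q N + 1) * 1 * 1 \<le> (height q N + 1) * (height q N + 1) * (2 ^ height q N * block_size q N)"
      by (intro mult_le_mono) auto
    then have "height q N + 1 \<le> main_term q N" by (simp add: main_term_def)
    then have "f N \<le> N + q + 12 + 1032 * main_term q N + 1030 * entry_term q N"
      using reduction_time_le[OF N, of q] unfolding f_def sz_def by simp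
    then have "real (f N) \<le> real (N + q + 12 + 1032 * main_term q N + 1030 * entry_term q N)"
      by (simp only: of_nat_le_iff)
    moreover have "real q \<le> real q * real N powr 3" using N3(2) mult_left_mono[of 1 "real N powr 3" "real q"] by simp
    moreover define X where "X = real N powr 3"
    ultimately show ?thesis using mt N3(2,3) unfolding distrib_right X_def[symmetric] by simp
  qed
  obtain j where j: "\<And>N. 1 \<le> N \<Longrightarrow> f N < (N * N + 2) ^ j" using polynomial_bound[of f, OF f] by blast
  define prog where "prog = Seq (reduction q) (Seq (shift 43 p) answer)"
  \<comment> \<open>\<open>(N * N + 2) ^ j\<close> exceeds \<open>f N\<close>; its
    \<open>k\<close>-th power covers the word bound of \<open>p\<close>, and one further factor
    covers the reduction.\<close>
  define k' where "k' = j * (k + 1)"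
  \<comment> \<open>\<open>2000 * K\<close> pays for the reduction, 2 for \<open>answer\<close>, and
    \<open>61 * K\<close> for \<open>p\<close>: 60 for the size of the text and 1 for the pattern
    term. The sign of \<open>c\<close> is unknown, hence \<open>max c 0\<close>.\<close>
  define c' where "c' = 2000 * K + 2 + max c 0 * (61 * K)"
  have "\<exists>t s. exec (word_bound k' (N * N)) prog (td_input N A B C) t s \<and> real t \<le> c' * real N powr (3 - \<delta>) \<and>
      s (Reg 0) = of_bool (has_triangle N A B C)"
    if N: "1 \<le> N" and ABC: "A \<in> carrier_mat N N" "B \<in> carrier_mat N N" "C \<in> carrier_mat N N" for N A B C
  proof -
    define W where "W = word_bound k' (N * N)"
    define M where "M a e = td_input N A B C (Cell a e)" for a e
    define P where "P = edsm_pattern (\<lambda>x. x) q N"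
    define E where "E = edsm_text (\<lambda>x. x) M q N"
    define T where "T = map set E"
    note par = parameters[OF q, of N]
    have M: "M a e < 2" for a e using td_input_le[of "Cell a e" N A B C] by (simp add: M_def)
    have enum: "enumerates E T"
      unfolding E_def T_def edsm_text_def using M par block_size_pos by (intro enumerates_ed_text)
    have ed: "ed_string {..<5} T"
      unfolding E_def T_def edsm_text_def using M N by (intro ed_string_ed_text) auto
    have size: "ed_size T = length (concat (concat E))" by (rule ed_size_enumerates[OF enum])
    have "ed_size T \<le> sz N" unfolding size E_def sz_def by (rule text_length_le[OF N])
    have lenT: "length T = 2 * height q N + 7" by (simp add: T_def E_def edsm_text_def length_ed_text)
    have lenP: "length P \<le> ed_size T"
      unfolding size P_def E_def edsm_pattern_def edsm_text_def
      by (rule length_concat_ed_text(1)[OF block_size_pos(1)])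
    have P: "P \<in> lists {..<5}" "P \<noteq> []"
      using set_blocks unfolding P_def edsm_pattern_def pattern_def by (fastforce simp: lists_eq_set)+
    obtain t2 s2 where run2: "exec (word_bound k (length T + ed_size T)) p (edsm_input P E) t2 s2"
      and t2: "real t2 \<le> c * (real (length T) * real (length P) powr (1.5 - \<epsilon>) + real (ed_size T))"
      and rep: "reported s2 = occurrence_ends P T"
      using edsm P ed lenP enum by blast
    obtain t1 where run1: "runs (reduction q) (td_input N A B C) t1 (reduction_store q (td_input N A B C))"
      and t1: "t1 \<le> reduction_time q N"
      using runs_reduction[of q "td_input N A B C"] by (auto simp: td_input_0)
    have fW: "f N < (N * N + 2) ^ j" by (rule j[OF N])
    have W: "W = ((N * N + 2) ^ j) ^ k * (N * N + 2) ^ j"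
      by (simp add: W_def word_bound_def k'_def flip: power_mult power_add)
    have pos: "1 \<le> ((N * N + 2) ^ j) ^ k" "1 \<le> (N * N + 2) ^ j" by (simp_all add: Suc_leI)
    have W1: "(N * N + 2) ^ j \<le> W" unfolding W using mult_le_mono1[OF pos(1)] by simp
    have W2: "word_bound k (length T + ed_size T) \<le> W"
    proof -
      have "length T + ed_size T + 2 \<le> f N" using lenT \<open>ed_size T \<le> sz N\<close> by (simp add: f_def)
      then have "(length T + ed_size T + 2) ^ k \<le> ((N * N + 2) ^ j) ^ k" using fW by (intro power_mono) auto
      also have "\<dots> \<le> W" unfolding W using mult_le_mono2[OF pos(2)] by simp
      finally show ?thesis by (simp add: word_bound_def)
    qed
    have "td_input N A B C l \<le> N + q + 4" for l
      using td_input_le[of l N A B C] td_input_0[of N A B C] by (cases "l = Reg 0") auto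
    moreover obtain W' where "exec W' (reduction q) (td_input N A B C) t1 (reduction_store q (td_input N A B C))"
      using run1 unfolding runs_def by blast
    moreover have "td_input N A B C (Reg 40) \<le> 1" by (rule td_input_le) simp
    moreover have "N + q + 4 + t1 < W" using fW W1 t1 unfolding f_def by linarith
    \<comment> \<open>The bound \<open>W'\<close> of the run at hand is arbitrary;
      \<open>exec_incremental\<close> moves the run to \<open>W\<close>.\<close>
    ultimately have exec1: "exec W (reduction q) (td_input N A B C) t1 (reduction_store q (td_input N A B C))"
      using exec_incremental[OF _ incremental_reduction] by fastforce
    have "shifted 43 (edsm_input P E) (reduction_store q (td_input N A B C))"
      unfolding P_def E_def M_def by (rule shifted_reduction_store) simp
    from exec_shift[OF exec_mono[OF run2 W2] this] obtain r2
      where exec2: "exec W (shift 43 p) (reduction_store q (td_input N A B C)) t2 r2" and r2: "shifted 43 s2 r2"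
      by blast
    have "1 < W" using fW W1 unfolding f_def by linarith
    note exec3 = exec_answer[OF this, of r2]
    define s3 where "s3 = r2(Reg 0 := of_bool (0 < r2 (Reg 43)))"
    have run: "exec W prog (td_input N A B C) (t1 + (t2 + 2)) s3"
      unfolding prog_def s3_def by (rule exec.Seq[OF exec1 exec.Seq[OF exec2 exec3]])
    \<comment> \<open>Which positions are reported does not matter for the decision, only whether
      there are any.\<close>
    have "0 < r2 (Reg 43) \<longleftrightarrow> reported s2 \<noteq> {}"
    proof -
      have "r2 (Reg 43) = s2 (Reg 0)" using r2 unfolding shifted_def by (metis add_0)
      then show ?thesis by (auto simp: reported_def)
    qed
    also have "\<dots> \<longleftrightarrow> has_triangle N A B C"
      unfolding rep P_def T_def E_def edsm_pattern_def edsm_text_def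
      using occurrence_iff_triangle[where M = M, OF M par(3,1,5)] triangle_in_td_input[OF ABC]
      unfolding M_def by simp
    finally have result: "s3 (Reg 0) = of_bool (has_triangle N A B C)" by (simp add: s3_def)
    define X where "X = real N powr (3 - \<delta>)"
    have X: "1 \<le> X" using N \<delta> by (simp add: X_def ge_one_powr_ge_zero)
    note b = bounds[OF N, folded X_def]
    have "real t1 \<le> real (1000 * (main_term q N + entry_term q N))"
      using t1 reduction_time_le[OF N, of q] by (simp only: of_nat_le_iff)
    then have t1': "real t1 \<le> 2000 * K * X" using b by simp
    have "real (ed_size T) \<le> real (sz N)" using \<open>ed_size T \<le> sz N\<close> by simp
    then have "real (ed_size T) \<le> 60 * K * X" using b by (simp add: sz_def)
    moreover have "real (length T) * real (length P) powr (1.5 - \<epsilon>) \<le> K * X"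
    proof -
      \<comment> \<open>With a base of at least 1, passing from \<open>\<epsilon>\<close> to the
        possibly smaller \<open>1 / q\<close> cannot decrease the power, whatever the sign of
        \<open>1.5 - \<epsilon>\<close>.\<close>
      have "1 \<le> real (length P)" using P(2) by (simp add: Suc_leI)
      then have "real (length P) powr (1.5 - \<epsilon>) \<le> real (length P) powr (1.5 - 1 / real q)"
        using q_\<epsilon> by (intro powr_mono) auto
      then have "real (length T) * real (length P) powr (1.5 - \<epsilon>) \<le>
          real (length T) * real (length P) powr (1.5 - 1 / real q)" by (intro mult_left_mono) auto
      also have "\<dots> \<le> K * X" using b unfolding lenT P_def by blast
      finally show ?thesis .
    qed
    ultimately have sum: "real (length T) * real (length P) powr (1.5 - \<epsilon>) + real (ed_size T) \<le> 61 * K * X" by simp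
    have "real t2 \<le> max c 0 * (real (length T) * real (length P) powr (1.5 - \<epsilon>) + real (ed_size T))"
      by (rule order_trans[OF t2]) (intro mult_right_mono, auto)
    also have "\<dots> \<le> max c 0 * (61 * K * X)" by (intro mult_left_mono sum) simp
    finally have "real (t1 + (t2 + 2)) \<le> 2000 * K * X + max c 0 * (61 * K * X) + 2 * X" using t1' X by simp
    then have "real (t1 + (t2 + 2)) \<le> c' * X" by (simp add: c'_def algebra_simps)
    then show ?thesis using run result unfolding W_def X_def by blast
  qed
  then have "truly_subcubic_TD prog"
    unfolding truly_subcubic_TD_def solves_TD_def using \<delta>(1) by blast
  moreover have "combinatorial prog"
    unfolding prog_def using closed p projection_reduction projection_answer
    unfolding projection_closed_def by blast
  ultimately show ?thesis by blast
qed

end
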